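(* Fix $d\ge3$. For all sufficiently large odd prime powers $q$ and every nondegenerate quadratic form $Q$ on $\mathbb F_q^d$, the system $(P_{\mathrm{rn}},\mathcal S_{\mathrm{rn}})$ constructed in the context has the following properties. Write $N=|P_{\mathrm{rn}}|$ and $\Sigma=\sigma(P_{\mathrm{rn}},\mathcal S_{\mathrm{rn}})$. (1) Every sphere $S_t$ has nonzero radius. The lifted parameters $\Phi(S_t)$, $t\in\mathbb F_q$, are affinely equivalent to $t\mapsto(t,t^2,\ldots,t^d)\in\mathbb F_q^d$. For every $0\le k\le d-1$, no affine $k$-flat in their $d$-dimensional affine span contains more than $k+1$ lifted parameters. In particular, no coaxal pencil contains three members of $\mathcal S_{\mathrm{rn}}$. (2) The map $A\mapsto p_A$ is injective, $$\binom qd-\frac1d\binom q{d-1}\le N\le\binom qd,\qquad N=\frac{q^d}{d!}+O_d(q^{d-1}),$$ and $p_A\in S_t\iff t\in A$. Consequently every point has degree $d$ (lies on exactly $d$ spheres of $\mathcal S_{\mathrm{rn}}$). For distinct $t,u\in\mathbb F_q$, $$\binom{q-2}{d-2}-\frac1{d-2}\binom{q-2}{d-3}\le|P_{\mathrm{rn}}\cap S_t\cap S_u|\le\binom{q-2}{d-2}.$$ (3) One has $$I(P_{\mathrm{rn}},\mathcal S_{\mathrm{rn}})=dN,\qquad\Sigma=(d-1)N,\qquad K_q=\frac{(d-1)\sqrt N}{q^{d/2}}\longrightarrow\frac{d-1}{\sqrt{d!}}\quad(q\to\infty),$$ where $K_q$ is defined by $\Sigma=K_qq^{(d-1)/2}\sqrt{|P_{\mathrm{rn}}||\mathcal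 S_{\mathrm{rn}}|}$. Moreover, $$K_q^2q^{d-1}|\mathcal S_{\mathrm{rn}}|=(d-1)^2N\ge4N.$$ For all sufficiently large $q$, the system lies in the moderate window $$\frac{4|P_{\mathrm{rn}}|}{K_q^2q^{d-1}}\le|\mathcal S_{\mathrm{rn}}|\le C_1K_qq^{(d-1)/2}$$ with $C_1=2$, and its rich-pair graph is complete: every two distinct $S,S'\in\mathcal S_{\mathrm{rn}}$ satisfy $|P_{\mathrm{rn}}\cap S\cap S'|\ge\frac{K_qq^{(d-1)/2}}{4C_1}$ with $C_1=2$. (4) Every $B\subseteq P_{\mathrm{rn}}$ satisfies $\sigma(B,\mathcal S_{\mathrm{rn}})=(d-1)|B|$. Hence, uniformly over distinct $t,u$, $$\frac{\sigma(P_{\mathrm{rn}}\cap S_t\cap S_u,\mathcal S_{\mathrm{rn}})}{\Sigma}=O_d(q^{-2}).$$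
   Context: Put $\langle x,y\rangle_Q=\frac{Q(x+y)-Q(x)-Q(y)}2$ and $S_Q(c,r)=\{x:Q(x-c)=r\}$; spheres are parametrized by pairs $(c,r)$. $I(P,\mathcal S)=|\{(p,S)\in P\times\mathcal S:p\in S\}|$, $\sigma(P,\mathcal S)=I(P,\mathcal S)-|P||\mathcal S|/q$. The lift is $\Phi(S_Q(c,r))=(2c,r-Q(c))\in\mathbb F_q^{d+1}$; a coaxal pencil is the family of $q$ spheres whose lifts form an affine line. Construction. Use a Witt decomposition $\mathbb F_q^d=\mathbb F_qe\oplus\mathbb F_qf\oplus V_0$ with $Q(xe+yf+z)=xy+Q_\perp(z)$, $Q_\perp$ nondegenerate on the $(d-2)$-dimensional space $V_0$. Fix a basis $u_1,\dots,u_{d-2}$ of $V_0$ and put, for $t\in\mathbb F_q$, $$z_t=\sum_{j=1}^{d-2}t^ju_j,\qquad c_t=t^{d-1}f+z_t,\qquad\gamma=-1-Q(c_1),\qquad g(t)=Q(c_t)+t^d+\gamma t^{d-1}.$$ The map $g:\mathbb F_q\to\mathbb F_q$ is not surjective (as $g(0)=g(1)=0$); choose $\kappa\in\mathbb F_q$ with $-\kappa\notin g(\mathbb F_q)$ and put $$b_t=t^d+\gamma t^{d-1}+\kappa,\qquad r_t=Q(c_t)+b_t,\qquad S_t=S_Q(c_t,r_t).$$ The map $$\Psi(xe+yf+z)(T)=T^d+(x+\gamma)T^{d-1}+\sum_{j=1}^{d-2}2\langle z,u_j\rangle_QT^j+\kappa-Q(xe+yf+z)$$ is a bijection from $\{xe+yf+z:x\in\mathbb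 F_q^\times,\ y\in\mathbb F_q,\ z\in V_0\}$ onto the set of monic degree-$d$ polynomials over $\mathbb F_q$ whose $T^{d-1}$-coefficient is not $\gamma$. Let $$\mathfrak A_{d,\gamma}=\Bigl\{A\subseteq\mathbb F_q:|A|=d,\ -\sum_{a\in A}a\ne\gamma\Bigr\},$$ for $A\in\mathfrak A_{d,\gamma}$ let $p_A$ be the point with $\Psi(p_A)=\prod_{a\in A}(T-a)$, and put $$P_{\mathrm{rn}}=\{p_A:A\in\mathfrak A_{d,\gamma}\},\qquad\mathcal S_{\mathrm{rn}}=\{S_t:t\in\mathbb F_q\}.$$ *)

theory Defs
  imports
    Complex_Main
    "HOL-Algebra.UnivPoly"
    "Jordan_Normal_Form.Missing_VectorSpace"
begin

text \<open>
  A statement that is uniform over all finite fields with sufficiently many elements must quantify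
  over fields inside the formula, so \<open>F\<^sub>q\<close> is a field in the sense of HOL-Algebra with finite
  carrier of size \<open>q\<close>. The type of its elements is arbitrary; already on the type \<^typ>\<open>nat\<close> every
  finite field occurs up to isomorphism.

  Coordinates are numbered from 1.
\<close>

abbreviation coord_space :: "'a ring \<Rightarrow> nat \<Rightarrow> ('a, nat \<Rightarrow> 'a) module" where
  "coord_space R n \<equiv> ring.func_space R {1..n}"

abbreviation two :: "'a ring \<Rightarrow> 'a" where
  "two R \<equiv> \<one>\<^bsub>R\<^esub> \<oplus>\<^bsub>R\<^esub> \<one>\<^bsub>R\<^esub>"


section \<open>Quadratic forms\<close>

definition qf_inner ::
    "'a ring \<Rightarrow> ('a, 'b) module \<Rightarrow> ('b \<Rightarrow> 'a) \<Rightarrow> 'b \<Rightarrow> 'b \<Rightarrow> 'a" where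
  "qf_inner R V Q x y =
     inv\<^bsub>R\<^esub> (two R) \<otimes>\<^bsub>R\<^esub> (Q (x \<oplus>\<^bsub>V\<^esub> y) \<ominus>\<^bsub>R\<^esub> Q x \<ominus>\<^bsub>R\<^esub> Q y)"

text \<open>Only meaningful in odd characteristic. \<open>qf_inner\<close> is visibly symmetric, so linearity in the
  first argument is bilinearity.\<close>

definition quadratic_form :: "'a ring \<Rightarrow> ('a, 'b) module \<Rightarrow> ('b \<Rightarrow> 'a) \<Rightarrow> bool" where
  "quadratic_form R V Q \<longleftrightarrow>
     Q \<in> carrier V \<rightarrow> carrier R \<and>
     (\<forall>a\<in>carrier R. \<forall>x\<in>carrier V. Q (a \<odot>\<^bsub>V\<^esub> x) = a [^]\<^bsub>R\<^esub> (2::nat) \<otimes>\<^bsub>R\<^esub> Q x) \<and>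
     (\<forall>x\<in>carrier V. \<forall>x'\<in>carrier V. \<forall>y\<in>carrier V.
        qf_inner R V Q (x \<oplus>\<^bsub>V\<^esub> x') y = qf_inner R V Q x y \<oplus>\<^bsub>R\<^esub> qf_inner R V Q x' y) \<and>
     (\<forall>a\<in>carrier R. \<forall>x\<in>carrier V. \<forall>y\<in>carrier V.
        qf_inner R V Q (a \<odot>\<^bsub>V\<^esub> x) y = a \<otimes>\<^bsub>R\<^esub> qf_inner R V Q x y)"

definition nondegenerate_on ::
    "'a ring \<Rightarrow> ('a, 'b) module \<Rightarrow> ('b \<Rightarrow> 'a) \<Rightarrow> 'b set \<Rightarrow> bool" where
  "nondegenerate_on R V Q W \<longleftrightarrow>
     (\<forall>x\<in>W. (\<forall>y\<in>W. qf_inner R V Q x y = \<zero>\<^bsub>R\<^esub>) \<longrightarrow> x = \<zero>\<^bsub>V\<^esub>)"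

definition odd_quadratic_space :: "'a ring \<Rightarrow> nat \<Rightarrow> ((nat \<Rightarrow> 'a) \<Rightarrow> 'a) \<Rightarrow> bool" where
  "odd_quadratic_space R d Q \<longleftrightarrow>
     field R \<and> finite (carrier R) \<and> odd (order R) \<and>
     quadratic_form R (coord_space R d) Q \<and>
     nondegenerate_on R (coord_space R d) Q (carrier (coord_space R d))"


section \<open>Affine geometry\<close>

definition affine_flat :: "'a ring \<Rightarrow> ('a, 'b) module \<Rightarrow> nat \<Rightarrow> 'b set \<Rightarrow> bool" where
  "affine_flat R M k F \<longleftrightarrow>
     (\<exists>a\<in>carrier M. \<exists>W. subspace R W M \<and> vectorspace.dim R (M\<lparr>carrier := W\<rparr>) = k \<and>
        F = (\<lambda>w. a \<oplus>\<^bsub>M\<^esub> w) ` W)"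

definition affine_span :: "'a ring \<Rightarrow> ('a, 'b) module \<Rightarrow> 'b set \<Rightarrow> 'b set" where
  "affine_span R M X = \<Inter> {F. X \<subseteq> F \<and> (\<exists>k. affine_flat R M k F)}"

definition affine_map ::
    "'a ring \<Rightarrow> ('a, 'b) module \<Rightarrow> ('a, 'c) module \<Rightarrow> ('b \<Rightarrow> 'c) \<Rightarrow> bool" where
  "affine_map R M N L \<longleftrightarrow>
     (\<exists>T. \<exists>b\<in>carrier N. linear_map R M N T \<and> (\<forall>x\<in>carrier M. L x = b \<oplus>\<^bsub>N\<^esub> T x))"

definition moment_curve :: "'a ring \<Rightarrow> nat \<Rightarrow> 'a \<Rightarrow> (nat \<Rightarrow> 'a)" where
  "moment_curve R d t = (\<lambda>i\<in>{1..d}. t [^]\<^bsub>R\<^esub> i)"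


section \<open>Spheres\<close>

text \<open>Families of spheres are sets of parameters \<open>(c, r)\<close>; \<open>sphere_pts\<close> is the point set.\<close>

type_synonym 'a sphere = "(nat \<Rightarrow> 'a) \<times> 'a"

definition sphere_pts ::
    "'a ring \<Rightarrow> nat \<Rightarrow> ((nat \<Rightarrow> 'a) \<Rightarrow> 'a) \<Rightarrow> 'a sphere \<Rightarrow> (nat \<Rightarrow> 'a) set" where
  "sphere_pts R d Q S =
     {x \<in> carrier (coord_space R d). Q (x \<ominus>\<^bsub>coord_space R d\<^esub> fst S) = snd S}"

definition incidences ::
    "'a ring \<Rightarrow> nat \<Rightarrow> ((nat \<Rightarrow> 'a) \<Rightarrow> 'a) \<Rightarrow> (nat \<Rightarrow> 'a) set \<Rightarrow> 'a sphere set \<Rightarrow> nat" where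
  "incidences R d Q P \<S> = card {(p, S). p \<in> P \<and> S \<in> \<S> \<and> p \<in> sphere_pts R d Q S}"

text \<open>The quantity \<open>\<sigma>(P,\<S>)\<close>.\<close>

definition excess ::
    "'a ring \<Rightarrow> nat \<Rightarrow> ((nat \<Rightarrow> 'a) \<Rightarrow> 'a) \<Rightarrow> (nat \<Rightarrow> 'a) set \<Rightarrow> 'a sphere set \<Rightarrow> real" where
  "excess R d Q P \<S> =
     real (incidences R d Q P \<S>) - real (card P) * real (card \<S>) / real (order R)"

text \<open>The solution \<open>K\<close> of \<open>\<sigma>(P,\<S>) = K q^((d-1)/2) sqrt(|P| |\<S>|)\<close>.\<close>

definition K_const ::
    "'a ring \<Rightarrow> nat \<Rightarrow> ((nat \<Rightarrow> 'a) \<Rightarrow> 'a) \<Rightarrow> (nat \<Rightarrow> 'a) set \<Rightarrow> 'a sphere set \<Rightarrow> real" where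
  "K_const R d Q P \<S> =
     excess R d Q P \<S> /
       (real (order R) powr ((real d - 1) / 2) * sqrt (real (card P) * real (card \<S>)))"

definition sphere_lift :: "'a ring \<Rightarrow> nat \<Rightarrow> ((nat \<Rightarrow> 'a) \<Rightarrow> 'a) \<Rightarrow> 'a sphere \<Rightarrow> (nat \<Rightarrow> 'a)" where
  "sphere_lift R d Q S =
     (\<lambda>i\<in>{1..d+1}. if i \<le> d then two R \<otimes>\<^bsub>R\<^esub> fst S i else snd S \<ominus>\<^bsub>R\<^esub> Q (fst S))"

definition coaxal_pencil ::
    "'a ring \<Rightarrow> nat \<Rightarrow> ((nat \<Rightarrow> 'a) \<Rightarrow> 'a) \<Rightarrow> 'a sphere set \<Rightarrow> bool" where
  "coaxal_pencil R d Q \<P> \<longleftrightarrow>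
     \<P> \<subseteq> carrier (coord_space R d) \<times> carrier R \<and> card \<P> = order R \<and>
     affine_flat R (coord_space R (d+1)) 1 (sphere_lift R d Q ` \<P>)"


section \<open>The rational normal system\<close>

locale rn_data =
  fixes R :: "'a ring" (structure)
    and d :: nat
    and Q :: "(nat \<Rightarrow> 'a) \<Rightarrow> 'a"
    and e f :: "nat \<Rightarrow> 'a"
    and V0 :: "(nat \<Rightarrow> 'a) set"
    and u :: "nat \<Rightarrow> (nat \<Rightarrow> 'a)"
    and \<kappa> :: 'a
begin

abbreviation V :: "('a, nat \<Rightarrow> 'a) module" where
  "V \<equiv> coord_space R d"

definition pt :: "'a \<Rightarrow> 'a \<Rightarrow> (nat \<Rightarrow> 'a) \<Rightarrow> (nat \<Rightarrow> 'a)" where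
  "pt x y z = x \<odot>\<^bsub>V\<^esub> e \<oplus>\<^bsub>V\<^esub> y \<odot>\<^bsub>V\<^esub> f \<oplus>\<^bsub>V\<^esub> z"

definition zvec :: "'a \<Rightarrow> (nat \<Rightarrow> 'a)" where
  "zvec t = (\<Oplus>\<^bsub>V\<^esub>j\<in>{1..d-2}. (t [^] j) \<odot>\<^bsub>V\<^esub> u j)"

definition center :: "'a \<Rightarrow> (nat \<Rightarrow> 'a)" where
  "center t = (t [^] (d-1)) \<odot>\<^bsub>V\<^esub> f \<oplus>\<^bsub>V\<^esub> zvec t"

definition gam :: 'a where
  "gam = \<ominus> \<one> \<ominus> Q (center \<one>)"

definition gfun :: "'a \<Rightarrow> 'a" where
  "gfun t = Q (center t) \<oplus> t [^] d \<oplus> gam \<otimes> t [^] (d-1)"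

definition bval :: "'a \<Rightarrow> 'a" where
  "bval t = t [^] d \<oplus> gam \<otimes> t [^] (d-1) \<oplus> \<kappa>"

definition radius :: "'a \<Rightarrow> 'a" where
  "radius t = Q (center t) \<oplus> bval t"

definition rn_sphere :: "'a \<Rightarrow> 'a sphere" where
  "rn_sphere t = (center t, radius t)"

definition rn_spheres :: "'a sphere set" where
  "rn_spheres = rn_sphere ` carrier R"

text \<open>\<open>Psi x y z\<close> is the polynomial \<open>\<Psi>(xe+yf+z)\<close>.\<close>

definition Psi :: "'a \<Rightarrow> 'a \<Rightarrow> (nat \<Rightarrow> 'a) \<Rightarrow> (nat \<Rightarrow> 'a)" where
  "Psi x y z =
     monom (UP R) \<one> d \<oplus>\<^bsub>UP R\<^esub> monom (UP R) (x \<oplus> gam) (d-1)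
     \<oplus>\<^bsub>UP R\<^esub> (\<Oplus>\<^bsub>UP R\<^esub>j\<in>{1..d-2}. monom (UP R) (two R \<otimes> qf_inner R V Q z (u j)) j)
     \<oplus>\<^bsub>UP R\<^esub> monom (UP R) (\<kappa> \<ominus> Q (pt x y z)) 0"

definition root_poly :: "'a set \<Rightarrow> (nat \<Rightarrow> 'a)" where
  "root_poly A = (\<Otimes>\<^bsub>UP R\<^esub>a\<in>A. monom (UP R) \<one> 1 \<ominus>\<^bsub>UP R\<^esub> monom (UP R) a 0)"

definition rn_sets :: "'a set set" where
  "rn_sets = {A. A \<subseteq> carrier R \<and> card A = d \<and> \<ominus> (\<Oplus>a\<in>A. a) \<noteq> gam}"

text \<open>Only points with \<open>x \<noteq> 0\<close> are considered: this is the domain on which \<open>\<Psi>\<close> is a bijection.\<close>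

definition rn_point :: "'a set \<Rightarrow> (nat \<Rightarrow> 'a)" where
  "rn_point A =
     (THE p. \<exists>x\<in>carrier R - {\<zero>}. \<exists>y\<in>carrier R. \<exists>z\<in>V0.
        p = pt x y z \<and> Psi x y z = root_poly A)"

definition rn_points :: "(nat \<Rightarrow> 'a) set" where
  "rn_points = rn_point ` rn_sets"

end

text \<open>\<open>Q\<^sub>\<bottom>\<close> is the restriction of \<open>Q\<close> to \<open>V0\<close>, as \<open>Q(xe+yf+z) = xy + Q\<^sub>\<bottom>(z)\<close> forces
  by putting \<open>x = y = 0\<close>.\<close>

locale rn_construction = rn_data +
  assumes space: "odd_quadratic_space R d Q"
    and e_closed: "e \<in> carrier V" and f_closed: "f \<in> carrier V"
    and V0_subspace: "subspace R V0 V"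
    and direct_sum: "bij_betw (\<lambda>(x, y, z). pt x y z) (carrier R \<times> carrier R \<times> V0) (carrier V)"
    and Q_decomp: "\<And>x y z. x \<in> carrier R \<Longrightarrow> y \<in> carrier R \<Longrightarrow> z \<in> V0 \<Longrightarrow>
                     Q (pt x y z) = x \<otimes> y \<oplus> Q z"
    and V0_nondegenerate: "nondegenerate_on R V Q V0"
    and u_inj: "inj_on u {1..d-2}"
    and u_basis: "vectorspace.basis R (V\<lparr>carrier := V0\<rparr>) (u ` {1..d-2})"
    and kappa_closed: "\<kappa> \<in> carrier R"
    and kappa_choice: "\<ominus> \<kappa> \<notin> gfun ` carrier R"

end

theory Submission
  imports Defs "HOL-Algebra.Multiplicative_Group"
begin

text \<open>
  Expanding \<open>Q(p - c\<^sub>t) = r\<^sub>t\<close> for \<open>p = xe + yf + z\<close> gives the equation \<open>\<Psi>(p)(t) = 0\<close>, because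
  \<open>2\<langle>p, c\<^sub>t\<rangle> = x t\<^bsup>d-1\<^esup> + \<Sum>\<^sub>j 2\<langle>z, u\<^sub>j\<rangle> t\<^sup>j\<close>. Hence \<open>p\<^sub>A\<close> lies on \<open>S\<^sub>t\<close> exactly when \<open>t\<close> is a root of
  \<open>\<Prod>\<^bsub>a\<in>A\<^esub> (T - a)\<close>, and all incidence counts become counts of \<open>d\<close>-subsets of the field whose sum
  avoids one value.

  The lifted parameters are an injective affine image of the moment curve, and by Vandermonde the
  chords of the moment curve through a common point are independent, up to \<open>d\<close> of them. Dimensions
  are compared by counting: a space of dimension \<open>k\<close> over the field has \<open>q\<^sup>k\<close> elements.

  The construction is possible for every nondegenerate \<open>Q\<close> on a space of dimension at least 3:
  among pairwise orthogonal anisotropic \<open>v\<close>, \<open>w\<close>, \<open>z\<close> the value \<open>-Q(z)\<close> is represented by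
  \<open>a\<^sup>2 Q(v) + b\<^sup>2 Q(w)\<close>, since both \<open>a\<^sup>2 Q(v)\<close> and \<open>-Q(z) - b\<^sup>2 Q(w)\<close> take more than \<open>q/2\<close> values.
\<close>

section \<open>Linear algebra over finite fields\<close>

text \<open>The summand Q(c_t) of the radius cancels twice: in the sphere equation, so that r_t -
  Q(p - c_t) is a polynomial of degree d in t, and in the lift, so that the lifted parameters are
  affine in the powers of t. It survives only in r_t = g(t) + kappa, which is why the
  nonsurjectivity of g is needed for nonzero radii. The sets A with forbidden sum are excluded
  because recovering p_A from its polynomial divides by x, the T^(d-1)-coefficient minus
  \<open>gam\<close>. The exclusion removes only O(q^(d-1)) sets, so N keeps the leading term
  q^d/d!. The estimates are tight in the exponent of q exactly at d = 3: in
  \<open>window_upper\<close> and \<open>rich_pair\<close> both sides then have the same order and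
  only constants decide, while for d >= 4 a spare factor q absorbs a factorial. This splits both
  proofs into two cases.\<close>

lemma (in vectorspace) card_carrier_eq:
  assumes "finite (carrier K)" "finite (carrier V)"
  shows "card (carrier V) = order K ^ dim"
proof -
  have "span (carrier V) = carrier V"
  proof
    show "span (carrier V) \<subseteq> carrier V" by (rule span_is_subset2) simp
    show "carrier V \<subseteq> span (carrier V)" by (rule in_own_span) simp
  qed
  with assms(2) have "fin_dim"
    unfolding fin_dim_def by blast
  from finite_basis_exists[OF this] obtain B where B: "finite B" "basis B"
    by auto
  then have BV: "B \<subseteq> carrier V"
    unfolding basis_def by simp
  have ex1: "\<forall>v. v \<in> carrier V \<longrightarrow> (\<exists>!a. a \<in> B \<rightarrow>\<^sub>E carrier K \<and> lincomb a B = v)"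
    using basis_criterion[OF B(1) BV] B(2) by (rule iffD1)
  have closed: "lincomb a B \<in> carrier V" if "a \<in> B \<rightarrow>\<^sub>E carrier K" for a
    using BV that by (intro lincomb_closed) auto
  have "bij_betw (\<lambda>a. lincomb a B) (B \<rightarrow>\<^sub>E carrier K) (carrier V)"
    unfolding bij_betw_def
  proof
    show "inj_on (\<lambda>a. lincomb a B) (B \<rightarrow>\<^sub>E carrier K)"
    proof (rule inj_onI)
      fix a b assume ab: "a \<in> B \<rightarrow>\<^sub>E carrier K" "b \<in> B \<rightarrow>\<^sub>E carrier K" "lincomb a B = lincomb b B"
      from ex1 closed[OF ab(2)] have "\<exists>!c. c \<in> B \<rightarrow>\<^sub>E carrier K \<and> lincomb c B = lincomb b B"
        by simp
      with ab show "a = b"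
        by (elim ex1E) metis
    qed
    show "(\<lambda>a. lincomb a B) ` (B \<rightarrow>\<^sub>E carrier K) = carrier V"
    proof
      show "(\<lambda>a. lincomb a B) ` (B \<rightarrow>\<^sub>E carrier K) \<subseteq> carrier V"
        by (rule image_subsetI) (rule closed)
      show "carrier V \<subseteq> (\<lambda>a. lincomb a B) ` (B \<rightarrow>\<^sub>E carrier K)"
      proof
        fix v assume "v \<in> carrier V"
        with ex1 have "\<exists>!a. a \<in> B \<rightarrow>\<^sub>E carrier K \<and> lincomb a B = v"
          by simp
        then obtain a where "a \<in> B \<rightarrow>\<^sub>E carrier K" "lincomb a B = v"
          by (elim ex1E conjE)
        then show "v \<in> (\<lambda>a. lincomb a B) ` (B \<rightarrow>\<^sub>E carrier K)"
          by (intro image_eqI) (rule sym)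
      qed
    qed
  qed
  from bij_betw_same_card[OF this] show ?thesis
    using B by (simp add: card_PiE order_def dim_basis)
qed

context ring
begin

lemma func_space_carrier: "carrier (func_space A) = A \<rightarrow>\<^sub>E carrier R"
  and func_space_add: "x \<oplus>\<^bsub>func_space A\<^esub> y = (\<lambda>i\<in>A. x i \<oplus> y i)"
  and func_space_smult: "c \<odot>\<^bsub>func_space A\<^esub> x = (\<lambda>i\<in>A. c \<otimes> x i)"
  and func_space_zero: "\<zero>\<^bsub>func_space A\<^esub> = (\<lambda>i\<in>A. \<zero>)"
  by (simp_all add: func_space_def)

end

context field
begin

lemma vectorspace_func_space: "vectorspace R (func_space A)"
  using func_space_is_module field_axioms unfolding vectorspace_def by blast

lemma func_space_finsum:
  assumes "finite I" "\<And>i. i \<in> I \<Longrightarrow> g i \<in> carrier (func_space A)" "a \<in> A"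
  shows "(\<Oplus>\<^bsub>func_space A\<^esub>i\<in>I. g i) a = (\<Oplus>i\<in>I. g i a)"
proof -
  interpret F: vectorspace R "func_space A" by (rule vectorspace_func_space)
  show ?thesis
    using assms(1,2)
  proof (induction I rule: finite_induct)
    case empty
    then show ?case using assms(3) by (simp add: func_space_zero)
  next
    case (insert x I)
    have "(\<Oplus>\<^bsub>func_space A\<^esub>i\<in>insert x I. g i) = g x \<oplus>\<^bsub>func_space A\<^esub> (\<Oplus>\<^bsub>func_space A\<^esub>i\<in>I. g i)"
      using insert by (intro F.M.finsum_insert) auto
    moreover have "g i a \<in> carrier R" if "i \<in> insert x I" for i
      using insert.prems[OF that] assms(3) by (auto simp: func_space_carrier PiE_iff)
    moreover from this have "(\<Oplus>i\<in>insert x I. g i a) = g x a \<oplus> (\<Oplus>i\<in>I. g i a)"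
      using insert.hyps by (intro finsum_insert) auto
    ultimately show ?case
      using insert assms(3) by (simp add: func_space_add)
  qed
qed

text \<open>Multiplying the coefficient of a by a - b removes the point b and costs one equation:
  the new j-th sum is the old (j+1)-st minus b times the old j-th. Since a - b is nonzero, induction
  gives c a = 0 on A, and the equation j = 0 then leaves c b = 0.\<close>

lemma vandermonde_trivial:
  assumes "finite A" "A \<subseteq> carrier R" "c \<in> A \<rightarrow> carrier R"
    and "\<And>j. j < card A \<Longrightarrow> (\<Oplus>a\<in>A. c a \<otimes> a [^] (j::nat)) = \<zero>"
  shows "\<forall>a\<in>A. c a = \<zero>"
  using assms
proof (induction A arbitrary: c rule: finite_induct)
  case empty
  then show ?case by simp
next
  case (insert b A)
  note A = \<open>insert b A \<subseteq> carrier R\<close> and c = \<open>c \<in> insert b A \<rightarrow> carrier R\<close>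
  have b: "b \<in> carrier R" and AR: "A \<subseteq> carrier R" and cb: "c b \<in> carrier R"
    and cA: "\<And>a. a \<in> A \<Longrightarrow> c a \<in> carrier R" "\<And>a. a \<in> A \<Longrightarrow> a \<in> carrier R"
    using A c by auto
  have pow_step: "x \<otimes> (y \<otimes> a) = x \<otimes> (a \<ominus> b) \<otimes> y \<oplus> b \<otimes> (x \<otimes> y)"
    if "x \<in> carrier R" "y \<in> carrier R" "a \<in> carrier R" "b \<in> carrier R" for x y a b
    using that by algebra
  let ?c = "\<lambda>a. c a \<otimes> (a \<ominus> b)"
  have sum0: "(\<Oplus>a\<in>A. ?c a \<otimes> a [^] (j::nat)) = \<zero>" if "j < card A" for j
  proof -
    have eq: "(\<Oplus>a\<in>insert b A. c a \<otimes> a [^] (i::nat)) = \<zero>" if "i < Suc (card A)" for i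
      using insert.prems(3)[of i] insert.hyps that by simp
    have ins: "(\<Oplus>a\<in>insert b A. c a \<otimes> a [^] (i::nat)) =
        c b \<otimes> b [^] i \<oplus> (\<Oplus>a\<in>A. c a \<otimes> a [^] i)" for i
      using insert.hyps cA b cb by (intro finsum_insert) auto
    have split: "(\<Oplus>a\<in>A. c a \<otimes> a [^] (Suc j)) =
        (\<Oplus>a\<in>A. ?c a \<otimes> a [^] j) \<oplus> b \<otimes> (\<Oplus>a\<in>A. c a \<otimes> a [^] j)"
    proof -
      have "(\<Oplus>a\<in>A. c a \<otimes> a [^] (Suc j)) =
          (\<Oplus>a\<in>A. ?c a \<otimes> a [^] j \<oplus> b \<otimes> (c a \<otimes> a [^] j))"
      proof (intro finsum_cong' refl)
        fix a assume "a \<in> A"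
        then show "c a \<otimes> a [^] Suc j = ?c a \<otimes> a [^] j \<oplus> b \<otimes> (c a \<otimes> a [^] j)"
          using pow_step[of "c a" "a [^] j" a b] cA[of a] b by simp
      qed (use cA b in auto)
      also have "\<dots> = (\<Oplus>a\<in>A. ?c a \<otimes> a [^] j) \<oplus> (\<Oplus>a\<in>A. b \<otimes> (c a \<otimes> a [^] j))"
        by (intro finsum_addf) (use cA b in auto)
      also have "(\<Oplus>a\<in>A. b \<otimes> (c a \<otimes> a [^] j)) = b \<otimes> (\<Oplus>a\<in>A. c a \<otimes> a [^] j)"
        by (rule finsum_rdistr[symmetric]) (use insert.hyps cA b in auto)
      finally show ?thesis .
    qed
    define s where "s = (\<Oplus>a\<in>A. c a \<otimes> a [^] j)"
    define s' where "s' = (\<Oplus>a\<in>A. ?c a \<otimes> a [^] j)"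
    define p where "p = c b \<otimes> b [^] j"
    have cl: "s \<in> carrier R" "s' \<in> carrier R" "p \<in> carrier R"
      unfolding s_def s'_def p_def using cA b cb by (auto intro!: finsum_closed)
    have "p \<oplus> s = \<zero>"
      using eq[of j] ins[of j] that unfolding s_def p_def by simp
    moreover have "p \<otimes> b \<oplus> (s' \<oplus> b \<otimes> s) = \<zero>"
    proof -
      have "p \<otimes> b = c b \<otimes> b [^] Suc j"
        unfolding p_def using b cb by (simp add: m_assoc)
      moreover have "c b \<otimes> b [^] Suc j \<oplus> (\<Oplus>a\<in>A. c a \<otimes> a [^] Suc j) = \<zero>"
        using eq[of "Suc j"] ins[of "Suc j"] that by (simp del: nat_pow_Suc)
      ultimately show ?thesis
        unfolding s_def s'_def split by (simp del: nat_pow_Suc)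
    qed
    moreover have "p \<otimes> b \<oplus> (s' \<oplus> b \<otimes> s) = s' \<oplus> b \<otimes> (p \<oplus> s)"
      using cl b by algebra
    ultimately show ?thesis
      using cl b unfolding s'_def by simp
  qed
  have "\<forall>a\<in>A. ?c a = \<zero>"
    by (rule insert.IH) (use AR cA b sum0 in auto)
  then have zero: "c a = \<zero>" if "a \<in> A" for a
  proof -
    have "c a \<otimes> (a \<ominus> b) = \<zero>" "a \<noteq> b"
      using \<open>\<forall>a\<in>A. ?c a = \<zero>\<close> that insert.hyps(2) by auto
    then show ?thesis
      using integral[of "c a" "a \<ominus> b"] cA[OF that] b r_right_minus_eq[of a b] by simp
  qed
  have "(\<Oplus>a\<in>A. c a \<otimes> a [^] (0::nat)) = (\<Oplus>a\<in>A. \<zero>)"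
    by (intro finsum_cong') (use zero cA in auto)
  moreover have "(\<Oplus>a\<in>insert b A. c a \<otimes> a [^] (0::nat)) = c b \<otimes> b [^] (0::nat) \<oplus> (\<Oplus>a\<in>A. c a \<otimes> a [^] (0::nat))"
    using insert.hyps cA b cb by (intro finsum_insert) auto
  moreover have "(\<Oplus>a\<in>insert b A. c a \<otimes> a [^] (0::nat)) = \<zero>"
    using insert.hyps by (intro insert.prems(3)) simp
  ultimately have "c b \<otimes> b [^] (0::nat) \<oplus> (\<Oplus>a\<in>A. \<zero>) = \<zero>"
    by argo
  then have "c b = \<zero>"
    using cb by simp
  with zero show ?case by blast
qed

end

section \<open>Quadratic forms over finite fields\<close>

text \<open>Every fibre lies in a pair {a, g a}. It is applied to a scaled and shifted squaring map,
  with negation as g.\<close>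

lemma card_le_two_image:
  assumes "finite A" "\<And>a b. a \<in> A \<Longrightarrow> b \<in> A \<Longrightarrow> f a = f b \<Longrightarrow> b = a \<or> b = g a"
  shows "card A \<le> 2 * card (f ` A)"
proof -
  have "A = (\<Union>v\<in>f ` A. {b \<in> A. f b = v})"
    by blast
  moreover have "card (\<Union>v\<in>f ` A. {b \<in> A. f b = v}) \<le> (\<Sum>v\<in>f ` A. card {b \<in> A. f b = v})"
    by (rule card_UN_le) (use assms(1) in simp)
  moreover have "card {b \<in> A. f b = v} \<le> 2" if "v \<in> f ` A" for v
  proof -
    from that obtain a where "a \<in> A" "f a = v"
      by blast
    then have "{b \<in> A. f b = v} \<subseteq> {a, g a}"
      using assms(2)[of a] by (smt (verit) insertCI mem_Collect_eq subsetI)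
    then have "card {b \<in> A. f b = v} \<le> card {a, g a}"
      by (rule card_mono[rotated]) simp
    also have "\<dots> \<le> 2"
      by (simp add: card_insert_if)
    finally show ?thesis .
  qed
  ultimately show ?thesis
    using sum_bounded_above[of "f ` A" "\<lambda>v. card {b \<in> A. f b = v}" 2] by simp
qed

section \<open>Odd order and the values of squares\<close>

context field
begin

text \<open>If 1 + 1 = 0, then 1 has additive order 2, and by Lagrange 2 divides the order of the
  field.\<close>

lemma two_nonzero:
  assumes "finite (carrier R)" "odd (order R)"
  shows "\<one> \<oplus> \<one> \<noteq> \<zero>"
proof
  assume two0: "\<one> \<oplus> \<one> = \<zero>"
  have "\<one> [^]\<^bsub>add_monoid R\<^esub> (2::nat) = \<one>\<^bsub>add_monoid R\<^esub>"
    using two0 by (simp add: numeral_2_eq_2)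
  then have "group.ord (add_monoid R) \<one> dvd 2"
    using group.pow_eq_id[OF a_group, of \<one> 2] by simp
  moreover have "group.ord (add_monoid R) \<one> \<noteq> 1"
    using group.ord_eq_1[OF a_group, of \<one>] by simp
  ultimately have "group.ord (add_monoid R) \<one> = 2"
    using dvd_imp_le[of "group.ord (add_monoid R) \<one>" 2]
    by (cases "group.ord (add_monoid R) \<one> = 0") auto
  then show False
    using group.ord_dvd_group_order[OF a_group, of \<one>] assms(2) by (simp add: order_def)
qed

lemma square_eq_square:
  assumes "a \<in> carrier R" "b \<in> carrier R" "a [^] (2::nat) = b [^] (2::nat)"
  shows "b = a \<or> b = \<ominus> a"
proof -
  have "(b \<ominus> a) \<otimes> (b \<oplus> a) = b \<otimes> b \<ominus> a \<otimes> a"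
    using assms(1,2) by algebra
  also have "\<dots> = \<zero>"
    using assms by (simp add: numeral_2_eq_2)
  finally have "b \<ominus> a = \<zero> \<or> b \<oplus> a = \<zero>"
    using assms(1,2) by (simp add: integral_iff)
  then show ?thesis
    using assms(1,2) minus_equality[of b a] by (auto simp: r_right_minus_eq)
qed

text \<open>Each value is attained at most at a and -a, so q is at most twice the number of values;
  as q is odd, equality is impossible. The strictness is what forces two such value sets to
  meet.\<close>

lemma card_square_image:
  assumes "finite (carrier R)" "odd (order R)"
    and "\<alpha> \<in> carrier R" "\<alpha> \<noteq> \<zero>" "\<gamma> \<in> carrier R"
  shows "order R < 2 * card ((\<lambda>a. \<gamma> \<oplus> \<alpha> \<otimes> a [^] (2::nat)) ` carrier R)"
proof -
  have "order R \<le> 2 * card ((\<lambda>a. \<gamma> \<oplus> \<alpha> \<otimes> a [^] (2::nat)) ` carrier R)"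
    unfolding order_def
  proof (rule card_le_two_image[where g = "\<lambda>a. \<ominus> a"])
    fix a b assume ab: "a \<in> carrier R" "b \<in> carrier R"
      "\<gamma> \<oplus> \<alpha> \<otimes> a [^] (2::nat) = \<gamma> \<oplus> \<alpha> \<otimes> b [^] (2::nat)"
    then have "\<alpha> \<otimes> a [^] (2::nat) = \<alpha> \<otimes> b [^] (2::nat)"
      using assms arg_cong[OF ab(3), of "\<lambda>z. \<ominus> \<gamma> \<oplus> z"] by (simp add: r_neg1)
    then have "a [^] (2::nat) = b [^] (2::nat)"
      using assms ab m_lcancel by simp
    with ab show "b = a \<or> b = \<ominus> a"
      using square_eq_square by blast
  qed fact
  with assms(2) show ?thesis
    by (metis dvd_triv_left le_neq_implies_less)
qed

lemma diagonal_binary_universal: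
  assumes "finite (carrier R)" "odd (order R)"
    and "\<alpha> \<in> carrier R" "\<alpha> \<noteq> \<zero>" "\<beta> \<in> carrier R" "\<beta> \<noteq> \<zero>" "\<gamma> \<in> carrier R"
  obtains a b where "a \<in> carrier R" "b \<in> carrier R"
    "\<alpha> \<otimes> a [^] (2::nat) \<oplus> \<beta> \<otimes> b [^] (2::nat) = \<gamma>"
proof -
  let ?A = "(\<lambda>a. \<zero> \<oplus> \<alpha> \<otimes> a [^] (2::nat)) ` carrier R"
  let ?B = "(\<lambda>b. \<gamma> \<oplus> (\<ominus> \<beta>) \<otimes> b [^] (2::nat)) ` carrier R"
  have nz: "\<ominus> \<beta> \<noteq> \<zero>"
    using assms(5,6) by (simp add: minus_nonzero)
  have "?A \<inter> ?B \<noteq> {}"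
  proof
    assume "?A \<inter> ?B = {}"
    then have "card ?A + card ?B = card (?A \<union> ?B)"
      using assms(1) by (intro card_Un_disjoint[symmetric]) auto
    also have "\<dots> \<le> order R"
      unfolding order_def using assms by (intro card_mono) auto
    finally show False
      using card_square_image[OF assms(1,2,3,4) zero_closed]
        card_square_image[OF assms(1,2) _ nz assms(7)] assms(5) by simp
  qed
  then obtain a b where ab: "a \<in> carrier R" "b \<in> carrier R"
    "\<zero> \<oplus> \<alpha> \<otimes> a [^] (2::nat) = \<gamma> \<oplus> (\<ominus> \<beta>) \<otimes> b [^] (2::nat)"
    by blast
  define s t where "s = a [^] (2::nat)" and "t = b [^] (2::nat)"
  have "s \<in> carrier R" "t \<in> carrier R"
    unfolding s_def t_def using ab by simp_all
  then have "\<alpha> \<otimes> s \<oplus> \<beta> \<otimes> t = (\<gamma> \<oplus> (\<ominus> \<beta>) \<otimes> t) \<oplus> \<beta> \<otimes> t"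
    using ab(3) assms(3) unfolding s_def[symmetric] t_def[symmetric] by simp
  also have "\<dots> = \<gamma>"
    using \<open>t \<in> carrier R\<close> assms(5,7) by algebra
  finally show ?thesis
    using that ab(1,2) unfolding s_def t_def by blast
qed

end

text \<open>Only 2 nonzero is assumed, so that the algebra of \<open>Q\<close> and \<open>B\<close>
  is independent of finiteness; counting enters with \<open>exists_orthogonal\<close>.\<close>

locale quadratic_space = vectorspace K V
  for K :: "'a ring" (structure) and V :: "('a, 'v) module" +
  fixes Q :: "'v \<Rightarrow> 'a"
  assumes quadratic_form: "quadratic_form K V Q"
    and two_nz: "two K \<noteq> \<zero>"
begin

abbreviation B :: "'v \<Rightarrow> 'v \<Rightarrow> 'a" where
  "B \<equiv> qf_inner K V Q"

lemma Q_closed [simp]: "x \<in> carrier V \<Longrightarrow> Q x \<in> carrier K"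
  using quadratic_form unfolding quadratic_form_def by blast

lemma Q_smult: "a \<in> carrier K \<Longrightarrow> x \<in> carrier V \<Longrightarrow> Q (a \<odot>\<^bsub>V\<^esub> x) = a [^] (2::nat) \<otimes> Q x"
  using quadratic_form unfolding quadratic_form_def by blast

lemma two_closed [simp]: "two K \<in> carrier K"
  by simp

lemma inv_two_closed [simp]: "inv (two K) \<in> carrier K"
  using two_nz field_Units by (intro Units_inv_closed) simp

lemma inv_two [simp]: "inv (two K) \<otimes> two K = \<one>" "two K \<otimes> inv (two K) = \<one>"
  using two_nz field_Units by simp_all

lemma B_closed [simp]: "x \<in> carrier V \<Longrightarrow> y \<in> carrier V \<Longrightarrow> B x y \<in> carrier K"
  unfolding qf_inner_def by (simp del: two_closed)

lemma B_sym: "x \<in> carrier V \<Longrightarrow> y \<in> carrier V \<Longrightarrow> B x y = B y x"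
proof -
  assume xy: "x \<in> carrier V" "y \<in> carrier V"
  have "a \<ominus> b \<ominus> c = a \<ominus> c \<ominus> b" if "a \<in> carrier K" "b \<in> carrier K" "c \<in> carrier K" for a b c
    using that by algebra
  with xy show ?thesis
    unfolding qf_inner_def by (simp add: M.a_comm)
qed

lemma B_add_left: "x \<in> carrier V \<Longrightarrow> x' \<in> carrier V \<Longrightarrow> y \<in> carrier V \<Longrightarrow>
    B (x \<oplus>\<^bsub>V\<^esub> x') y = B x y \<oplus> B x' y"
  using quadratic_form unfolding quadratic_form_def by blast

lemma B_smult_left: "a \<in> carrier K \<Longrightarrow> x \<in> carrier V \<Longrightarrow> y \<in> carrier V \<Longrightarrow>
    B (a \<odot>\<^bsub>V\<^esub> x) y = a \<otimes> B x y"
  using quadratic_form unfolding quadratic_form_def by blast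

lemma B_add_right: "x \<in> carrier V \<Longrightarrow> y \<in> carrier V \<Longrightarrow> y' \<in> carrier V \<Longrightarrow>
    B x (y \<oplus>\<^bsub>V\<^esub> y') = B x y \<oplus> B x y'"
  using B_add_left[of y y' x] B_sym by simp

lemma B_smult_right: "a \<in> carrier K \<Longrightarrow> x \<in> carrier V \<Longrightarrow> y \<in> carrier V \<Longrightarrow>
    B x (a \<odot>\<^bsub>V\<^esub> y) = a \<otimes> B x y"
  using B_smult_left[of a y x] B_sym by simp

lemma B_zero [simp]:
  assumes "x \<in> carrier V"
  shows "B \<zero>\<^bsub>V\<^esub> x = \<zero>" "B x \<zero>\<^bsub>V\<^esub> = \<zero>"
proof -
  show "B \<zero>\<^bsub>V\<^esub> x = \<zero>"
    using B_smult_left[of \<zero> "\<zero>\<^bsub>V\<^esub>" x] assms by simp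
  then show "B x \<zero>\<^bsub>V\<^esub> = \<zero>"
    using B_sym[of x "\<zero>\<^bsub>V\<^esub>"] assms by simp
qed

lemma B_minus_left: "x \<in> carrier V \<Longrightarrow> y \<in> carrier V \<Longrightarrow> B (\<ominus>\<^bsub>V\<^esub> x) y = \<ominus> B x y"
  using B_smult_left[of "\<ominus> \<one>" x y] by (simp add: smult_minus_1 l_minus)

lemma B_diff_left: "x \<in> carrier V \<Longrightarrow> x' \<in> carrier V \<Longrightarrow> y \<in> carrier V \<Longrightarrow>
    B (x \<ominus>\<^bsub>V\<^esub> x') y = B x y \<ominus> B x' y"
  by (simp add: a_minus_def B_add_left B_minus_left)

lemma B_finsum_right:
  assumes "finite I" "x \<in> carrier V" "\<And>i. i \<in> I \<Longrightarrow> g i \<in> carrier V"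
  shows "B x (\<Oplus>\<^bsub>V\<^esub>i\<in>I. g i) = (\<Oplus>i\<in>I. B x (g i))"
  using assms(1,3)
proof (induction I rule: finite_induct)
  case empty
  then show ?case using assms(2) by simp
next
  case (insert i I)
  have "(\<Oplus>\<^bsub>V\<^esub>i\<in>insert i I. g i) = g i \<oplus>\<^bsub>V\<^esub> (\<Oplus>\<^bsub>V\<^esub>i\<in>I. g i)"
    using insert by (intro M.finsum_insert) auto
  moreover have "(\<Oplus>i\<in>insert i I. B x (g i)) = B x (g i) \<oplus> (\<Oplus>i\<in>I. B x (g i))"
    using insert assms(2) by (intro R.finsum_insert) auto
  moreover have "(\<Oplus>\<^bsub>V\<^esub>i\<in>I. g i) \<in> carrier V"
    using insert by (intro M.finsum_closed) auto
  ultimately show ?case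
    using insert assms(2) by (simp add: B_add_right)
qed

lemma Q_add: "x \<in> carrier V \<Longrightarrow> y \<in> carrier V \<Longrightarrow>
    Q (x \<oplus>\<^bsub>V\<^esub> y) = Q x \<oplus> Q y \<oplus> two K \<otimes> B x y"
proof -
  assume xy: "x \<in> carrier V" "y \<in> carrier V"
  have "two K \<otimes> B x y = (two K \<otimes> inv (two K)) \<otimes> (Q (x \<oplus>\<^bsub>V\<^esub> y) \<ominus> Q x \<ominus> Q y)"
    unfolding qf_inner_def using xy by (simp add: m_assoc del: inv_two)
  also have "\<dots> = Q (x \<oplus>\<^bsub>V\<^esub> y) \<ominus> Q x \<ominus> Q y"
    using xy by simp
  finally have *: "two K \<otimes> B x y = Q (x \<oplus>\<^bsub>V\<^esub> y) \<ominus> Q x \<ominus> Q y" .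
  have "a = b \<oplus> c \<oplus> (a \<ominus> b \<ominus> c)" if "a \<in> carrier K" "b \<in> carrier K" "c \<in> carrier K" for a b c
    using that by algebra
  then show ?thesis
    unfolding * using xy by simp
qed

text \<open>By homogeneity Q(x + x) = 4 Q(x); polarization subtracts 2 Q(x) and halves the
  rest.\<close>

lemma B_self: "x \<in> carrier V \<Longrightarrow> B x x = Q x"
proof -
  assume x: "x \<in> carrier V"
  have "x \<oplus>\<^bsub>V\<^esub> x = two K \<odot>\<^bsub>V\<^esub> x"
    using x by (simp add: smult_l_distr)
  then have "Q (x \<oplus>\<^bsub>V\<^esub> x) = two K \<otimes> two K \<otimes> Q x"
    using Q_smult[of "two K" x] x by (simp add: numeral_2_eq_2)
  moreover have "(\<one> \<oplus> \<one>) \<otimes> (\<one> \<oplus> \<one>) \<otimes> a \<ominus> a \<ominus> a = (\<one> \<oplus> \<one>) \<otimes> a" if "a \<in> carrier K" for a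
    using that by algebra
  ultimately have "B x x = inv (two K) \<otimes> (two K \<otimes> Q x)"
    unfolding qf_inner_def using x by simp
  also have "\<dots> = (inv (two K) \<otimes> two K) \<otimes> Q x"
    using x by (simp only: m_assoc two_closed inv_two_closed Q_closed)
  finally show ?thesis
    using x by simp
qed

lemma Q_zero [simp]: "Q \<zero>\<^bsub>V\<^esub> = \<zero>"
  using Q_smult[of \<zero> "\<zero>\<^bsub>V\<^esub>"] by (simp add: numeral_2_eq_2)

lemma Q_diff: "x \<in> carrier V \<Longrightarrow> y \<in> carrier V \<Longrightarrow>
    Q (x \<ominus>\<^bsub>V\<^esub> y) = Q x \<oplus> Q y \<ominus> two K \<otimes> B x y"
proof -
  assume xy: "x \<in> carrier V" "y \<in> carrier V"
  have "Q (\<ominus>\<^bsub>V\<^esub> y) = Q y"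
    using Q_smult[of "\<ominus> \<one>" y] xy by (simp add: smult_minus_1 numeral_2_eq_2 l_minus r_minus)
  moreover have "B x (\<ominus>\<^bsub>V\<^esub> y) = \<ominus> B x y"
    using xy B_sym[of x "\<ominus>\<^bsub>V\<^esub> y"] B_sym[of x y] by (simp add: B_minus_left)
  ultimately show ?thesis
    using Q_add[of x "\<ominus>\<^bsub>V\<^esub> y"] xy by (simp add: a_minus_def r_minus)
qed

end

section \<open>Isotropic vectors and hyperbolic pairs\<close>

context quadratic_space
begin

text \<open>Pigeonhole in place of a dimension formula: more than q^2 vectors cannot have distinct
  pairs (B z x, B z y), and the difference of two vectors with equal pairs is orthogonal to both x
  and y. With x = y = 0 it supplies a nonzero vector.\<close>

lemma exists_orthogonal:
  assumes fin: "finite (carrier K)" "finite (carrier V)"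
    and card: "(order K)\<^sup>2 < card (carrier V)"
    and x: "x \<in> carrier V" and y: "y \<in> carrier V"
  obtains z where "z \<in> carrier V" "z \<noteq> \<zero>\<^bsub>V\<^esub>" "B z x = \<zero>" "B z y = \<zero>"
proof -
  have "\<not> inj_on (\<lambda>z. (B z x, B z y)) (carrier V)"
  proof
    assume "inj_on (\<lambda>z. (B z x, B z y)) (carrier V)"
    then have "card (carrier V) \<le> card (carrier K \<times> carrier K)"
      by (rule card_inj_on_le) (use x y fin in auto)
    with card show False
      by (simp add: card_cartesian_product order_def power2_eq_square)
  qed
  then obtain z w where zw: "z \<in> carrier V" "w \<in> carrier V" "z \<noteq> w" "B z x = B w x" "B z y = B w y"
    unfolding inj_on_def by auto
  have "z \<ominus>\<^bsub>V\<^esub> w \<noteq> \<zero>\<^bsub>V\<^esub>"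
    using zw(1-3) M.add.inv_solve_right' by (metis M.l_zero M.zero_closed a_minus_def)
  moreover have "B (z \<ominus>\<^bsub>V\<^esub> w) x = \<zero>" "B (z \<ominus>\<^bsub>V\<^esub> w) y = \<zero>"
    using zw x y by (simp_all add: B_diff_left r_right_minus_eq)
  ultimately show ?thesis
    using that[of "z \<ominus>\<^bsub>V\<^esub> w"] zw by simp
qed

lemma exists_isotropic:
  assumes fin: "finite (carrier K)" "finite (carrier V)" and odd: "odd (order K)"
    and card: "(order K)\<^sup>2 < card (carrier V)"
  obtains e where "e \<in> carrier V" "e \<noteq> \<zero>\<^bsub>V\<^esub>" "Q e = \<zero>"
proof (cases "\<exists>e. e \<in> carrier V \<and> e \<noteq> \<zero>\<^bsub>V\<^esub> \<and> Q e = \<zero>")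
  case True
  then show ?thesis using that by blast
next
  \<comment> \<open>Now every nonzero vector is anisotropic, so each vector supplied by
    \<open>exists_orthogonal\<close> has a nonzero value of Q, and Q is diagonal in v, w, z.\<close>
  case False
  obtain v where v: "v \<in> carrier V" "v \<noteq> \<zero>\<^bsub>V\<^esub>"
    by (rule exists_orthogonal[OF fin card M.zero_closed M.zero_closed])
  obtain w where w: "w \<in> carrier V" "w \<noteq> \<zero>\<^bsub>V\<^esub>" "B w v = \<zero>"
    by (rule exists_orthogonal[OF fin card v(1) v(1)])
  obtain z where z: "z \<in> carrier V" "z \<noteq> \<zero>\<^bsub>V\<^esub>" "B z v = \<zero>" "B z w = \<zero>"
    by (rule exists_orthogonal[OF fin card v(1) w(1)])
  have "Q v \<noteq> \<zero>" "Q w \<noteq> \<zero>" "Q z \<noteq> \<zero>"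
    using False v w z by auto
  then obtain a b where ab: "a \<in> carrier K" "b \<in> carrier K"
    "Q v \<otimes> a [^] (2::nat) \<oplus> Q w \<otimes> b [^] (2::nat) = \<ominus> Q z"
    using diagonal_binary_universal[OF fin(1) odd, of "Q v" "Q w" "\<ominus> Q z"] v w z by auto
  let ?s = "a \<odot>\<^bsub>V\<^esub> v \<oplus>\<^bsub>V\<^esub> b \<odot>\<^bsub>V\<^esub> w"
  have orth: "B v w = \<zero>" "B v z = \<zero>" "B w z = \<zero>"
    using v w z B_sym by simp_all
  have "Q ?s = Q v \<otimes> a [^] (2::nat) \<oplus> Q w \<otimes> b [^] (2::nat)"
    using ab v w z orth by (simp add: Q_add Q_smult B_smult_left B_smult_right m_comm)
  moreover have sz: "B ?s z = \<zero>"
    using ab v w z orth by (simp add: B_add_left B_smult_left)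
  ultimately have "Q (?s \<oplus>\<^bsub>V\<^esub> z) = \<zero>"
    using ab v w z by (simp add: Q_add R.l_neg)
  \<comment> \<open>Pairing with z gives Q z, which is nonzero whatever a and b are.\<close>
  moreover have "?s \<oplus>\<^bsub>V\<^esub> z \<noteq> \<zero>\<^bsub>V\<^esub>"
  proof
    assume "?s \<oplus>\<^bsub>V\<^esub> z = \<zero>\<^bsub>V\<^esub>"
    then have "B (?s \<oplus>\<^bsub>V\<^esub> z) z = \<zero>"
      using z by simp
    then have "B z z = \<zero>"
      using sz ab v w z by (simp add: B_add_left[of ?s])
    then show False
      using B_self z \<open>Q z \<noteq> \<zero>\<close> by simp
  qed
  ultimately show ?thesis
    using that[of "?s \<oplus>\<^bsub>V\<^esub> z"] ab v w z by simp
qed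

text \<open>Nondegeneracy yields w with B e w nonzero, rescaled to w' with 2 B e w' = 1. Adding a
  multiple of e keeps the pairing with e, since Q e = 0, but changes the value of Q linearly, so a
  suitable multiple makes it zero.\<close>

lemma exists_hyperbolic_pair:
  assumes e: "e \<in> carrier V" "e \<noteq> \<zero>\<^bsub>V\<^esub>" "Q e = \<zero>"
    and nondeg: "nondegenerate_on K V Q (carrier V)"
  obtains f where "f \<in> carrier V" "Q f = \<zero>" "two K \<otimes> B e f = \<one>"
proof -
  obtain w where w: "w \<in> carrier V" "B e w \<noteq> \<zero>"
    using nondeg e unfolding nondegenerate_on_def by blast
  define c where "c = two K \<otimes> B e w"
  have c: "c \<in> carrier K" "c \<noteq> \<zero>"
    unfolding c_def using w e two_nz integral_iff[of "two K" "B e w"] by simp_all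
  then have ic: "inv c \<in> carrier K" "inv c \<otimes> c = \<one>"
    using field_Units by auto
  define w' where "w' = inv c \<odot>\<^bsub>V\<^esub> w"
  have w': "w' \<in> carrier V"
    unfolding w'_def using ic w by simp
  have "two K \<otimes> B e w' = inv c \<otimes> c"
  proof -
    have "two K \<otimes> B e w' = two K \<otimes> (inv c \<otimes> B e w)"
      unfolding w'_def using e w ic by (simp add: B_smult_right del: ic(2))
    also have "\<dots> = inv c \<otimes> c"
      unfolding c_def using e w ic(1)[unfolded c_def] by (intro m_lcomm) simp_all
    finally show ?thesis .
  qed
  then have hyp: "two K \<otimes> B e w' = \<one>"
    using ic by simp
  \<comment> \<open>Q(w' - s e) = Q w' - s (2 B w' e) = Q w' - s, hence s = Q w'.\<close>
  define f where "f = w' \<ominus>\<^bsub>V\<^esub> Q w' \<odot>\<^bsub>V\<^esub> e"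
  have f: "f \<in> carrier V"
    unfolding f_def using w' e by simp
  have "two K \<otimes> B w' (Q w' \<odot>\<^bsub>V\<^esub> e) = Q w' \<otimes> (two K \<otimes> B e w')"
    using w' e B_sym[of w' e] by (simp only: B_smult_right Q_closed B_closed two_closed m_lcomm)
  then have "two K \<otimes> B w' (Q w' \<odot>\<^bsub>V\<^esub> e) = Q w'"
    using hyp w' by simp
  moreover have "Q (Q w' \<odot>\<^bsub>V\<^esub> e) = \<zero>"
    using w' e by (simp add: Q_smult)
  ultimately have "Q f = \<zero>"
    unfolding f_def using w' e by (simp add: Q_diff r_right_minus_eq)
  moreover have "B e f = B e w'"
  proof -
    have "B e f = B w' e \<ominus> B (Q w' \<odot>\<^bsub>V\<^esub> e) e"
      using B_sym[of e f] f e w' unfolding f_def by (simp add: B_diff_left)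
    then show ?thesis
      using e w' B_self[of e] B_sym[of e w'] by (simp add: B_smult_left a_minus_def)
  qed
  ultimately show ?thesis
    using that f hyp by simp
qed

lemma subspace_orthogonal:
  assumes "e \<in> carrier V" "f \<in> carrier V"
  shows "subspace K {z \<in> carrier V. B z e = \<zero> \<and> B z f = \<zero>} V"
  unfolding subspace_def
  by (intro conjI submodule.intro vectorspace_axioms module_axioms)
     (use assms in \<open>auto simp: B_add_left B_smult_left\<close>)

text \<open>The coordinates of \<open>v\<close> along \<open>e\<close> and \<open>f\<close> are \<open>2\<langle>v,f\<rangle>\<close> and \<open>2\<langle>v,e\<rangle>\<close>.\<close>

lemma hyperbolic_decomposition:
  assumes e: "e \<in> carrier V" "Q e = \<zero>" and f: "f \<in> carrier V" "Q f = \<zero>"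
    and hyp: "two K \<otimes> B e f = \<one>"
    and nondeg: "nondegenerate_on K V Q (carrier V)"
  defines "V0 \<equiv> {z \<in> carrier V. B z e = \<zero> \<and> B z f = \<zero>}"
    and "p \<equiv> \<lambda>x y z. x \<odot>\<^bsub>V\<^esub> e \<oplus>\<^bsub>V\<^esub> y \<odot>\<^bsub>V\<^esub> f \<oplus>\<^bsub>V\<^esub> z"
  shows "bij_betw (\<lambda>(x, y, z). p x y z) (carrier K \<times> carrier K \<times> V0) (carrier V)"
    and "\<And>x y z. x \<in> carrier K \<Longrightarrow> y \<in> carrier K \<Longrightarrow> z \<in> V0 \<Longrightarrow> Q (p x y z) = x \<otimes> y \<oplus> Q z"
    and "nondegenerate_on K V Q V0"
proof -
  have V0D: "z \<in> carrier V" "B z e = \<zero>" "B z f = \<zero>" "B e z = \<zero>" "B f z = \<zero>" if "z \<in> V0" for z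
    using that e f B_sym unfolding V0_def by auto
  have pcl: "p x y z \<in> carrier V" if "x \<in> carrier K" "y \<in> carrier K" "z \<in> carrier V" for x y z
    using that e f unfolding p_def by simp
  have hyp': "two K \<otimes> B f e = \<one>"
    using hyp B_sym[of e f] e f by simp
  have rot: "t \<otimes> a \<otimes> b = a \<otimes> (t \<otimes> b)"
    if "t \<in> carrier K" "a \<in> carrier K" "b \<in> carrier K" for t a b
    using that by (simp add: m_ac)
  have Bee: "B e e = \<zero>" "B f f = \<zero>"
    using e f B_self by simp_all
  have lc: "two K \<otimes> (x \<otimes> b) = x" if "two K \<otimes> b = \<one>" "x \<in> carrier K" "b \<in> carrier K" for x b
    using that m_lcomm[of "two K" x b] by simp
  have coord: "two K \<otimes> B (p x y z) f = x" "two K \<otimes> B (p x y z) e = y"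
    if "x \<in> carrier K" "y \<in> carrier K" "z \<in> V0" for x y z
  proof -
    have "B (p x y z) f = x \<otimes> B e f" "B (p x y z) e = y \<otimes> B f e"
      unfolding p_def using that V0D[OF that(3)] e f Bee by (simp_all add: B_add_left B_smult_left)
    then show "two K \<otimes> B (p x y z) f = x" "two K \<otimes> B (p x y z) e = y"
      using lc hyp hyp' that e f by (simp_all del: two_closed)
  qed
  have p_inj: "x = x' \<and> y = y' \<and> z = z'"
    if h: "x \<in> carrier K" "y \<in> carrier K" "z \<in> V0" "x' \<in> carrier K" "y' \<in> carrier K" "z' \<in> V0"
      and eq: "p x y z = p x' y' z'" for x y z x' y' z'
  proof -
    have xy: "x = x'" "y = y'"
      using coord[of x y z] coord[of x' y' z'] h eq by auto
    define h0 where "h0 = x \<odot>\<^bsub>V\<^esub> e \<oplus>\<^bsub>V\<^esub> y \<odot>\<^bsub>V\<^esub> f"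
    have h0: "h0 \<in> carrier V"
      unfolding h0_def using h e f by simp
    have "h0 \<oplus>\<^bsub>V\<^esub> z = h0 \<oplus>\<^bsub>V\<^esub> z'"
      using eq unfolding p_def xy[symmetric] h0_def .
    then have "z = z'"
      using M.r_neg1[of h0 z] M.r_neg1[of h0 z'] h0 h V0D by simp
    with xy show ?thesis
      by simp
  qed
  show "bij_betw (\<lambda>(x, y, z). p x y z) (carrier K \<times> carrier K \<times> V0) (carrier V)"
    unfolding bij_betw_def
  proof
    show "inj_on (\<lambda>(x, y, z). p x y z) (carrier K \<times> carrier K \<times> V0)"
    proof (rule inj_onI)
      fix s t
      assume st: "s \<in> carrier K \<times> carrier K \<times> V0" "t \<in> carrier K \<times> carrier K \<times> V0"
        and eq: "(case s of (x, y, z) \<Rightarrow> p x y z) = (case t of (x, y, z) \<Rightarrow> p x y z)"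
      obtain x y z x' y' z' where [simp]: "s = (x, y, z)" "t = (x', y', z')"
        by (metis surj_pair)
      show "s = t"
        using p_inj[of x y z x' y' z'] st eq by simp
    qed
    show "(\<lambda>(x, y, z). p x y z) ` (carrier K \<times> carrier K \<times> V0) = carrier V"
    proof
      show "(\<lambda>(x, y, z). p x y z) ` (carrier K \<times> carrier K \<times> V0) \<subseteq> carrier V"
        using pcl V0D by auto
      show "carrier V \<subseteq> (\<lambda>(x, y, z). p x y z) ` (carrier K \<times> carrier K \<times> V0)"
      proof
        fix v assume v: "v \<in> carrier V"
        define x y where "x = two K \<otimes> B v f" and "y = two K \<otimes> B v e"
        have xy: "x \<in> carrier K" "y \<in> carrier K"
          unfolding x_def y_def using v e f by simp_all
        define h where "h = x \<odot>\<^bsub>V\<^esub> e \<oplus>\<^bsub>V\<^esub> y \<odot>\<^bsub>V\<^esub> f"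
        have h: "h \<in> carrier V"
          unfolding h_def using xy e f by simp
        have "B h e = y \<otimes> B f e" "B h f = x \<otimes> B e f"
          unfolding h_def using xy e f Bee by (simp_all add: B_add_left B_smult_left)
        moreover have "y \<otimes> B f e = B v e \<otimes> (two K \<otimes> B f e)"
          unfolding y_def using v e f by (intro rot) simp_all
        moreover have "x \<otimes> B e f = B v f \<otimes> (two K \<otimes> B e f)"
          unfolding x_def using v e f by (intro rot) simp_all
        ultimately have "B h e = B v e" "B h f = B v f"
          using hyp hyp' v e f by simp_all
        then have "v \<ominus>\<^bsub>V\<^esub> h \<in> V0"
          unfolding V0_def using v h e f by (simp add: B_diff_left r_right_minus_eq)
        moreover have "v = p x y (v \<ominus>\<^bsub>V\<^esub> h)"
          unfolding p_def h_def[symmetric] using v h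
          by (simp add: a_minus_def M.a_comm[of v] M.r_neg2)
        ultimately show "v \<in> (\<lambda>(x, y, z). p x y z) ` (carrier K \<times> carrier K \<times> V0)"
          using xy by (intro image_eqI[of _ _ "(x, y, v \<ominus>\<^bsub>V\<^esub> h)"]) auto
      qed
    qed
  qed
  then have surj: "\<exists>x\<in>carrier K. \<exists>y\<in>carrier K. \<exists>z\<in>V0. v = p x y z" if "v \<in> carrier V" for v
  proof -
    from that \<open>bij_betw _ _ _\<close> have "v \<in> (\<lambda>(x, y, z). p x y z) ` (carrier K \<times> carrier K \<times> V0)"
      unfolding bij_betw_def by simp
    then obtain s where s: "s \<in> carrier K \<times> carrier K \<times> V0" "v = (\<lambda>(x, y, z). p x y z) s"
      by (rule imageE)
    obtain x y z where "s = (x, y, z)"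
      by (rule prod_cases3)
    with s show ?thesis
      by auto
  qed
  show "Q (p x y z) = x \<otimes> y \<oplus> Q z" if "x \<in> carrier K" "y \<in> carrier K" "z \<in> V0" for x y z
  proof -
    have "Q (x \<odot>\<^bsub>V\<^esub> e \<oplus>\<^bsub>V\<^esub> y \<odot>\<^bsub>V\<^esub> f) = two K \<otimes> (x \<otimes> (y \<otimes> B e f))"
      using that e f m_lcomm[of y x "B e f"] by (simp add: Q_add Q_smult B_smult_left B_smult_right)
    also have "\<dots> = x \<otimes> (two K \<otimes> (y \<otimes> B e f))"
      using that e f by (intro m_lcomm) simp_all
    also have "\<dots> = x \<otimes> y"
      using lc[OF hyp, of y] that e f by simp
    finally have "Q (x \<odot>\<^bsub>V\<^esub> e \<oplus>\<^bsub>V\<^esub> y \<odot>\<^bsub>V\<^esub> f) = x \<otimes> y" .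
    moreover have "B (x \<odot>\<^bsub>V\<^esub> e \<oplus>\<^bsub>V\<^esub> y \<odot>\<^bsub>V\<^esub> f) z = \<zero>"
      using that V0D e f by (simp add: B_add_left B_smult_left)
    ultimately show ?thesis
      unfolding p_def using that V0D e f by (simp add: Q_add)
  qed
  show "nondegenerate_on K V Q V0"
    unfolding nondegenerate_on_def
  proof (intro ballI impI)
    \<comment> \<open>Membership in \<open>V0\<close> already makes z orthogonal to e and f, so
      orthogonality to \<open>V0\<close> extends to the whole space.\<close>
    fix z assume z: "z \<in> V0" and orth: "\<forall>z'\<in>V0. B z z' = \<zero>"
    have "B z v = \<zero>" if "v \<in> carrier V" for v
    proof -
      from surj[OF that] obtain x y z' where "x \<in> carrier K" "y \<in> carrier K" "z' \<in> V0" "v = p x y z'"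
        by blast
      then show ?thesis
        unfolding p_def using V0D z e f orth by (simp add: B_add_right B_smult_right)
    qed
    then show "z = \<zero>\<^bsub>V\<^esub>"
      using nondeg V0D(1)[OF z] unfolding nondegenerate_on_def by blast
  qed
qed

end

section \<open>Existence of the construction\<close>

text \<open>Rewriting \<open>1\<close> to \<open>Suc 0\<close> inside \<open>{1..d}\<close> would keep the facts about \<open>coord_space R d\<close> from
  applying.\<close>

declare One_nat_def [simp del]

lemma odd_quadratic_spaceD:
  assumes "odd_quadratic_space R d Q"
  shows "quadratic_space R (coord_space R d) Q"
    and "finite (carrier R)" "odd (order R)"
    and "nondegenerate_on R (coord_space R d) Q (carrier (coord_space R d))"
    and "finite (carrier (coord_space R d))"
    and "card (carrier (coord_space R d)) = order R ^ d"
proof -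
  from assms show fin: "finite (carrier R)" "odd (order R)"
    and "nondegenerate_on R (coord_space R d) Q (carrier (coord_space R d))"
    unfolding odd_quadratic_space_def by simp_all
  interpret field R
    using assms unfolding odd_quadratic_space_def by simp
  show "quadratic_space R (coord_space R d) Q"
    using assms two_nonzero[OF fin] vectorspace_func_space[of "{1..d}"]
    unfolding odd_quadratic_space_def quadratic_space_def quadratic_space_axioms_def by simp
  show "finite (carrier (coord_space R d))" "card (carrier (coord_space R d)) = order R ^ d"
    using fin by (simp_all add: func_space_carrier finite_PiE card_PiE order_def)
qed

text \<open>Splits off the two hyperbolic coordinates, so that the cardinality of \<open>V0\<close>
  follows by cancelling.\<close>

lemma power_eq_mult_mult:
  fixes x :: "'b :: monoid_mult"
  assumes "2 \<le> n"
  shows "x ^ n = x * (x * x ^ (n - 2))"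
proof -
  have "n = Suc (Suc (n - 2))"
    using assms by simp
  then show ?thesis
    by (metis power_Suc)
qed

lemma finite_not_surj:
  assumes "finite A" "f \<in> A \<rightarrow> A" "a \<in> A" "b \<in> A" "a \<noteq> b" "f a = f b"
  obtains c where "c \<in> A" "c \<notin> f ` A"
proof -
  have "\<not> A \<subseteq> f ` A"
    using assms finite_surj_inj[of A f] unfolding inj_on_def by blast
  then show ?thesis
    using that by blast
qed

lemma rn_construction_exists:
  fixes R :: "'a ring"
  assumes sp: "odd_quadratic_space R d Q" and d: "d \<ge> 3"
  obtains e f V0 u \<kappa> where "rn_construction R d Q e f V0 u \<kappa>"
proof -
  note D = odd_quadratic_spaceD[OF sp]
  interpret quadratic_space R "coord_space R d" Q
    by (rule D(1))
  let ?V = "coord_space R d"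
  have R1: "1 < order R"
  proof -
    have "card {\<zero>\<^bsub>R\<^esub>, \<one>\<^bsub>R\<^esub>} \<le> order R"
      unfolding order_def by (intro card_mono D) auto
    then show ?thesis by simp
  qed
  have "(order R)\<^sup>2 < card (carrier ?V)"
    unfolding D(6) using d R1 by (intro power_strict_increasing) simp_all
  from exists_isotropic[OF D(2,5,3) this]
  obtain e where e: "e \<in> carrier ?V" "e \<noteq> \<zero>\<^bsub>?V\<^esub>" "Q e = \<zero>\<^bsub>R\<^esub>" .
  from exists_hyperbolic_pair[OF e D(4)]
  obtain f where f: "f \<in> carrier ?V" "Q f = \<zero>\<^bsub>R\<^esub>" "two R \<otimes>\<^bsub>R\<^esub> B e f = \<one>\<^bsub>R\<^esub>" .
  define V0 where "V0 = {z \<in> carrier ?V. B z e = \<zero>\<^bsub>R\<^esub> \<and> B z f = \<zero>\<^bsub>R\<^esub>}"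
  note dec = hyperbolic_decomposition[OF e(1,3) f D(4), folded V0_def]
  have sub: "subspace R V0 ?V"
    unfolding V0_def by (rule subspace_orthogonal[OF e(1) f(1)])
  interpret V0: vectorspace R "vs V0"
    by (rule subspace_is_vs[OF sub])
  have V0V: "V0 \<subseteq> carrier ?V" and finV0: "finite V0"
    unfolding V0_def using D(5) by (auto intro: finite_subset[rotated])
  \<comment> \<open>The triples (x, y, z) biject with the q^d vectors, which forces q^(d-2) elements
    in \<open>V0\<close>; comparing powers of q then gives d - 2 basis vectors.\<close>
  have "order R ^ d = order R * (order R * card V0)"
    using bij_betw_same_card[OF dec(1)] unfolding D(6) order_def
    by (simp only: card_cartesian_product)
  moreover have "order R ^ d = order R * (order R * order R ^ (d - 2))"
    using d by (intro power_eq_mult_mult) simp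
  ultimately have cardV0: "card V0 = order R ^ (d - 2)"
    using R1 by simp
  have gen: "V0.span V0 = V0"
    using V0.span_is_subset2[of V0] V0.in_own_span[of V0] by auto
  then have fd: "V0.fin_dim"
    unfolding V0.fin_dim_def using finV0 by (intro exI[of _ V0]) simp
  from V0.finite_basis_exists[OF fd] obtain \<beta> where \<beta>: "finite \<beta>" "V0.basis \<beta>"
    by auto
  have "order R ^ card \<beta> = order R ^ (d - 2)"
    using V0.card_carrier_eq[OF D(2)] V0.dim_basis[OF \<beta>] finV0 cardV0 by simp
  then have "card \<beta> = d - 2"
    using R1 power_inject_exp by blast
  then obtain u where u: "bij_betw u {1..d-2} \<beta>"
    using ex_bij_betw_nat_finite_1[OF \<beta>(1)] by auto
  have uV0: "u j \<in> V0" if "j \<in> {1..d-2}" for j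
    using bij_betwE[OF u] \<beta>(2) that unfolding V0.basis_def by auto
  then have uV: "u j \<in> carrier ?V" if "j \<in> {1..d-2}" for j
    using V0V that by blast
  \<comment> \<open>The value 0 for \<kappa> is a placeholder: \<open>center\<close>,
    \<open>gam\<close> and \<open>gfun\<close> do not involve \<kappa>, which is chosen once the
    range of \<open>gfun\<close> is known.\<close>
  interpret rn: rn_data R d Q e f V0 u "\<zero>\<^bsub>R\<^esub>" .
  have center_closed: "rn.center t \<in> carrier ?V" if "t \<in> carrier R" for t
    unfolding rn.center_def rn.zvec_def using that f uV
    by (intro M.add.m_closed smult_closed M.finsum_closed) auto
  have "rn.zvec \<zero>\<^bsub>R\<^esub> = (\<Oplus>\<^bsub>?V\<^esub>j\<in>{1..d-2}. \<zero>\<^bsub>?V\<^esub>)"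
    unfolding rn.zvec_def using uV
    by (intro M.finsum_cong') (auto simp: nat_pow_zero)
  then have center0: "rn.center \<zero>\<^bsub>R\<^esub> = \<zero>\<^bsub>?V\<^esub>"
    unfolding rn.center_def using f d by (simp add: nat_pow_zero)
  have gam: "rn.gam \<in> carrier R"
    unfolding rn.gam_def using center_closed by simp
  have g: "rn.gfun \<in> carrier R \<rightarrow> carrier R"
    unfolding rn.gfun_def using center_closed gam by auto
  have "rn.gfun \<zero>\<^bsub>R\<^esub> = \<zero>\<^bsub>R\<^esub>"
    unfolding rn.gfun_def center0 using d gam by (simp add: nat_pow_zero)
  moreover have "rn.gfun \<one>\<^bsub>R\<^esub> = \<zero>\<^bsub>R\<^esub>"
  proof -
    \<comment> \<open>With c = Q(c_1): \<open>gam\<close> is chosen to make g vanish at 1 as it does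
      at 0.\<close>
    have "c \<oplus>\<^bsub>R\<^esub> \<one>\<^bsub>R\<^esub> \<oplus>\<^bsub>R\<^esub> (\<ominus>\<^bsub>R\<^esub> \<one>\<^bsub>R\<^esub> \<ominus>\<^bsub>R\<^esub> c) = \<zero>\<^bsub>R\<^esub>" if "c \<in> carrier R" for c
      using that by algebra
    then show ?thesis
      unfolding rn.gfun_def rn.gam_def using center_closed by simp
  qed
  ultimately have "rn.gfun \<zero>\<^bsub>R\<^esub> = rn.gfun \<one>\<^bsub>R\<^esub>"
    by simp
  from finite_not_surj[OF D(2) g R.zero_closed R.one_closed _ this]
  obtain c where c: "c \<in> carrier R" "c \<notin> rn.gfun ` carrier R"
    by auto
  interpret rk: rn_data R d Q e f V0 u "\<ominus>\<^bsub>R\<^esub> c" .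
  have "rn_construction R d Q e f V0 u (\<ominus>\<^bsub>R\<^esub> c)"
  proof (rule rn_construction.intro)
    show "odd_quadratic_space R d Q" "e \<in> carrier ?V" "f \<in> carrier ?V" "subspace R V0 ?V"
      by fact+
    show "bij_betw (\<lambda>(x, y, z). rk.pt x y z) (carrier R \<times> carrier R \<times> V0) (carrier ?V)"
      using dec(1) unfolding rk.pt_def .
    show "Q (rk.pt x y z) = x \<otimes>\<^bsub>R\<^esub> y \<oplus>\<^bsub>R\<^esub> Q z"
      if "x \<in> carrier R" "y \<in> carrier R" "z \<in> V0" for x y z
      using dec(2)[OF that] unfolding rk.pt_def .
    show "nondegenerate_on R ?V Q V0"
      by (rule dec(3))
    show "inj_on u {1..d-2}" "V0.basis (u ` {1..d-2})"
      using u \<beta>(2) unfolding bij_betw_def by simp_all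
    show "\<ominus>\<^bsub>R\<^esub> c \<in> carrier R" "\<ominus>\<^bsub>R\<^esub> (\<ominus>\<^bsub>R\<^esub> c) \<notin> rk.gfun ` carrier R"
      using c by simp_all
  qed
  then show ?thesis
    using that by blast
qed

section \<open>Points and polynomials\<close>

context UP_cring
begin

abbreviation linear_factor :: "'a \<Rightarrow> nat \<Rightarrow> 'a" where
  "linear_factor a \<equiv> monom P \<one> 1 \<ominus>\<^bsub>P\<^esub> monom P a 0"

lemma coeff_linear_factor_mult:
  assumes a: "a \<in> carrier R" and p: "p \<in> carrier P"
  shows "coeff P (linear_factor a \<otimes>\<^bsub>P\<^esub> p) (Suc n) = coeff P p n \<ominus> a \<otimes> coeff P p (Suc n)"
proof -
  have "linear_factor a \<otimes>\<^bsub>P\<^esub> p =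
      monom P \<one> 1 \<otimes>\<^bsub>P\<^esub> p \<ominus>\<^bsub>P\<^esub> monom P a 0 \<otimes>\<^bsub>P\<^esub> p"
    using a p by (simp add: a_minus_def P.l_distr P.l_minus)
  moreover have "coeff P (monom P \<one> 1 \<otimes>\<^bsub>P\<^esub> p) (Suc n) = coeff P p n"
    using coeff_monom_mult[OF R.one_closed p, of 1 n] p unfolding Suc_eq_plus1
    by (simp del: coeff_mult)
  moreover have "coeff P (monom P a 0 \<otimes>\<^bsub>P\<^esub> p) (Suc n) = a \<otimes> coeff P p (Suc n)"
    using coeff_monom_mult[OF a p, of 0 "Suc n"] by (simp del: coeff_mult)
  ultimately show ?thesis
    using a p by (simp del: coeff_mult)
qed

lemma prod_linear_factors:
  assumes "finite A" "A \<subseteq> carrier R"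
  shows "(\<Otimes>\<^bsub>P\<^esub>a\<in>A. linear_factor a) \<in> carrier P"
    and "n > card A \<Longrightarrow> coeff P (\<Otimes>\<^bsub>P\<^esub>a\<in>A. linear_factor a) n = \<zero>"
    and "coeff P (\<Otimes>\<^bsub>P\<^esub>a\<in>A. linear_factor a) (card A) = \<one>"
    and "A \<noteq> {} \<Longrightarrow> coeff P (\<Otimes>\<^bsub>P\<^esub>a\<in>A. linear_factor a) (card A - 1) = \<ominus> (\<Oplus>a\<in>A. a)"
proof -
  let ?F = "\<lambda>A. (\<Otimes>\<^bsub>P\<^esub>a\<in>A. linear_factor a)"
  have closed: "?F A \<in> carrier P" if "A \<subseteq> carrier R" for A
    using that by (intro P.finprod_closed) auto
  show "?F A \<in> carrier P"
    by (rule closed) fact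
  have ins: "?F (insert b A) = linear_factor b \<otimes>\<^bsub>P\<^esub> ?F A"
    if "finite A" "b \<notin> A" "A \<subseteq> carrier R" "b \<in> carrier R" for A b
    using that by (intro P.finprod_insert) auto
  \<comment> \<open>Joint induction: the subleading coefficient of the larger product is the
    previous subleading one minus b times the previous leading one.\<close>
  have "(\<forall>n>card A. coeff P (?F A) n = \<zero>) \<and> coeff P (?F A) (card A) = \<one> \<and>
      (A \<noteq> {} \<longrightarrow> coeff P (?F A) (card A - 1) = \<ominus> (\<Oplus>a\<in>A. a))"
    using assms
  proof (induction A rule: finite_induct)
    case empty
    then show ?case by simp
  next
    case (insert b A)
    then have A: "A \<subseteq> carrier R" and b: "b \<in> carrier R"
      by auto
    note IH = insert.IH[OF A]
    have Fc: "?F A \<in> carrier P"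
      by (rule closed) fact
    have coeff_Suc: "coeff P (?F (insert b A)) (Suc n) =
        coeff P (?F A) n \<ominus> b \<otimes> coeff P (?F A) (Suc n)" for n
      unfolding ins[OF insert.hyps A b] by (rule coeff_linear_factor_mult[OF b Fc])
    have card: "card (insert b A) = Suc (card A)"
      using insert.hyps by simp
    have high: "coeff P (?F (insert b A)) n = \<zero>" if "n > Suc (card A)" for n
    proof -
      from that obtain m where m: "n = Suc m" "m > card A"
        by (cases n) auto
      then show ?thesis
        unfolding m(1) coeff_Suc using IH b by (simp add: a_minus_def)
    qed
    have lead: "coeff P (?F (insert b A)) (Suc (card A)) = \<one>"
      unfolding coeff_Suc using IH b by (simp add: a_minus_def)
    have "coeff P (?F (insert b A)) (card A) = \<ominus> (\<Oplus>a\<in>insert b A. a)"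
    \<comment> \<open>The recursion needs a coefficient below the leading one, and the empty product
      has none.\<close>
    proof (cases "A = {}")
      case True
      then have "?F (insert b A) = linear_factor b"
        unfolding ins[OF insert.hyps A b] using b by simp
      with True b show ?thesis
        by (simp add: a_minus_def)
    next
      case False
      then obtain m where m: "card A = Suc m"
        using insert.hyps(1) by (cases "card A") auto
      have s: "(\<Oplus>a\<in>A. a) \<in> carrier R"
        using A by (intro R.finsum_closed) auto
      have "coeff P (?F (insert b A)) (card A) = \<ominus> (\<Oplus>a\<in>A. a) \<ominus> b"
        using IH False b m coeff_Suc[of m] by simp
      also have "\<dots> = \<ominus> (b \<oplus> (\<Oplus>a\<in>A. a))"
        using s b by (simp add: a_minus_def R.minus_add R.a_comm)
      also have "b \<oplus> (\<Oplus>a\<in>A. a) = (\<Oplus>a\<in>insert b A. a)"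
        using insert.hyps A b by (intro R.finsum_insert[symmetric]) auto
      finally show ?thesis .
    qed
    with high lead show ?case
      unfolding card by simp
  qed
  then show "n > card A \<Longrightarrow> coeff P (?F A) n = \<zero>" "coeff P (?F A) (card A) = \<one>"
    "A \<noteq> {} \<Longrightarrow> coeff P (?F A) (card A - 1) = \<ominus> (\<Oplus>a\<in>A. a)"
    by blast+
qed

end

text \<open>Evaluation at t is a ring homomorphism into a domain, so the product of the t - b
  vanishes only if a factor does.\<close>

lemma (in UP_domain) eval_prod_linear_factors_eq_zero:
  assumes "finite A" "A \<subseteq> carrier R" "t \<in> carrier R"
  shows "eval R R id t (\<Otimes>\<^bsub>P\<^esub>a\<in>A. linear_factor a) = \<zero> \<longleftrightarrow> t \<in> A"
  using assms(1,2)
proof (induction A rule: finite_induct)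
  interpret UP_pre_univ_prop R R id P by unfold_locales simp
  interpret E: ring_hom_cring P R "eval R R id t"
    by unfold_locales (rule eval_ring_hom[OF assms(3)])
  {
    case empty
    show ?case
      unfolding P.finprod_empty E.hom_one by simp
  next
    case (insert b A)
    then have A: "A \<subseteq> carrier R" and b: "b \<in> carrier R"
      by auto
    let ?p = "\<Otimes>\<^bsub>P\<^esub>a\<in>A. linear_factor a"
    have p: "?p \<in> carrier P"
      using A by (intro P.finprod_closed) auto
    have "(\<Otimes>\<^bsub>P\<^esub>a\<in>insert b A. linear_factor a) = linear_factor b \<otimes>\<^bsub>P\<^esub> ?p"
      using insert.hyps A b by (intro P.finprod_insert) auto
    moreover have "eval R R id t (linear_factor b) = t \<ominus> b"
      using eval_monom[OF R.one_closed assms(3), of 1] eval_monom[OF b assms(3), of 0] assms(3) b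
      by (simp add: a_minus_def)
    ultimately have "eval R R id t (\<Otimes>\<^bsub>P\<^esub>a\<in>insert b A. linear_factor a) =
        (t \<ominus> b) \<otimes> eval R R id t ?p"
      using p b by simp
    moreover have "eval R R id t ?p \<in> carrier R"
      using p by simp
    moreover have "(t \<ominus> b) \<otimes> x = \<zero> \<longleftrightarrow> t = b \<or> x = \<zero>" if "x \<in> carrier R" for x
      using assms(3) b that by (simp add: R.integral_iff R.r_right_minus_eq)
    ultimately show ?case
      using insert.IH[OF A] by (simp only: insert_iff)
  }
qed

section \<open>Consequences of the Witt decomposition\<close>

sublocale rn_construction \<subseteq> quadratic_space R V Q
  by (rule odd_quadratic_spaceD(1)[OF space])

context rn_construction
begin

lemmas finite_carrier = odd_quadratic_spaceD(2)[OF space]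
  and card_V = odd_quadratic_spaceD(6)[OF space]

lemma order_gt_one: "1 < order R"
proof -
  have "card {\<zero>, \<one>} \<le> order R"
    unfolding order_def by (intro card_mono finite_carrier) auto
  then show ?thesis by simp
qed

lemma V0_V: "z \<in> V0 \<Longrightarrow> z \<in> carrier V"
  using V0_subspace unfolding subspace_def submodule_def by blast

lemma zero_V0: "\<zero>\<^bsub>V\<^esub> \<in> V0"
  using V0_subspace unfolding subspace_def submodule_def by blast

lemma u_V0: "j \<in> {1..d-2} \<Longrightarrow> u j \<in> V0"
  using u_basis vectorspace.basis_def[OF subspace_is_vs[OF V0_subspace]] by auto

lemma u_V: "j \<in> {1..d-2} \<Longrightarrow> u j \<in> carrier V"
  using u_V0 V0_V by blast

lemma pt_closed: "x \<in> carrier R \<Longrightarrow> y \<in> carrier R \<Longrightarrow> z \<in> V0 \<Longrightarrow> pt x y z \<in> carrier V"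
  unfolding pt_def using e_closed f_closed V0_V by simp

text \<open>The locale states the decomposition as a formula for Q. Evaluating it at coordinates 0
  and 1 and polarizing recovers that e and f form a hyperbolic pair orthogonal to
  \<open>V0\<close>.\<close>

lemma Q_e: "Q e = \<zero>" and Q_f: "Q f = \<zero>"
  and B_e_f: "two R \<otimes> B e f = \<one>"
  and B_e_V0: "z \<in> V0 \<Longrightarrow> B e z = \<zero>" and B_f_V0: "z \<in> V0 \<Longrightarrow> B f z = \<zero>"
proof -
  have pte: "pt \<one> \<zero> z = e \<oplus>\<^bsub>V\<^esub> z" and ptf: "pt \<zero> \<one> z = f \<oplus>\<^bsub>V\<^esub> z" if "z \<in> V0" for z
    unfolding pt_def using e_closed f_closed V0_V[OF that] by simp_all
  show Qe: "Q e = \<zero>" and Qf: "Q f = \<zero>"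
    using Q_decomp[of \<one> \<zero> "\<zero>\<^bsub>V\<^esub>"] Q_decomp[of \<zero> \<one> "\<zero>\<^bsub>V\<^esub>"] pte ptf zero_V0 e_closed f_closed
    by simp_all
  have "Q (e \<oplus>\<^bsub>V\<^esub> f) = \<one>"
    using Q_decomp[of \<one> \<one> "\<zero>\<^bsub>V\<^esub>"] zero_V0 e_closed f_closed unfolding pt_def by simp
  then show "two R \<otimes> B e f = \<one>"
    using Qe Qf e_closed f_closed by (simp add: Q_add)
  have orth: "B g z = \<zero>" if g: "g \<in> carrier V" "Q g = \<zero>" and z: "z \<in> V0"
    and eq: "Q (g \<oplus>\<^bsub>V\<^esub> z) = Q z" for g z
  proof -
    note zV = V0_V[OF z]
    have "Q z \<oplus> two R \<otimes> B g z = Q z"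
      using eq g zV by (simp add: Q_add)
    then have "two R \<otimes> B g z = \<zero>"
      using R.r_neg1[of "Q z" "two R \<otimes> B g z"] g zV by (simp add: R.l_neg)
    then show ?thesis
      using integral_iff[of "two R" "B g z"] two_nz g zV by simp
  qed
  show "B e z = \<zero>" if "z \<in> V0"
    using orth[OF e_closed Qe that] Q_decomp[of \<one> \<zero> z] pte that V0_V by simp
  show "B f z = \<zero>" if "z \<in> V0"
    using orth[OF f_closed Qf that] Q_decomp[of \<zero> \<one> z] ptf that V0_V by simp
qed

lemma zvec_closed: "t \<in> carrier R \<Longrightarrow> zvec t \<in> carrier V"
  unfolding zvec_def using u_V by (intro M.finsum_closed) auto

lemma center_closed: "t \<in> carrier R \<Longrightarrow> center t \<in> carrier V"
  unfolding center_def using f_closed zvec_closed by simp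

lemma gam_closed: "gam \<in> carrier R"
  unfolding gam_def using center_closed by simp

lemma bval_closed: "t \<in> carrier R \<Longrightarrow> bval t \<in> carrier R"
  unfolding bval_def using gam_closed kappa_closed by simp

text \<open>Since r_t = g(t) + \<kappa>, a zero radius would make -\<kappa> a value of g.\<close>

lemma radius_nonzero:
  assumes t: "t \<in> carrier R"
  shows "radius t \<noteq> \<zero>"
proof
  assume "radius t = \<zero>"
  moreover have "radius t = gfun t \<oplus> \<kappa>"
    unfolding radius_def bval_def gfun_def
    using t center_closed gam_closed kappa_closed by (simp add: R.a_assoc)
  moreover have "gfun t \<in> carrier R"
    unfolding gfun_def using t center_closed gam_closed by simp
  ultimately have "\<ominus> \<kappa> = gfun t"
    using kappa_closed R.minus_equality[of "gfun t" \<kappa>] by simp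
  then show False
    using kappa_choice t by blast
qed

text \<open>\<open>dual z j\<close> is the coefficient of \<open>T\<^sup>j\<close> in \<open>\<Psi>(xe+yf+z)\<close>.\<close>

definition dual :: "(nat \<Rightarrow> 'a) \<Rightarrow> nat \<Rightarrow> 'a" where
  "dual z = (\<lambda>j\<in>{1..d-2}. two R \<otimes> B z (u j))"

lemma card_V0: "d \<ge> 3 \<Longrightarrow> card V0 = order R ^ (d - 2)"
proof -
  assume d: "d \<ge> 3"
  have "order R ^ d = order R * (order R * card V0)"
    using bij_betw_same_card[OF direct_sum] unfolding card_V order_def
    by (simp only: card_cartesian_product)
  moreover have "order R ^ d = order R * (order R * order R ^ (d - 2))"
    using d by (intro power_eq_mult_mult) simp
  ultimately show ?thesis
    using order_gt_one by simp
qed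

lemma dual_closed: "z \<in> carrier V \<Longrightarrow> dual z \<in> {1..d-2} \<rightarrow>\<^sub>E carrier R"
  unfolding dual_def using u_V by auto

text \<open>A difference with zero pairings against the basis is orthogonal to \<open>V0\<close>,
  hence zero by nondegeneracy; surjectivity follows since both sides have q^(d-2) elements. Thus the
  middle coefficients of \<open>Psi\<close> can be prescribed freely and determine z.\<close>

lemma bij_betw_dual:
  assumes d: "d \<ge> 3"
  shows "bij_betw dual V0 ({1..d-2} \<rightarrow>\<^sub>E carrier R)"
proof -
  have fin: "finite ({1..d-2} \<rightarrow>\<^sub>E carrier R)"
    using finite_carrier by (simp add: finite_PiE)
  have inj: "inj_on dual V0"
  proof (rule inj_onI)
    fix z z' assume z: "z \<in> V0" "z' \<in> V0" and eq: "dual z = dual z'"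
    note zV = z[THEN V0_V]
    let ?w = "z \<ominus>\<^bsub>V\<^esub> z'"
    interpret W: submodule R V0 V
      using V0_subspace unfolding subspace_def by simp
    have w: "?w \<in> V0"
    proof -
      have "\<ominus>\<^bsub>V\<^esub> z' \<in> V0"
        using W.smult_closed[of "\<ominus> \<one>" z'] z zV smult_minus_1[of z'] by simp
      then show ?thesis
        unfolding a_minus_def using z by simp
    qed
    have w_V: "?w \<in> carrier V"
      using zV by simp
    have "B ?w (u j) = \<zero>" if j: "j \<in> {1..d-2}" for j
    proof -
      have "two R \<otimes> B z (u j) = two R \<otimes> B z' (u j)"
        using fun_cong[OF eq, of j] j unfolding dual_def by simp
      then have "B z (u j) = B z' (u j)"
        using m_lcancel[of "two R" "B z (u j)" "B z' (u j)"] two_nz zV u_V[OF j] by simp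
      then show ?thesis
        using zV u_V[OF j] by (simp add: B_diff_left r_right_minus_eq)
    qed
    then have orth: "B ?w v = \<zero>" if "v \<in> u ` {1..d-2}" for v
      using that by blast
    \<comment> \<open>The vectors of \<open>V0\<close> orthogonal to ?w form a submodule containing
      the basis, hence all of \<open>V0\<close>.\<close>
    have "B ?w v = \<zero>" if "v \<in> V0" for v
    proof -
      interpret V0: vectorspace R "vs V0"
        by (rule subspace_is_vs[OF V0_subspace])
      have "V0.span (u ` {1..d-2}) = V0" "u ` {1..d-2} \<subseteq> V0"
        using u_basis unfolding V0.basis_def by simp_all
      moreover have "submodule R {v \<in> V0. B ?w v = \<zero>} (vs V0)"
        by (rule submodule.intro)
          (use V0.module_axioms V0_V w_V in \<open>auto simp: B_add_right B_smult_right\<close>)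
      moreover have "u ` {1..d-2} \<subseteq> {v \<in> V0. B ?w v = \<zero>}"
        using orth u_V0 by auto
      ultimately show ?thesis
        using that V0.span_is_subset by blast
    qed
    then have "?w = \<zero>\<^bsub>V\<^esub>"
      using V0_nondegenerate w unfolding nondegenerate_on_def by blast
    then show "z = z'"
      using zV by (metis M.add.inv_closed M.minus_equality M.minus_minus M.a_comm a_minus_def)
  qed
  have "dual ` V0 \<subseteq> {1..d-2} \<rightarrow>\<^sub>E carrier R"
    using dual_closed V0_V by blast
  moreover have "card (dual ` V0) = card ({1..d-2} \<rightarrow>\<^sub>E carrier R)"
    using card_image[OF inj] card_V0[OF d] by (simp add: card_PiE order_def)
  ultimately have "dual ` V0 = {1..d-2} \<rightarrow>\<^sub>E carrier R"
    by (intro card_subset_eq fin) auto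
  with inj show ?thesis
    unfolding bij_betw_def by simp
qed

end

text \<open>The letters stand for a = Q(p), c = Q(c_t), X = t^d, Y = t^(d-1), g =
  \<open>gam\<close>, k = \<kappa>, and x Y + S = 2 B(p, c_t). The left equation is Q(p - c_t) =
  r_t, and the difference of its sides is the polynomial on the right.\<close>

lemma (in cring) sphere_equation_iff:
  assumes "a \<in> carrier R" "c \<in> carrier R" "X \<in> carrier R" "Y \<in> carrier R" "g \<in> carrier R"
    "x \<in> carrier R" "S \<in> carrier R" "k \<in> carrier R"
  shows "a \<oplus> c \<ominus> (x \<otimes> Y \<oplus> S) = c \<oplus> (X \<oplus> g \<otimes> Y \<oplus> k) \<longleftrightarrow>
    X \<oplus> (x \<oplus> g) \<otimes> Y \<oplus> S \<oplus> (k \<ominus> a) = \<zero>"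
proof -
  have "X \<oplus> (x \<oplus> g) \<otimes> Y \<oplus> S \<oplus> (k \<ominus> a) =
      (c \<oplus> (X \<oplus> g \<otimes> Y \<oplus> k)) \<ominus> (a \<oplus> c \<ominus> (x \<otimes> Y \<oplus> S))"
    using assms by algebra
  then show ?thesis
    using assms r_right_minus_eq[of "c \<oplus> (X \<oplus> g \<otimes> Y \<oplus> k)" "a \<oplus> c \<ominus> (x \<otimes> Y \<oplus> S)"]
    by auto
qed

text \<open>Applied with v = x y and c = Q(z): it reads x y off from the constant coefficient of
  \<open>Psi\<close>.\<close>

lemma (in cring) minus_minus_add_cancel:
  assumes "k \<in> carrier R" "v \<in> carrier R" "c \<in> carrier R"
  shows "k \<ominus> (k \<ominus> (v \<oplus> c)) \<ominus> c = v"
  using assms by algebra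

context rn_construction
begin

text \<open>The expansion of r_t - Q(p - c_t) for p = \<open>pt x y z\<close>; by
  \<open>eval_Psi\<close> it is also the value of \<open>Psi x y z\<close> at t.\<close>

definition psi :: "'a \<Rightarrow> 'a \<Rightarrow> (nat \<Rightarrow> 'a) \<Rightarrow> 'a \<Rightarrow> 'a" where
  "psi x y z t = t [^] d \<oplus> (x \<oplus> gam) \<otimes> t [^] (d-1) \<oplus>
     (\<Oplus>j\<in>{1..d-2}. dual z j \<otimes> t [^] j) \<oplus> (\<kappa> \<ominus> Q (pt x y z))"

lemma dual_apply_closed: "z \<in> carrier V \<Longrightarrow> j \<in> {1..d-2} \<Longrightarrow> dual z j \<in> carrier R"
  using dual_closed by (auto simp: PiE_iff)

text \<open>The linear extension of t |-> c_t, with arbitrary coefficients in place of the powers of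
  t. One computation of pairings then serves the sphere equation and the injectivity of the
  lift.\<close>

definition center_lin :: "(nat \<Rightarrow> 'a) \<Rightarrow> nat \<Rightarrow> 'a" where
  "center_lin a = a (d-1) \<odot>\<^bsub>V\<^esub> f \<oplus>\<^bsub>V\<^esub> (\<Oplus>\<^bsub>V\<^esub>j\<in>{1..d-2}. a j \<odot>\<^bsub>V\<^esub> u j)"

lemma center_eq: "center t = center_lin (\<lambda>j. t [^] j)"
  unfolding center_def zvec_def center_lin_def ..

lemma center_lin_closed:
  assumes "a (d-1) \<in> carrier R" "\<And>j. j \<in> {1..d-2} \<Longrightarrow> a j \<in> carrier R"
  shows "(\<Oplus>\<^bsub>V\<^esub>j\<in>{1..d-2}. a j \<odot>\<^bsub>V\<^esub> u j) \<in> carrier V" "center_lin a \<in> carrier V"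
proof -
  show s: "(\<Oplus>\<^bsub>V\<^esub>j\<in>{1..d-2}. a j \<odot>\<^bsub>V\<^esub> u j) \<in> carrier V"
    using assms u_V by (intro M.finsum_closed) auto
  then show "center_lin a \<in> carrier V"
    unfolding center_lin_def using assms(1) f_closed by simp
qed

text \<open>Pairing with f sees only x, because 2 B e f = 1 while f is isotropic and orthogonal to
  \<open>V0\<close>; pairing with \<open>u j\<close> sees only z. Hence y drops out.\<close>

lemma two_B_pt_center_lin:
  assumes x: "x \<in> carrier R" and y: "y \<in> carrier R" and z: "z \<in> V0"
    and a: "a (d-1) \<in> carrier R" "\<And>j. j \<in> {1..d-2} \<Longrightarrow> a j \<in> carrier R"
  shows "two R \<otimes> B (pt x y z) (center_lin a) =
    x \<otimes> a (d-1) \<oplus> (\<Oplus>j\<in>{1..d-2}. dual z j \<otimes> a j)"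
proof -
  note zV = V0_V[OF z] and p = pt_closed[OF x y z]
  have Bz: "B z f = \<zero>"
    using B_f_V0[OF z] B_sym[OF zV f_closed] by simp
  have "B (pt x y z) f = x \<otimes> B e f"
    using x y zV e_closed f_closed Bz B_self[OF f_closed] Q_f
    by (simp add: pt_def B_add_left B_smult_left)
  then have "two R \<otimes> B (pt x y z) (a (d-1) \<odot>\<^bsub>V\<^esub> f) = x \<otimes> a (d-1) \<otimes> (two R \<otimes> B e f)"
    using p a(1) x e_closed f_closed by (simp add: B_smult_right m_ac)
  also have "\<dots> = x \<otimes> a (d-1)"
    using x a(1) by (simp add: B_e_f)
  finally have part1: "two R \<otimes> B (pt x y z) (a (d-1) \<odot>\<^bsub>V\<^esub> f) = x \<otimes> a (d-1)" .
  have Bu: "B (pt x y z) (u j) = B z (u j)" if "j \<in> {1..d-2}" for j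
    using x y zV e_closed f_closed u_V[OF that] B_e_V0[OF u_V0[OF that]] B_f_V0[OF u_V0[OF that]]
    by (simp add: pt_def B_add_left B_smult_left)
  have "B (pt x y z) (\<Oplus>\<^bsub>V\<^esub>j\<in>{1..d-2}. a j \<odot>\<^bsub>V\<^esub> u j) =
      (\<Oplus>j\<in>{1..d-2}. B (pt x y z) (a j \<odot>\<^bsub>V\<^esub> u j))"
    using p a(2) u_V by (intro B_finsum_right) auto
  then have "two R \<otimes> B (pt x y z) (\<Oplus>\<^bsub>V\<^esub>j\<in>{1..d-2}. a j \<odot>\<^bsub>V\<^esub> u j) =
      (\<Oplus>j\<in>{1..d-2}. two R \<otimes> B (pt x y z) (a j \<odot>\<^bsub>V\<^esub> u j))"
    using p a(2) u_V finsum_rdistr[of "{1..d-2}" "two R" "\<lambda>j. B (pt x y z) (a j \<odot>\<^bsub>V\<^esub> u j)"]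
    by auto
  also have "\<dots> = (\<Oplus>j\<in>{1..d-2}. dual z j \<otimes> a j)"
  proof (intro R.finsum_cong' refl)
    fix j assume j: "j \<in> {1..d-2}"
    then show "two R \<otimes> B (pt x y z) (a j \<odot>\<^bsub>V\<^esub> u j) = dual z j \<otimes> a j"
      using p a(2)[OF j] zV u_V[OF j] Bu[OF j] by (simp add: dual_def B_smult_right m_ac)
  qed (use dual_apply_closed[OF zV] a(2) in auto)
  finally show ?thesis
    using part1 p a f_closed center_lin_closed(1)[of a, OF a] unfolding center_lin_def
    by (simp add: B_add_right r_distr)
qed

lemma pt_mem_sphere_iff:
  assumes x: "x \<in> carrier R" and y: "y \<in> carrier R" and z: "z \<in> V0" and t: "t \<in> carrier R"
  shows "pt x y z \<in> sphere_pts R d Q (rn_sphere t) \<longleftrightarrow> psi x y z t = \<zero>"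
proof -
  note p = pt_closed[OF x y z] and c = center_closed[OF t]
  have S: "(\<Oplus>j\<in>{1..d-2}. dual z j \<otimes> t [^] j) \<in> carrier R"
    using dual_apply_closed[OF V0_V[OF z]] t by (intro R.finsum_closed) auto
  have "pt x y z \<in> sphere_pts R d Q (rn_sphere t) \<longleftrightarrow>
      Q (pt x y z \<ominus>\<^bsub>V\<^esub> center t) = Q (center t) \<oplus> bval t"
    using p unfolding sphere_pts_def rn_sphere_def radius_def by simp
  also have "\<dots> \<longleftrightarrow> psi x y z t = \<zero>"
    unfolding Q_diff[OF p c] bval_def psi_def
      two_B_pt_center_lin[OF x y z, of "\<lambda>j. t [^] j", OF R.nat_pow_closed[OF t] R.nat_pow_closed[OF t],
        folded center_eq]
    by (rule sphere_equation_iff) (use p c S x t gam_closed kappa_closed in simp_all)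
  finally show ?thesis .
qed

lemma dual_eq: "(\<Oplus>\<^bsub>UP R\<^esub>j\<in>{1..d-2}. monom (UP R) (two R \<otimes> B z (u j)) j) =
    (\<Oplus>\<^bsub>UP R\<^esub>j\<in>{1..d-2}. monom (UP R) (dual z j) j)" if "z \<in> V0"
proof -
  interpret UP_domain R "UP R" by unfold_locales simp
  show ?thesis
    using dual_apply_closed[OF V0_V[OF that]] by (intro P.finsum_cong') (auto simp: dual_def)
qed

lemma Psi_closed:
  assumes "x \<in> carrier R" "y \<in> carrier R" "z \<in> V0"
  shows "Psi x y z \<in> carrier (UP R)"
proof -
  interpret UP_domain R "UP R" by unfold_locales simp
  show ?thesis
    unfolding Psi_def dual_eq[OF assms(3)]
    using assms gam_closed kappa_closed pt_closed dual_apply_closed[OF V0_V[OF assms(3)]]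
    by (intro P.add.m_closed P.finsum_closed monom_closed) auto
qed

lemma eval_Psi:
  assumes x: "x \<in> carrier R" and y: "y \<in> carrier R" and z: "z \<in> V0" and t: "t \<in> carrier R"
  shows "eval R R id t (Psi x y z) = psi x y z t"
proof -
  interpret UP_domain R "UP R" by unfold_locales simp
  interpret UP_pre_univ_prop R R id "UP R" by unfold_locales simp
  interpret E: ring_hom_cring "UP R" R "eval R R id t"
    by unfold_locales (rule eval_ring_hom[OF t])
  note dc = dual_apply_closed[OF V0_V[OF z]]
  have mon: "eval R R id t (monom (UP R) a n) = a \<otimes> t [^] n" if "a \<in> carrier R" for a n
    using eval_monom[OF that t, of n] unfolding id_apply .
  have "eval R R id t (\<Oplus>\<^bsub>UP R\<^esub>j\<in>{1..d-2}. monom (UP R) (dual z j) j) =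
      (\<Oplus>j\<in>{1..d-2}. eval R R id t (monom (UP R) (dual z j) j))"
    using dc by (subst E.hom_finsum) (auto simp: comp_def)
  also have "\<dots> = (\<Oplus>j\<in>{1..d-2}. dual z j \<otimes> t [^] j)"
    using dc t by (intro R.finsum_cong') (auto simp: mon)
  finally have sum: "eval R R id t (\<Oplus>\<^bsub>UP R\<^esub>j\<in>{1..d-2}. monom (UP R) (dual z j) j) =
      (\<Oplus>j\<in>{1..d-2}. dual z j \<otimes> t [^] j)" .
  have cl: "(\<Oplus>\<^bsub>UP R\<^esub>j\<in>{1..d-2}. monom (UP R) (dual z j) j) \<in> carrier (UP R)"
    using dc by (intro P.finsum_closed) auto
  have c0: "\<kappa> \<ominus> Q (pt x y z) \<in> carrier R" "x \<oplus> gam \<in> carrier R"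
    using kappa_closed pt_closed[OF x y z] gam_closed x by simp_all
  show ?thesis
    unfolding Psi_def dual_eq[OF z] psi_def
    using cl c0 t mon[OF c0(1), of 0] mon[OF c0(2), of "d-1"] mon[OF R.one_closed, of d]
    by (simp only: E.hom_add monom_closed P.add.m_closed R.one_closed sum R.nat_pow_0 R.r_one R.l_one R.nat_pow_closed)
qed

text \<open>The exponents 0, 1..d-2, d-1 and d are disjoint, so each coefficient comes from a single
  summand.\<close>

lemma coeff_Psi:
  assumes d: "d \<ge> 3" and x: "x \<in> carrier R" and y: "y \<in> carrier R" and z: "z \<in> V0"
  shows "coeff (UP R) (Psi x y z) n =
    (if n = 0 then \<kappa> \<ominus> Q (pt x y z) else if n \<le> d - 2 then dual z n
     else if n = d - 1 then x \<oplus> gam else if n = d then \<one> else \<zero>)"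
proof -
  interpret UP_domain R "UP R" by unfold_locales simp
  note dc = dual_apply_closed[OF V0_V[OF z]]
  have cl: "(\<Oplus>\<^bsub>UP R\<^esub>j\<in>{1..d-2}. monom (UP R) (dual z j) j) \<in> carrier (UP R)"
    using dc by (intro P.finsum_closed) auto
  have c0: "\<kappa> \<ominus> Q (pt x y z) \<in> carrier R" "x \<oplus> gam \<in> carrier R"
    using kappa_closed pt_closed[OF x y z] gam_closed x by simp_all
  have "coeff (UP R) (\<Oplus>\<^bsub>UP R\<^esub>j\<in>{1..d-2}. monom (UP R) (dual z j) j) n =
      (\<Oplus>j\<in>{1..d-2}. coeff (UP R) (monom (UP R) (dual z j) j) n)"
    using dc by (intro coeff_finsum) auto
  also have "\<dots> = (\<Oplus>j\<in>{1..d-2}. if n = j then dual z j else \<zero>)"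
    using dc by (intro R.finsum_cong') auto
  also have "\<dots> = (if n \<in> {1..d-2} then dual z n else \<zero>)"
  proof (cases "n \<in> {1..d-2}")
    case True
    then show ?thesis
      using R.finsum_singleton[OF True, of "dual z"] dc by auto
  next
    case False
    have "(\<Oplus>j\<in>{1..d-2}. if n = j then dual z j else \<zero>) = (\<Oplus>j\<in>{1..d-2}. \<zero>)"
      using False by (intro R.finsum_cong') auto
    also have "\<dots> = \<zero>"
      by simp
    finally show ?thesis
      unfolding if_not_P[OF False] .
  qed
  finally have sum: "coeff (UP R) (\<Oplus>\<^bsub>UP R\<^esub>j\<in>{1..d-2}. monom (UP R) (dual z j) j) n =
      (if n \<in> {1..d-2} then dual z n else \<zero>)" .
  have "coeff (UP R) (Psi x y z) n = (if d = n then \<one> else \<zero>) \<oplus> (if d - 1 = n then x \<oplus> gam else \<zero>)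
      \<oplus> (if n \<in> {1..d-2} then dual z n else \<zero>) \<oplus> (if 0 = n then \<kappa> \<ominus> Q (pt x y z) else \<zero>)"
    unfolding Psi_def dual_eq[OF z] using cl c0 sum by simp
  then show ?thesis
    using d c0 dc[of n] by auto
qed

text \<open>Both polynomials are monic of degree d, so only lower coefficients are compared; they
  group into an equation for x, one for z, and one that then fixes y.\<close>

lemma Psi_eq_iff:
  assumes d: "d \<ge> 3" and x: "x \<in> carrier R" and y: "y \<in> carrier R" and z: "z \<in> V0"
    and p: "p \<in> carrier (UP R)" "coeff (UP R) p d = \<one>" "\<And>n. n > d \<Longrightarrow> coeff (UP R) p n = \<zero>"
  shows "Psi x y z = p \<longleftrightarrow> x \<oplus> gam = coeff (UP R) p (d-1) \<and>
    dual z = (\<lambda>j\<in>{1..d-2}. coeff (UP R) p j) \<and> \<kappa> \<ominus> Q (pt x y z) = coeff (UP R) p 0"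
proof -
  interpret UP_domain R "UP R" by unfold_locales simp
  note cP = coeff_Psi[OF d x y z]
  show ?thesis
  proof
    assume *: "Psi x y z = p"
    have "coeff (UP R) p (d-1) = x \<oplus> gam" "coeff (UP R) p 0 = \<kappa> \<ominus> Q (pt x y z)"
      unfolding *[symmetric] cP using d by auto
    moreover have "dual z = (\<lambda>j\<in>{1..d-2}. coeff (UP R) p j)"
      unfolding *[symmetric] cP using dual_closed[OF V0_V[OF z]]
      by (intro ext) (auto simp: PiE_iff extensional_def)
    ultimately show "x \<oplus> gam = coeff (UP R) p (d-1) \<and>
      dual z = (\<lambda>j\<in>{1..d-2}. coeff (UP R) p j) \<and> \<kappa> \<ominus> Q (pt x y z) = coeff (UP R) p 0"
      by simp
  next
    assume *: "x \<oplus> gam = coeff (UP R) p (d-1) \<and>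
      dual z = (\<lambda>j\<in>{1..d-2}. coeff (UP R) p j) \<and> \<kappa> \<ominus> Q (pt x y z) = coeff (UP R) p 0"
    show "Psi x y z = p"
    proof (rule up_eqI[OF _ Psi_closed[OF x y z] p(1)])
      fix n
      consider "n = 0" | "n \<in> {1..d-2}" | "n = d - 1" | "n = d" | "n > d"
        by fastforce
      then show "coeff (UP R) (Psi x y z) n = coeff (UP R) p n"
        unfolding cP using * p(2,3) d by cases auto
    qed
  qed
qed

text \<open>The system is triangular: the coefficient of T^(d-1) gives x, the middle ones give z by
  \<open>bij_betw_dual\<close>, and the constant one gives the product x y. Since the
  T^(d-1)-coefficient differs from \<open>gam\<close>, x is nonzero and y can be divided
  out.\<close>

lemma ex1_Psi_eq:
  assumes d: "d \<ge> 3"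
    and p: "p \<in> carrier (UP R)" "coeff (UP R) p d = \<one>" "\<And>n. n > d \<Longrightarrow> coeff (UP R) p n = \<zero>"
    and gam: "coeff (UP R) p (d-1) \<noteq> gam"
  shows "\<exists>!q. \<exists>x\<in>carrier R - {\<zero>}. \<exists>y\<in>carrier R. \<exists>z\<in>V0. q = pt x y z \<and> Psi x y z = p"
proof -
  note lcancel = m_lcancel
  interpret UP_domain R "UP R" by unfold_locales simp
  note iff = Psi_eq_iff[OF d _ _ _ p]
  have cp: "coeff (UP R) p n \<in> carrier R" for n
    using p(1) by simp
  define x where "x = coeff (UP R) p (d-1) \<ominus> gam"
  have x: "x \<in> carrier R" "x \<noteq> \<zero>"
    unfolding x_def using cp gam_closed gam by (simp_all add: R.r_right_minus_eq)
  have xg: "x \<oplus> gam = coeff (UP R) p (d-1)"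
    unfolding x_def using cp[of "d-1"] gam_closed by (simp add: a_minus_def R.a_assoc R.l_neg)
  have "(\<lambda>j\<in>{1..d-2}. coeff (UP R) p j) \<in> {1..d-2} \<rightarrow>\<^sub>E carrier R"
    using cp by simp
  then obtain z where z: "z \<in> V0" "dual z = (\<lambda>j\<in>{1..d-2}. coeff (UP R) p j)"
    using bij_betw_imp_surj_on[OF bij_betw_dual[OF d]] by (metis (no_types, lifting) imageE)
  define y where "y = inv x \<otimes> (\<kappa> \<ominus> coeff (UP R) p 0 \<ominus> Q z)"
  have ix: "inv x \<in> carrier R" "x \<otimes> inv x = \<one>"
    using x field_Units by auto
  note clos = cp[of 0] kappa_closed Q_closed[OF V0_V[OF z(1)]]
  have y: "y \<in> carrier R"
    unfolding y_def using ix clos by simp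
  have "x \<otimes> y = \<kappa> \<ominus> coeff (UP R) p 0 \<ominus> Q z"
    unfolding y_def using ix x clos by (simp flip: R.m_assoc)
  moreover have "k \<ominus> (k \<ominus> c \<ominus> q \<oplus> q) = c" if "k \<in> carrier R" "c \<in> carrier R" "q \<in> carrier R" for k c q
    using that by (simp add: a_minus_def R.a_assoc R.l_neg R.minus_add R.r_neg1 R.r_neg2)
  ultimately have "\<kappa> \<ominus> Q (pt x y z) = coeff (UP R) p 0"
    using Q_decomp[OF x(1) y z(1)] clos by simp
  then have ex: "Psi x y z = p"
    using iff[OF x(1) y z(1)] xg z(2) by simp
  show ?thesis
  proof (rule ex1I)
    show "\<exists>x'\<in>carrier R - {\<zero>}. \<exists>y'\<in>carrier R. \<exists>z'\<in>V0. pt x y z = pt x' y' z' \<and> Psi x' y' z' = p"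
      using x y z(1) ex by blast
  next
    fix q assume "\<exists>x'\<in>carrier R - {\<zero>}. \<exists>y'\<in>carrier R. \<exists>z'\<in>V0. q = pt x' y' z' \<and> Psi x' y' z' = p"
    then obtain x' y' z' where q: "x' \<in> carrier R" "y' \<in> carrier R" "z' \<in> V0" "q = pt x' y' z'"
      "Psi x' y' z' = p"
      by blast
    have eqs: "x' \<oplus> gam = coeff (UP R) p (d-1)" "dual z' = (\<lambda>j\<in>{1..d-2}. coeff (UP R) p j)"
        "\<kappa> \<ominus> Q (pt x' y' z') = coeff (UP R) p 0"
      using iff[OF q(1-3)] q(5) by simp_all
    have "x' \<oplus> gam = x \<oplus> gam"
      using eqs xg by simp
    then have [simp]: "x' = x"
      using q(1) x(1) gam_closed R.add.right_cancel by blast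
    have [simp]: "z' = z"
      by (rule inj_onD[OF bij_betw_imp_inj_on[OF bij_betw_dual[OF d]]]) (use eqs z q(3) in simp_all)
    have "\<kappa> \<ominus> (x \<otimes> y' \<oplus> Q z) = \<kappa> \<ominus> (x \<otimes> y \<oplus> Q z)"
      using eqs Q_decomp[OF x(1) q(2) z(1)] Q_decomp[OF x(1) y z(1)] \<open>\<kappa> \<ominus> Q (pt x y z) = _\<close> by simp
    then have "x \<otimes> y' = x \<otimes> y"
      using R.minus_minus_add_cancel[of \<kappa> "x \<otimes> y" "Q z"]
        R.minus_minus_add_cancel[of \<kappa> "x \<otimes> y'" "Q z"] x y q(2) clos by simp
    then have "y' = y"
      using lcancel x y q(2) by simp
    then show "q = pt x y z"
      using q(4) by simp
  qed
qed

lemma rn_setsD: "A \<in> rn_sets \<Longrightarrow> A \<subseteq> carrier R" "A \<in> rn_sets \<Longrightarrow> card A = d" "A \<in> rn_sets \<Longrightarrow> finite A"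
  unfolding rn_sets_def using finite_carrier by (auto intro: finite_subset)

text \<open>The T^(d-1)-coefficient of the root polynomial is minus the sum of A, so the condition
  in \<open>rn_sets\<close> is what \<open>ex1_Psi_eq\<close> requires; this makes the definite
  description in \<open>rn_point\<close> proper.\<close>

lemma rn_point_obtain:
  assumes d: "d \<ge> 3" and A: "A \<in> rn_sets"
  obtains x y z where "x \<in> carrier R" "y \<in> carrier R" "z \<in> V0" "rn_point A = pt x y z"
    "Psi x y z = root_poly A"
proof -
  interpret UP_domain R "UP R" by unfold_locales simp
  have nonempty: "A \<noteq> {}"
    using rn_setsD(2)[OF A] d by auto
  have "\<ominus> (\<Oplus>a\<in>A. a) \<noteq> gam"
    using A unfolding rn_sets_def by simp
  note pl = prod_linear_factors[OF rn_setsD(3)[OF A] rn_setsD(1)[OF A], folded root_poly_def, unfolded rn_setsD(2)[OF A]]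
  have "\<exists>!q. \<exists>x\<in>carrier R - {\<zero>}. \<exists>y\<in>carrier R. \<exists>z\<in>V0. q = pt x y z \<and> Psi x y z = root_poly A"
    using pl(4)[OF nonempty] \<open>_ \<noteq> gam\<close> by (intro ex1_Psi_eq d pl) simp_all
  from theI'[OF this, folded rn_point_def] show ?thesis
    using that by blast
qed

lemma rn_point_mem_sphere_iff:
  assumes d: "d \<ge> 3" and A: "A \<in> rn_sets" and t: "t \<in> carrier R"
  shows "rn_point A \<in> sphere_pts R d Q (rn_sphere t) \<longleftrightarrow> t \<in> A"
proof -
  interpret UP_domain R "UP R" by unfold_locales simp
  obtain x y z where q: "x \<in> carrier R" "y \<in> carrier R" "z \<in> V0" "rn_point A = pt x y z"
    "Psi x y z = root_poly A"
    by (rule rn_point_obtain[OF d A])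
  have "rn_point A \<in> sphere_pts R d Q (rn_sphere t) \<longleftrightarrow> eval R R id t (root_poly A) = \<zero>"
    unfolding q(4) pt_mem_sphere_iff[OF q(1-3) t] q(5)[symmetric] eval_Psi[OF q(1-3) t] ..
  also have "\<dots> \<longleftrightarrow> t \<in> A"
    unfolding root_poly_def by (rule eval_prod_linear_factors_eq_zero[OF rn_setsD(3)[OF A] rn_setsD(1)[OF A] t])
  finally show ?thesis .
qed

text \<open>A is read off from its point as the set of parameters t with p_A on S_t.\<close>

lemma inj_on_rn_point:
  assumes d: "d \<ge> 3"
  shows "inj_on rn_point rn_sets"
proof (rule inj_onI)
  fix A A' assume A: "A \<in> rn_sets" "A' \<in> rn_sets" and eq: "rn_point A = rn_point A'"
  have "t \<in> A \<longleftrightarrow> t \<in> A'" if "t \<in> carrier R" for t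
    using rn_point_mem_sphere_iff[OF d A(1) that] rn_point_mem_sphere_iff[OF d A(2) that] eq by simp
  then show "A = A'"
    using rn_setsD(1)[OF A(1)] rn_setsD(1)[OF A(2)] by blast
qed

end

section \<open>Flats meeting the moment curve\<close>

text \<open>Used both for the translation of the affine map and for the base point of a flat:
  neither affects chords.\<close>

lemma (in abelian_group) diff_shift:
  assumes "x \<in> carrier G" "y \<in> carrier G" "z \<in> carrier G"
  shows "x \<ominus> y = (z \<oplus> x) \<ominus> (z \<oplus> y)"
  using assms by (simp add: a_minus_def minus_add a_comm[of z x] a_assoc r_neg2)

lemma (in vectorspace) card_subspace:
  assumes "finite (carrier K)" "finite (carrier V)" "subspace K W V"
  shows "card W = order K ^ vectorspace.dim K (vs W)"
proof -
  interpret W: vectorspace K "vs W"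
    by (rule subspace_is_vs) fact
  have "W \<subseteq> carrier V"
    using assms(3) unfolding subspace_def submodule_def by blast
  then show ?thesis
    using W.card_carrier_eq[OF assms(1)] finite_subset[OF _ assms(2)] by simp
qed

section \<open>Chords of the moment curve\<close>

locale plain_field = field R for R :: "'a ring" (structure)
begin

lemma moment_curve_closed: "t \<in> carrier R \<Longrightarrow> moment_curve R n t \<in> carrier (coord_space R n)"
  unfolding moment_curve_def func_space_carrier by simp

lemma coord_space_diff:
  assumes "x \<in> carrier (coord_space R n)" "y \<in> carrier (coord_space R n)" "i \<in> {1..n}"
  shows "(x \<ominus>\<^bsub>coord_space R n\<^esub> y) i = x i \<ominus> y i"
  using assms unfolding a_minus_def func_space_neg[OF assms(2)] func_space_add by simp

definition chord_comb :: "nat \<Rightarrow> 'a set \<Rightarrow> 'a \<Rightarrow> ('a \<Rightarrow> 'a) \<Rightarrow> nat \<Rightarrow> 'a" where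
  "chord_comb n A t0 c = (\<Oplus>\<^bsub>coord_space R n\<^esub>a\<in>A.
     c a \<odot>\<^bsub>coord_space R n\<^esub> (moment_curve R n a \<ominus>\<^bsub>coord_space R n\<^esub> moment_curve R n t0))"

lemma chord_closed:
  assumes "a \<in> carrier R" "t0 \<in> carrier R"
  shows "moment_curve R n a \<ominus>\<^bsub>coord_space R n\<^esub> moment_curve R n t0 \<in> carrier (coord_space R n)"
proof -
  interpret V: vectorspace R "coord_space R n" by (rule vectorspace_func_space)
  show ?thesis
    using assms moment_curve_closed by (intro V.M.minus_closed)
qed

lemma chord_comb_closed:
  assumes "A \<subseteq> carrier R" "t0 \<in> carrier R" "c \<in> A \<rightarrow> carrier R"
  shows "chord_comb n A t0 c \<in> carrier (coord_space R n)"
proof -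
  interpret V: vectorspace R "coord_space R n" by (rule vectorspace_func_space)
  show ?thesis
    unfolding chord_comb_def using assms chord_closed
    by (intro V.M.finsum_closed) (auto simp: subset_eq)
qed

lemma chord_comb_apply:
  assumes A: "finite A" "A \<subseteq> carrier R" and t0: "t0 \<in> carrier R" and c: "c \<in> A \<rightarrow> carrier R"
    and j: "j \<in> {1..n}"
  shows "chord_comb n A t0 c j = (\<Oplus>a\<in>A. c a \<otimes> (a [^] j \<ominus> t0 [^] j))"
proof -
  interpret V: vectorspace R "coord_space R n" by (rule vectorspace_func_space)
  have "chord_comb n A t0 c j = (\<Oplus>a\<in>A. (c a \<odot>\<^bsub>coord_space R n\<^esub>
      (moment_curve R n a \<ominus>\<^bsub>coord_space R n\<^esub> moment_curve R n t0)) j)"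
    unfolding chord_comb_def using A t0 c j chord_closed
    by (intro func_space_finsum) (auto simp: subset_eq)
  also have "\<dots> = (\<Oplus>a\<in>A. c a \<otimes> (a [^] j \<ominus> t0 [^] j))"
  proof (intro finsum_cong' refl)
    fix a assume "a \<in> A"
    then have a: "a \<in> carrier R" using A by blast
    show "(c a \<odot>\<^bsub>coord_space R n\<^esub> (moment_curve R n a \<ominus>\<^bsub>coord_space R n\<^esub> moment_curve R n t0)) j =
        c a \<otimes> (a [^] j \<ominus> t0 [^] j)"
      using j coord_space_diff[OF moment_curve_closed[OF a] moment_curve_closed[OF t0] j]
      by (simp add: func_space_smult moment_curve_def)
  qed (use A t0 c in auto)
  finally show ?thesis .
qed

text \<open>A vanishing combination of chords becomes a vanishing combination of the powers a [^] j
  over \<open>insert t0 A\<close> once t0 receives minus the sum of the coefficients. This choice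
  also supplies the equation j = 0, which the coordinates 1..n do not contain, so
  \<open>vandermonde_trivial\<close> applies to up to n + 1 points. Injectivity in the coefficients
  is the form of independence that counting needs.\<close>

lemma inj_on_chord_comb:
  assumes A: "finite A" "A \<subseteq> carrier R" "card A \<le> n" and t0: "t0 \<in> carrier R" "t0 \<notin> A"
  shows "inj_on (chord_comb n A t0) (A \<rightarrow>\<^sub>E carrier R)"
proof (rule inj_onI)
  fix c c' assume c: "c \<in> A \<rightarrow>\<^sub>E carrier R" "c' \<in> A \<rightarrow>\<^sub>E carrier R"
    and eq: "chord_comb n A t0 c = chord_comb n A t0 c'"
  let ?b = "\<lambda>a. c a \<ominus> c' a"
  have cl: "c a \<in> carrier R" "c' a \<in> carrier R" "a \<in> carrier R" if "a \<in> A" for a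
    using c A that by auto
  have bcl: "?b \<in> A \<rightarrow> carrier R"
    using cl by simp
  define s where "s = (\<Oplus>a\<in>A. ?b a)"
  have s: "s \<in> carrier R"
    unfolding s_def using bcl by (rule finsum_closed)
  let ?b' = "\<lambda>a. if a = t0 then \<ominus> s else ?b a"
  have diff: "(\<Oplus>a\<in>A. ?b a \<otimes> (a [^] j \<ominus> t0 [^] j)) = \<zero>" if j: "j \<in> {1..n}" for j
  proof -
    have "(\<Oplus>a\<in>A. ?b a \<otimes> (a [^] j \<ominus> t0 [^] j)) =
        (\<Oplus>a\<in>A. c a \<otimes> (a [^] j \<ominus> t0 [^] j) \<oplus> (\<ominus> \<one>) \<otimes> (c' a \<otimes> (a [^] j \<ominus> t0 [^] j)))"
    proof (intro finsum_cong' refl)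
      fix a assume "a \<in> A"
      note cla = cl[OF this]
      have "(x \<ominus> x') \<otimes> v = x \<otimes> v \<oplus> (\<ominus> \<one>) \<otimes> (x' \<otimes> v)"
        if "x \<in> carrier R" "x' \<in> carrier R" "v \<in> carrier R" for x x' v
        using that by algebra
      then show "?b a \<otimes> (a [^] j \<ominus> t0 [^] j) =
          c a \<otimes> (a [^] j \<ominus> t0 [^] j) \<oplus> (\<ominus> \<one>) \<otimes> (c' a \<otimes> (a [^] j \<ominus> t0 [^] j))"
        using cla t0 by simp
    qed (use cl t0 in auto)
    also have "\<dots> = (\<Oplus>a\<in>A. c a \<otimes> (a [^] j \<ominus> t0 [^] j)) \<oplus>
        (\<Oplus>a\<in>A. (\<ominus> \<one>) \<otimes> (c' a \<otimes> (a [^] j \<ominus> t0 [^] j)))"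
      using cl t0 by (intro finsum_addf) auto
    also have "(\<Oplus>a\<in>A. (\<ominus> \<one>) \<otimes> (c' a \<otimes> (a [^] j \<ominus> t0 [^] j))) =
        (\<ominus> \<one>) \<otimes> (\<Oplus>a\<in>A. c' a \<otimes> (a [^] j \<ominus> t0 [^] j))"
      using cl t0 A by (intro finsum_rdistr[symmetric]) auto
    also have "(\<Oplus>a\<in>A. c a \<otimes> (a [^] j \<ominus> t0 [^] j)) = (\<Oplus>a\<in>A. c' a \<otimes> (a [^] j \<ominus> t0 [^] j))"
      using chord_comb_apply[OF A(1,2) t0(1) _ j, of c] chord_comb_apply[OF A(1,2) t0(1) _ j, of c'] c eq
      by (auto simp: PiE_def)
    finally show ?thesis
      using finsum_closed[of "\<lambda>a. c' a \<otimes> (a [^] j \<ominus> t0 [^] j)" A] cl t0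
      by (simp add: l_minus r_neg Pi_iff)
  qed
  have "(\<Oplus>a\<in>insert t0 A. ?b' a \<otimes> a [^] j) = \<zero>" if "j < card (insert t0 A)" for j :: nat
  proof -
    have ins: "(\<Oplus>a\<in>insert t0 A. ?b' a \<otimes> a [^] j) = ?b' t0 \<otimes> t0 [^] j \<oplus> (\<Oplus>a\<in>A. ?b' a \<otimes> a [^] j)"
      using A t0 cl s by (intro finsum_insert) auto
    have "(\<Oplus>a\<in>A. ?b' a \<otimes> a [^] j) = (\<Oplus>a\<in>A. ?b a \<otimes> (a [^] j \<ominus> t0 [^] j) \<oplus> ?b a \<otimes> t0 [^] j)"
    proof (intro finsum_cong' refl)
      fix a assume a: "a \<in> A"
      have split: "v \<otimes> p = v \<otimes> (p \<ominus> r) \<oplus> v \<otimes> r"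
        if "v \<in> carrier R" "p \<in> carrier R" "r \<in> carrier R" for v p r
        using that by algebra
      have "a \<noteq> t0"
        using a t0 by blast
      then show "?b' a \<otimes> a [^] j = ?b a \<otimes> (a [^] j \<ominus> t0 [^] j) \<oplus> ?b a \<otimes> t0 [^] j"
        using split[of "?b a" "a [^] j" "t0 [^] j"] cl[OF a] t0 by simp
    qed (use cl t0 in auto)
    also have "\<dots> = (\<Oplus>a\<in>A. ?b a \<otimes> (a [^] j \<ominus> t0 [^] j)) \<oplus> (\<Oplus>a\<in>A. ?b a \<otimes> t0 [^] j)"
      using cl t0 by (intro finsum_addf) auto
    also have "(\<Oplus>a\<in>A. ?b a \<otimes> t0 [^] j) = s \<otimes> t0 [^] j"
      unfolding s_def using cl t0 A by (intro finsum_ldistr[symmetric]) auto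
    also have "(\<Oplus>a\<in>A. ?b a \<otimes> (a [^] j \<ominus> t0 [^] j)) = \<zero>"
    \<comment> \<open>For j = 0 each factor is 1 - 1; for j >= 1 the sum is a coordinate, since j <=
      card A <= n.\<close>
    proof (cases "j = 0")
      case True
      have "(\<Oplus>a\<in>A. ?b a \<otimes> (a [^] j \<ominus> t0 [^] j)) = (\<Oplus>a\<in>A. \<zero>)"
        using True cl t0 by (intro finsum_cong') (auto simp: a_minus_def r_neg)
      then show ?thesis by simp
    next
      case False
      then show ?thesis
        using that A t0 by (intro diff) auto
    qed
    finally show ?thesis
      unfolding ins using s t0 by (simp add: l_minus l_neg)
  qed
  then have "\<forall>a\<in>insert t0 A. ?b' a = \<zero>"
    by (intro vandermonde_trivial) (use A t0 s cl in auto)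
  then have "c a = c' a" if "a \<in> A" for a
    using that t0 cl[OF that] by (auto simp: r_right_minus_eq split: if_splits)
  then show "c = c'"
    using c by (intro PiE_ext) auto
qed

end

text \<open>The lifted spheres are the instance with n = d and W of dimension d + 1; T is the linear
  part and b the translation.\<close>

locale affine_moment_curve = linear_map R "coord_space R n" W T
  for R :: "'a ring" (structure) and n :: nat and W :: "('a, 'w) module" and T +
  fixes b
  assumes finite_R: "finite (carrier R)" and finite_W: "finite (carrier W)"
    and inj_T: "inj_on T (carrier (coord_space R n))" and b_closed: "b \<in> carrier W"

sublocale affine_moment_curve \<subseteq> plain_field R
  by unfold_locales

context affine_moment_curve
begin

definition L where "L x = b \<oplus>\<^bsub>W\<^esub> T x"

definition curve where "curve t = L (moment_curve R n t)"

lemma one_less_order: "1 < order R"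
proof -
  have "card {\<zero>, \<one>} \<le> order R"
    unfolding order_def by (intro card_mono finite_R) auto
  then show ?thesis by simp
qed

lemma inj_L: "inj_on L (carrier (coord_space R n))"
proof (rule inj_onI)
  fix x y assume xy: "x \<in> carrier (coord_space R n)" "y \<in> carrier (coord_space R n)" "L x = L y"
  then have "T x = T y"
    using W.module.M.r_neg1[of b "T x"] W.module.M.r_neg1[of b "T y"] b_closed unfolding L_def by simp
  then show "x = y"
    using inj_onD[OF inj_T] xy by simp
qed

text \<open>Two points of a flat differ by a vector of its direction space U. On the curve such a
  difference is T of a chord, because the translation b cancels.\<close>

lemma T_chord_comb_mem:
  assumes U: "subspace R U W" and a0: "a0 \<in> carrier W"
    and A: "finite A" "A \<subseteq> carrier R" and t0: "t0 \<in> carrier R"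
    and mem: "\<And>t. t \<in> insert t0 A \<Longrightarrow> curve t \<in> (\<lambda>w. a0 \<oplus>\<^bsub>W\<^esub> w) ` U"
    and c: "c \<in> A \<rightarrow> carrier R"
  shows "T (chord_comb n A t0 c) \<in> U"
proof -
  interpret U: submodule R U W
    using U unfolding subspace_def by simp
  let ?V = "coord_space R n"
  let ?m = "moment_curve R n"
  have U_diff: "v \<ominus>\<^bsub>W\<^esub> w \<in> U" if "v \<in> U" "w \<in> U" for v w
  proof -
    have "w \<in> carrier W"
      using U.subset that(2) by (rule subsetD)
    then have "\<ominus>\<^bsub>W\<^esub> w \<in> U"
      using U.smult_closed[of "\<ominus> \<one>" w] W.module.smult_minus_1[of w] that by simp
    then show ?thesis
      unfolding a_minus_def using that by simp
  qed
  have chord: "T (?m a \<ominus>\<^bsub>?V\<^esub> ?m t0) \<in> U" if a: "a \<in> A" for a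
  proof -
    obtain v w where vw: "v \<in> U" "w \<in> U" "b \<oplus>\<^bsub>W\<^esub> T (?m a) = a0 \<oplus>\<^bsub>W\<^esub> v" "b \<oplus>\<^bsub>W\<^esub> T (?m t0) = a0 \<oplus>\<^bsub>W\<^esub> w"
      using mem[of a] mem[of t0] a unfolding curve_def L_def by blast
    have m: "T (?m a) \<in> carrier W" "T (?m t0) \<in> carrier W"
      using moment_curve_closed a A t0 by (auto intro!: f_im)
    have vwW: "v \<in> carrier W" "w \<in> carrier W"
      using vw U.subset by auto
    have "T (?m a \<ominus>\<^bsub>?V\<^esub> ?m t0) = T (?m a) \<ominus>\<^bsub>W\<^esub> T (?m t0)"
      using moment_curve_closed a A t0 by (intro f_minus) auto
    also have "\<dots> = v \<ominus>\<^bsub>W\<^esub> w"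
      using W.module.M.diff_shift[OF m b_closed] W.module.M.diff_shift[OF vwW a0] vw by simp
    finally show ?thesis
      using U_diff vw by simp
  qed
  have "(\<Oplus>\<^bsub>?V\<^esub>a\<in>A. c a \<odot>\<^bsub>?V\<^esub> (?m a \<ominus>\<^bsub>?V\<^esub> ?m t0)) \<in> {v \<in> carrier ?V. T v \<in> U}"
    using A c chord
  proof (induction A rule: finite_induct)
    case empty
    then show ?case by simp
  next
    case (insert a A)
    let ?g = "\<lambda>a. c a \<odot>\<^bsub>?V\<^esub> (?m a \<ominus>\<^bsub>?V\<^esub> ?m t0)"
    have g: "?g x \<in> carrier ?V" "?m x \<ominus>\<^bsub>?V\<^esub> ?m t0 \<in> carrier ?V" if "x \<in> insert a A" for x
      using chord_closed[of x t0 n] t0 insert.prems that by auto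
    have "(\<Oplus>\<^bsub>?V\<^esub>a\<in>insert a A. ?g a) = ?g a \<oplus>\<^bsub>?V\<^esub> (\<Oplus>\<^bsub>?V\<^esub>a\<in>A. ?g a)"
      using insert.hyps g by (intro V.module.M.finsum_insert) auto
    moreover have "(\<Oplus>\<^bsub>?V\<^esub>a\<in>A. ?g a) \<in> {v \<in> carrier ?V. T v \<in> U}"
      using insert.prems by (intro insert.IH) auto
    moreover have "T (?g a) \<in> U"
      using insert.prems g(2)[of a] by auto
    ultimately show ?case
      using g(1)[of a] by simp
  qed
  then show ?thesis
    unfolding chord_comb_def by simp
qed

text \<open>The q^(card A) combinations of the chords at t0 have distinct images under T, all inside
  U, which has q^dim elements.\<close>

lemma card_le_dim_of_curve:
  assumes U: "subspace R U W" and a0: "a0 \<in> carrier W"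
    and A: "finite A" "A \<subseteq> carrier R" "card A \<le> n" and t0: "t0 \<in> carrier R" "t0 \<notin> A"
    and mem: "\<And>t. t \<in> insert t0 A \<Longrightarrow> curve t \<in> (\<lambda>w. a0 \<oplus>\<^bsub>W\<^esub> w) ` U"
  shows "card A \<le> vectorspace.dim R (W\<lparr>carrier := U\<rparr>)"
proof -
  have UW: "U \<subseteq> carrier W"
    using U unfolding subspace_def submodule_def by blast
  have "inj_on (\<lambda>c. T (chord_comb n A t0 c)) (A \<rightarrow>\<^sub>E carrier R)"
    using comp_inj_on[OF inj_on_chord_comb[OF A t0] inj_on_subset[OF inj_T]]
      chord_comb_closed[OF A(2) t0(1)] by (auto simp: comp_def PiE_def image_subset_iff)
  then have "card (A \<rightarrow>\<^sub>E carrier R) \<le> card U"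
    using T_chord_comb_mem[OF U a0 A(1,2) t0(1) mem] finite_subset[OF UW finite_W]
    by (intro card_inj_on_le) (auto simp: PiE_def)
  then have "order R ^ card A \<le> order R ^ vectorspace.dim R (W\<lparr>carrier := U\<rparr>)"
    using A(1) W.card_subspace[OF finite_R finite_W U] by (simp add: card_PiE order_def)
  then show ?thesis
    using one_less_order by (simp add: power_increasing_iff)
qed

text \<open>k + 2 points on the flat would give k + 1 chords at one of them. These are independent
  because k + 1 <= n, so they do not fit into dimension k.\<close>

lemma card_curve_in_flat_le:
  assumes F: "affine_flat R W k F" and k: "k < n"
  shows "card {t \<in> carrier R. curve t \<in> F} \<le> k + 1"
proof (rule ccontr)
  assume "\<not> ?thesis"
  then have "k + 2 \<le> card {t \<in> carrier R. curve t \<in> F}"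
    by simp
  then obtain X where X: "X \<subseteq> {t \<in> carrier R. curve t \<in> F}" "card X = k + 2" "finite X"
    by (rule obtain_subset_with_card_n)
  then obtain t0 where t0: "t0 \<in> X"
    by fastforce
  obtain a0 U where U: "a0 \<in> carrier W" "subspace R U W" "vectorspace.dim R (W\<lparr>carrier := U\<rparr>) = k"
    "F = (\<lambda>w. a0 \<oplus>\<^bsub>W\<^esub> w) ` U"
    using F unfolding affine_flat_def by blast
  have card: "card (X - {t0}) = k + 1"
    using X t0 by simp
  have "card (X - {t0}) \<le> vectorspace.dim R (W\<lparr>carrier := U\<rparr>)"
  proof (rule card_le_dim_of_curve[OF U(2,1), of _ t0])
    show "curve t \<in> (\<lambda>w. a0 \<oplus>\<^bsub>W\<^esub> w) ` U" if "t \<in> insert t0 (X - {t0})" for t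
      using that X(1) t0 U(4) by blast
  qed (use X t0 card k in auto)
  with card U(3) show False
    by simp
qed

lemma subspace_T_image: "subspace R (T ` carrier (coord_space R n)) W"
  using imT_is_subspace unfolding im_def .

lemma affine_flat_L_image: "affine_flat R W n (L ` carrier (coord_space R n))"
proof -
  have "card (T ` carrier (coord_space R n)) = order R ^ n"
    using card_image[OF inj_T] by (simp add: func_space_carrier card_PiE order_def)
  then have "vectorspace.dim R (W\<lparr>carrier := T ` carrier (coord_space R n)\<rparr>) = n"
    using W.card_subspace[OF finite_R finite_W subspace_T_image] one_less_order power_inject_exp
    by metis
  then show ?thesis
    unfolding affine_flat_def using b_closed subspace_T_image
    by (intro bexI[of _ b] exI[of _ "T ` carrier (coord_space R n)"]) (auto simp: L_def image_image)
qed

text \<open>As n < q, there are n + 1 parameters. Their n chords at one point have q^n distinct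
  combinations, which exhaust the coordinate space, so the direction space of the flat contains the
  whole image of T.\<close>

lemma L_image_subset_flat:
  assumes n: "n < order R" and F: "affine_flat R W k F" and sub: "curve ` carrier R \<subseteq> F"
  shows "L ` carrier (coord_space R n) \<subseteq> F"
proof -
  let ?V = "coord_space R n"
  let ?m = "moment_curve R n"
  obtain a0 U where U: "a0 \<in> carrier W" "subspace R U W" "F = (\<lambda>w. a0 \<oplus>\<^bsub>W\<^esub> w) ` U"
    using F unfolding affine_flat_def by blast
  interpret U: submodule R U W
    using U unfolding subspace_def by simp
  have "n + 1 \<le> card (carrier R)"
    using n unfolding order_def by simp
  then obtain X where X: "X \<subseteq> carrier R" "card X = n + 1" "finite X"
    by (rule obtain_subset_with_card_n)
  then obtain t0 where t0: "t0 \<in> X"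
    by fastforce
  define A where "A = X - {t0}"
  have A: "finite A" "A \<subseteq> carrier R" "card A = n" and t0: "t0 \<in> carrier R" "t0 \<notin> A"
    unfolding A_def using X t0 by auto
  have inj: "inj_on (chord_comb n A t0) (A \<rightarrow>\<^sub>E carrier R)"
    using A t0 by (intro inj_on_chord_comb) auto
  have fin: "finite (carrier ?V)"
    using finite_R by (simp add: func_space_carrier finite_PiE)
  have surj: "chord_comb n A t0 ` (A \<rightarrow>\<^sub>E carrier R) = carrier ?V"
  proof (rule card_subset_eq[OF fin])
    show "chord_comb n A t0 ` (A \<rightarrow>\<^sub>E carrier R) \<subseteq> carrier ?V"
      using chord_comb_closed[OF A(2) t0(1)] by (auto simp: PiE_def)
    show "card (chord_comb n A t0 ` (A \<rightarrow>\<^sub>E carrier R)) = card (carrier ?V)"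
      using card_image[OF inj] A by (simp add: func_space_carrier card_PiE)
  qed
  have T_U: "T v \<in> U" if "v \<in> carrier ?V" for v
  proof -
    from that surj obtain c where "c \<in> A \<rightarrow>\<^sub>E carrier R" "v = chord_comb n A t0 c"
      by blast
    then show ?thesis
      using T_chord_comb_mem[OF U(2,1) A(1,2) t0(1), of c] sub U(3) A t0 by (auto simp: PiE_def)
  qed
  obtain w where w: "w \<in> U" "curve t0 = a0 \<oplus>\<^bsub>W\<^esub> w"
    using sub t0 U(3) by blast
  show ?thesis
  proof
    fix y assume "y \<in> L ` carrier ?V"
    then obtain v where v: "v \<in> carrier ?V" "y = L v"
      by blast
    let ?v = "v \<ominus>\<^bsub>?V\<^esub> ?m t0"
    have m: "?m t0 \<in> carrier ?V"
      by (rule moment_curve_closed) fact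
    have vc: "?v \<in> carrier ?V"
      using v m by simp
    have "v = ?m t0 \<oplus>\<^bsub>?V\<^esub> ?v"
      using v m by (simp add: a_minus_def V.module.M.a_comm[of v] V.module.M.r_neg2)
    then have "T v = T (?m t0) \<oplus>\<^bsub>W\<^esub> T ?v"
      using f_add[OF m vc] by simp
    then have "y = curve t0 \<oplus>\<^bsub>W\<^esub> T ?v"
      unfolding v(2) curve_def L_def using b_closed m vc by (simp add: W.module.M.a_assoc)
    also have "\<dots> = a0 \<oplus>\<^bsub>W\<^esub> (w \<oplus>\<^bsub>W\<^esub> T ?v)"
      unfolding w(2) using w(1) U(1) U.subset vc by (intro W.module.M.a_assoc) auto
    finally show "y \<in> F"
      unfolding U(3) using U.m_closed[OF w(1) T_U[OF vc]] by blast
  qed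
qed

lemma affine_span_curve:
  assumes "n < order R"
  shows "affine_span R W (curve ` carrier R) = L ` carrier (coord_space R n)"
proof
  show "affine_span R W (curve ` carrier R) \<subseteq> L ` carrier (coord_space R n)"
    unfolding affine_span_def using affine_flat_L_image moment_curve_closed
    by (intro Inter_lower) (auto simp: curve_def)
  show "L ` carrier (coord_space R n) \<subseteq> affine_span R W (curve ` carrier R)"
    unfolding affine_span_def using L_image_subset_flat[OF assms] by (intro Inter_greatest) blast
qed

end

section \<open>The lift as an affine image of the moment curve\<close>

context rn_construction
begin

text \<open>The lift of \<open>S\<^sub>t\<close> is \<open>(2c\<^sub>t, b\<^sub>t)\<close>, an affine function of \<open>(t, t\<^sup>2, \<dots>, t\<^sup>d)\<close>.\<close>

definition lift_lin :: "(nat \<Rightarrow> 'a) \<Rightarrow> nat \<Rightarrow> 'a" where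
  "lift_lin a = (\<lambda>i\<in>{1..d+1}. if i \<le> d then two R \<otimes> center_lin a i else a d \<oplus> gam \<otimes> a (d-1))"

definition lift_const :: "nat \<Rightarrow> 'a" where
  "lift_const = (\<lambda>i\<in>{1..d+1}. if i \<le> d then \<zero> else \<kappa>)"

lemma vec_apply: "x \<in> carrier V \<Longrightarrow> i \<in> {1..d} \<Longrightarrow> x i \<in> carrier R"
  unfolding func_space_carrier by auto

lemma center_lin_add:
  assumes d: "d \<ge> 3" and a: "a \<in> carrier V" and b: "b \<in> carrier V"
  shows "center_lin (a \<oplus>\<^bsub>V\<^esub> b) = center_lin a \<oplus>\<^bsub>V\<^esub> center_lin b"
proof -
  have ap: "(a \<oplus>\<^bsub>V\<^esub> b) i = a i \<oplus> b i" "a i \<in> carrier R" "b i \<in> carrier R" if "i \<in> {1..d}" for i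
    using that vec_apply a b by (simp_all add: func_space_add)
  let ?s = "\<lambda>a. (\<Oplus>\<^bsub>V\<^esub>j\<in>{1..d-2}. a j \<odot>\<^bsub>V\<^esub> u j)"
  have s: "?s a \<in> carrier V" "?s b \<in> carrier V"
    using ap(2,3) u_V by (auto intro!: M.finsum_closed)
  have "?s (a \<oplus>\<^bsub>V\<^esub> b) = (\<Oplus>\<^bsub>V\<^esub>j\<in>{1..d-2}. a j \<odot>\<^bsub>V\<^esub> u j \<oplus>\<^bsub>V\<^esub> b j \<odot>\<^bsub>V\<^esub> u j)"
    using ap u_V by (intro M.finsum_cong') (auto simp: smult_l_distr)
  also have "\<dots> = ?s a \<oplus>\<^bsub>V\<^esub> ?s b"
    using ap u_V by (intro M.finsum_addf) auto
  finally have sum: "?s (a \<oplus>\<^bsub>V\<^esub> b) = ?s a \<oplus>\<^bsub>V\<^esub> ?s b" .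
  have "d - 1 \<in> {1..d}"
    using d by auto
  note ap1 = ap[OF this]
  show ?thesis
    unfolding center_lin_def sum ap1(1) using ap1(2,3) f_closed s
    by (simp add: smult_l_distr M.a_ac)
qed

lemma center_lin_smult:
  assumes d: "d \<ge> 3" and c: "c \<in> carrier R" and a: "a \<in> carrier V"
  shows "center_lin (c \<odot>\<^bsub>V\<^esub> a) = c \<odot>\<^bsub>V\<^esub> center_lin a"
proof -
  have ap: "(c \<odot>\<^bsub>V\<^esub> a) i = c \<otimes> a i" "a i \<in> carrier R" if "i \<in> {1..d}" for i
    using that vec_apply a by (simp_all add: func_space_smult)
  let ?s = "\<lambda>a. (\<Oplus>\<^bsub>V\<^esub>j\<in>{1..d-2}. a j \<odot>\<^bsub>V\<^esub> u j)"
  have s: "?s a \<in> carrier V"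
    using ap(2) u_V by (auto intro!: M.finsum_closed)
  have "?s (c \<odot>\<^bsub>V\<^esub> a) = (\<Oplus>\<^bsub>V\<^esub>j\<in>{1..d-2}. c \<odot>\<^bsub>V\<^esub> (a j \<odot>\<^bsub>V\<^esub> u j))"
    using ap u_V c by (intro M.finsum_cong') (auto simp: smult_assoc1)
  also have "\<dots> = c \<odot>\<^bsub>V\<^esub> ?s a"
    using ap u_V c by (intro finsum_smult[symmetric]) auto
  finally have sum: "?s (c \<odot>\<^bsub>V\<^esub> a) = c \<odot>\<^bsub>V\<^esub> ?s a" .
  have "d - 1 \<in> {1..d}"
    using d by auto
  note ap1 = ap[OF this]
  show ?thesis
    unfolding center_lin_def sum ap1(1) using ap1(2) f_closed s c
    by (simp add: smult_r_distr smult_assoc1)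
qed

lemma center_lin_V:
  assumes d: "d \<ge> 3" and a: "a \<in> carrier V"
  shows "center_lin a \<in> carrier V"
  using d vec_apply[OF a] by (intro center_lin_closed) auto

lemma linear_map_lift_lin:
  assumes d: "d \<ge> 3"
  shows "linear_map R V (coord_space R (d+1)) lift_lin"
proof -
  have W: "vectorspace R (coord_space R (d+1))"
    by (rule vectorspace_func_space)
  have i: "i \<in> {1..d}" if "i \<in> {1..d+1}" "i \<le> d" for i
    using that by simp
  have dd: "d \<in> {1..d}" "d - 1 \<in> {1..d}"
    using d by auto
  have "lift_lin \<in> module_hom R V (coord_space R (d+1))"
    unfolding module_hom_def
  proof (intro CollectI conjI allI impI)
    show "lift_lin \<in> carrier V \<rightarrow> carrier (coord_space R (d+1))"
      unfolding lift_lin_def func_space_carrier[of "{1..d+1}"]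
      using vec_apply center_lin_V[OF d] dd gam_closed by auto
  next
    fix a b assume "a \<in> carrier V \<and> b \<in> carrier V"
    then have ab: "a \<in> carrier V" "b \<in> carrier V" by simp_all
    show "lift_lin (a \<oplus>\<^bsub>V\<^esub> b) = lift_lin a \<oplus>\<^bsub>coord_space R (d+1)\<^esub> lift_lin b"
      unfolding lift_lin_def center_lin_add[OF d ab] func_space_add[where A = "{1..d+1}"]
      using vec_apply[OF center_lin_V[OF d ab(1)]] vec_apply[OF center_lin_V[OF d ab(2)]] i
        vec_apply[OF ab(1) dd(1)] vec_apply[OF ab(2) dd(1)] vec_apply[OF ab(1) dd(2)] vec_apply[OF ab(2) dd(2)]
        gam_closed dd
      by (intro restrict_ext) (simp add: func_space_add r_distr R.a_ac)
  next
    fix c a assume "c \<in> carrier R \<and> a \<in> carrier V"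
    then have ca: "c \<in> carrier R" "a \<in> carrier V" by simp_all
    show "lift_lin (c \<odot>\<^bsub>V\<^esub> a) = c \<odot>\<^bsub>coord_space R (d+1)\<^esub> lift_lin a"
      unfolding lift_lin_def center_lin_smult[OF d ca] func_space_smult[where A = "{1..d+1}"]
      using vec_apply[OF center_lin_V[OF d ca(2)]] i ca(1)
        vec_apply[OF ca(2) dd(1)] vec_apply[OF ca(2) dd(2)] gam_closed dd
        m_lcomm[of "two R" c] m_lcomm[of gam c]
      by (intro restrict_ext) (simp add: func_space_smult r_distr)
  qed
  then show ?thesis
    using vectorspace_axioms W unfolding linear_map_def mod_hom_def mod_hom_axioms_def vectorspace_def
    by blast
qed

text \<open>The coefficients are recovered by pairing with points x e + z: x = 1 with
  \<open>dual z\<close> zero isolates the entry d - 1, and x = 0 with \<open>dual z\<close> equal to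
  1 at j and 0 elsewhere isolates the entry j.\<close>

lemma center_lin_inj:
  assumes d: "d \<ge> 3" and ab: "a \<in> carrier V" "b \<in> carrier V" and eq: "center_lin a = center_lin b"
  shows "a (d-1) = b (d-1)" and "j \<in> {1..d-2} \<Longrightarrow> a j = b j"
proof -
  have cl: "c (d-1) \<in> carrier R" "\<And>j. j \<in> {1..d-2} \<Longrightarrow> c j \<in> carrier R" if "c \<in> carrier V" for c
    using vec_apply[OF that] d by auto
  have eqB: "x \<otimes> a (d-1) \<oplus> (\<Oplus>j\<in>{1..d-2}. dual z j \<otimes> a j) =
      x \<otimes> b (d-1) \<oplus> (\<Oplus>j\<in>{1..d-2}. dual z j \<otimes> b j)" if "x \<in> carrier R" "z \<in> V0" for x z
    using two_B_pt_center_lin[OF that(1) R.zero_closed that(2), of a, OF cl[OF ab(1)]]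
      two_B_pt_center_lin[OF that(1) R.zero_closed that(2), of b, OF cl[OF ab(2)]] eq by simp
  have pick: "x \<otimes> a (d-1) \<oplus> y \<otimes> a j = x \<otimes> b (d-1) \<oplus> y \<otimes> b j"
    if "x \<in> carrier R" "y \<in> carrier R" "j \<in> {1..d-2}" for x y j
  proof -
    have "(\<lambda>i\<in>{1..d-2}. if j = i then y else \<zero>) \<in> {1..d-2} \<rightarrow>\<^sub>E carrier R"
      using that by simp
    then obtain z where z: "z \<in> V0" "dual z = (\<lambda>i\<in>{1..d-2}. if j = i then y else \<zero>)"
      using bij_betw_imp_surj_on[OF bij_betw_dual[OF d]] by (metis (no_types, lifting) imageE)
    have sum: "(\<Oplus>i\<in>{1..d-2}. dual z i \<otimes> c i) = y \<otimes> c j" if "c \<in> carrier V" for c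
    proof -
      have "(\<Oplus>i\<in>{1..d-2}. dual z i \<otimes> c i) = (\<Oplus>i\<in>{1..d-2}. if j = i then y \<otimes> c i else \<zero>)"
        using cl[OF that] \<open>y \<in> carrier R\<close> unfolding z(2) by (intro R.finsum_cong') auto
      also have "\<dots> = y \<otimes> c j"
        using cl[OF that] \<open>y \<in> carrier R\<close> \<open>j \<in> {1..d-2}\<close> by (intro R.finsum_singleton) auto
      finally show ?thesis .
    qed
    show ?thesis
      using eqB[OF that(1) z(1)] unfolding sum[OF ab(1)] sum[OF ab(2)] .
  qed
  \<comment> \<open>The index set is nonempty because d >= 3; any index will do, as
    \<open>pick\<close> is used with y = 0.\<close>
  have "1 \<in> {1..d-2}"
    using d by simp
  from pick[OF R.one_closed R.zero_closed this] cl[OF ab(1)] cl[OF ab(2)] this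
  show "a (d-1) = b (d-1)"
    by simp
  show "a j = b j" if "j \<in> {1..d-2}"
    using pick[OF R.zero_closed R.one_closed that] cl[OF ab(1)] cl[OF ab(2)] that by simp
qed

text \<open>The first d coordinates return \<open>center_lin\<close> up to the factor 2, hence the
  entries up to d - 1. The last coordinate then returns the entry d, because \<open>gam\<close>
  times the entry d - 1 is already known.\<close>

lemma inj_on_lift_lin:
  assumes d: "d \<ge> 3"
  shows "inj_on lift_lin (carrier V)"
proof (rule inj_onI)
  fix a b assume ab: "a \<in> carrier V" "b \<in> carrier V" and eq: "lift_lin a = lift_lin b"
  note clV = center_lin_V[OF d ab(1)] center_lin_V[OF d ab(2)]
  have "center_lin a = center_lin b"
  proof (rule PiE_ext[OF clV[unfolded func_space_carrier]])
    fix i assume i: "i \<in> {1..d}"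
    then have "two R \<otimes> center_lin a i = two R \<otimes> center_lin b i"
      using fun_cong[OF eq, of i] unfolding lift_lin_def by simp
    then show "center_lin a i = center_lin b i"
      using m_lcancel[OF two_nz two_closed vec_apply[OF clV(1) i] vec_apply[OF clV(2) i]] by simp
  qed
  note inj = center_lin_inj[OF d ab this]
  have dd: "d \<in> {1..d}" "d - 1 \<in> {1..d}"
    using d by auto
  have "a d \<oplus> gam \<otimes> a (d-1) = b d \<oplus> gam \<otimes> a (d-1)"
    using fun_cong[OF eq, of "d+1"] inj(1) unfolding lift_lin_def by simp
  then have last: "a d = b d"
    using vec_apply[OF ab(1) dd(1)] vec_apply[OF ab(2) dd(1)] vec_apply[OF ab(1) dd(2)] gam_closed
    by (simp add: R.add.right_cancel)
  show "a = b"
  proof (rule PiE_ext[OF ab[unfolded func_space_carrier]])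
    fix i assume "i \<in> {1..d}"
    then consider "i \<in> {1..d-2}" | "i = d - 1" | "i = d"
      by fastforce
    then show "a i = b i"
      using inj last by cases auto
  qed
qed

text \<open>Subtracting Q(c_t) from the radius leaves b_t, in which only t^d, t^(d-1) and constants
  occur.\<close>

lemma lift_eq:
  assumes d: "d \<ge> 3" and t: "t \<in> carrier R"
  shows "sphere_lift R d Q (rn_sphere t) = lift_const \<oplus>\<^bsub>coord_space R (d+1)\<^esub> lift_lin (moment_curve R d t)"
proof -
  have m: "moment_curve R d t i = t [^] i" if "i \<in> {1..d}" for i
    using that unfolding moment_curve_def by simp
  have dd: "d \<in> {1..d}" "d - 1 \<in> {1..d}"
    using d by auto
  have c: "center_lin (moment_curve R d t) = center t"
  proof -
    have "(\<Oplus>\<^bsub>V\<^esub>j\<in>{1..d-2}. moment_curve R d t j \<odot>\<^bsub>V\<^esub> u j) = (\<Oplus>\<^bsub>V\<^esub>j\<in>{1..d-2}. t [^] j \<odot>\<^bsub>V\<^esub> u j)"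
      using t u_V by (intro M.finsum_cong') (auto simp: m)
    then show ?thesis
      unfolding center_eq center_lin_def m[OF dd(2)] by simp
  qed
  have b: "radius t \<ominus> Q (center t) = \<kappa> \<oplus> (t [^] d \<oplus> gam \<otimes> t [^] (d-1))"
  proof -
    have "q \<oplus> (X \<oplus> k) \<ominus> q = k \<oplus> X" if "q \<in> carrier R" "X \<in> carrier R" "k \<in> carrier R" for q X k
      using that by (simp add: a_minus_def R.a_ac R.r_neg)
    then show ?thesis
      unfolding radius_def bval_def using t center_closed[OF t] gam_closed kappa_closed by simp
  qed
  show ?thesis
    unfolding sphere_lift_def rn_sphere_def lift_const_def lift_lin_def c m[OF dd(1)] m[OF dd(2)]
      func_space_add[where A = "{1..d+1}"]
    using vec_apply[OF center_closed[OF t]] by (intro restrict_ext) (simp add: b)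
qed

lemma affine_moment_curve_lift:
  assumes d: "d \<ge> 3"
  shows "affine_moment_curve R d (coord_space R (d+1)) lift_lin lift_const"
proof -
  interpret linear_map R V "coord_space R (d+1)" lift_lin
    by (rule linear_map_lift_lin[OF d])
  show ?thesis
  proof
    show "finite (carrier (coord_space R (d+1)))"
      using finite_carrier by (simp add: func_space_carrier finite_PiE)
    show "lift_const \<in> carrier (coord_space R (d+1))"
      unfolding lift_const_def using kappa_closed by (simp add: func_space_carrier)
  qed (use finite_carrier inj_on_lift_lin[OF d] in auto)
qed

end

section \<open>Counting incidences\<close>

text \<open>A \<open>(k+1)\<close>-set with prescribed sum is determined by any \<open>k\<close> of its elements.\<close>

lemma (in abelian_group) card_subsets_with_sum_le:
  assumes X: "finite X" "X \<subseteq> carrier G" and s: "s \<in> carrier G"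
  shows "Suc k * card {A. A \<subseteq> X \<and> card A = Suc k \<and> (\<Oplus>a\<in>A. a) = s} \<le> card X choose k"
proof -
  define \<A> where "\<A> = {A. A \<subseteq> X \<and> card A = Suc k \<and> (\<Oplus>a\<in>A. a) = s}"
  have fin: "finite \<A>"
    unfolding \<A>_def using X(1) by simp
  have finA: "finite A" if "A \<in> \<A>" for A
    using that X(1) finite_subset unfolding \<A>_def by blast
  \<comment> \<open>Double counting of the pairs (A, a) with a in A; each A contributes Suc k of
    them.\<close>
  have "card (Sigma \<A> (\<lambda>A. A)) = (\<Sum>A\<in>\<A>. card A)"
    using fin finA by (intro card_SigmaI) auto
  also have "\<dots> = Suc k * card \<A>"
    by (subst sum.cong[of \<A> \<A> card "\<lambda>_. Suc k"]) (auto simp: \<A>_def)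
  finally have "Suc k * card \<A> = card (Sigma \<A> (\<lambda>A. A))" ..
  also have "\<dots> \<le> card {B. B \<subseteq> X \<and> card B = k}"
  proof (rule card_inj_on_le)
    show "inj_on (\<lambda>(A, a). A - {a}) (Sigma \<A> (\<lambda>A. A))"
    proof (rule inj_onI)
      fix x y assume xy: "x \<in> Sigma \<A> (\<lambda>A. A)" "y \<in> Sigma \<A> (\<lambda>A. A)"
        and eq: "(\<lambda>(A, a). A - {a}) x = (\<lambda>(A, a). A - {a}) y"
      obtain A a where x: "x = (A, a)" by (rule prod.exhaust)
      obtain A' a' where y: "y = (A', a')" by (rule prod.exhaust)
      have A: "A \<in> \<A>" "a \<in> A" "A' \<in> \<A>" "a' \<in> A'"
        using xy unfolding x y by auto
      have eq': "A - {a} = A' - {a'}"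
        using eq unfolding x y by simp
      have sum: "s = b \<oplus> (\<Oplus>a\<in>B - {b}. a)" "b \<in> carrier G" "(\<Oplus>a\<in>B - {b}. a) \<in> carrier G"
        if "B \<in> \<A>" "b \<in> B" for B b
      proof -
        have sub: "B \<subseteq> carrier G"
          using that X(2) unfolding \<A>_def by blast
        then show "b \<in> carrier G" "(\<Oplus>a\<in>B - {b}. a) \<in> carrier G"
          using that by (auto intro!: finsum_closed)
        have "(\<Oplus>a\<in>insert b (B - {b}). a) = b \<oplus> (\<Oplus>a\<in>B - {b}. a)"
          using finA[OF that(1)] sub that(2) by (intro finsum_insert) auto
        then show "s = b \<oplus> (\<Oplus>a\<in>B - {b}. a)"
          using that unfolding \<A>_def by (simp add: insert_absorb)
      qed
      \<comment> \<open>Both removed elements complete the same partial sum to s.\<close>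
      have "a \<oplus> (\<Oplus>a\<in>A - {a}. a) = a' \<oplus> (\<Oplus>a\<in>A - {a}. a)"
        using sum(1)[OF A(1,2)] sum(1)[OF A(3,4)] eq' by simp
      then have "a = a'"
        using sum(2,3)[OF A(1,2)] sum(2)[OF A(3,4)] add.right_cancel by blast
      then have "A = A'"
        using eq' A insert_Diff by metis
      with \<open>a = a'\<close> show "x = y"
        unfolding x y by simp
    qed
    show "(\<lambda>(A, a). A - {a}) ` Sigma \<A> (\<lambda>A. A) \<subseteq> {B. B \<subseteq> X \<and> card B = k}"
      unfolding \<A>_def using X(1) by (auto simp: card_Diff_singleton)
    show "finite {B. B \<subseteq> X \<and> card B = k}"
      using X(1) by simp
  qed
  also have "\<dots> = card X choose k"
    by (rule n_subsets) fact
  finally show ?thesis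
    unfolding \<A>_def .
qed

lemma (in abelian_group) card_subsets_avoiding_sum:
  fixes k :: nat
  assumes X: "finite X" "X \<subseteq> carrier G" and s: "s \<in> carrier G"
  defines "N \<equiv> card {A. A \<subseteq> X \<and> card A = Suc k \<and> (\<Oplus>a\<in>A. a) \<noteq> s}"
  shows "real (card X choose Suc k) - real (card X choose k) / real (Suc k) \<le> real N"
    and "N \<le> card X choose Suc k"
proof -
  let ?bad = "{A. A \<subseteq> X \<and> card A = Suc k \<and> (\<Oplus>a\<in>A. a) = s}"
  let ?good = "{A. A \<subseteq> X \<and> card A = Suc k \<and> (\<Oplus>a\<in>A. a) \<noteq> s}"
  have "card (?good \<union> ?bad) = card ?good + card ?bad"
    using X(1) by (intro card_Un_disjoint) auto
  moreover have "?good \<union> ?bad = {A. A \<subseteq> X \<and> card A = Suc k}"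
    by auto
  ultimately have split: "card X choose Suc k = N + card ?bad"
    unfolding N_def using n_subsets[OF X(1)] by simp
  then show "N \<le> card X choose Suc k"
    by simp
  have "real (Suc k) * real (card ?bad) \<le> real (card X choose k)"
    unfolding of_nat_mult[symmetric] of_nat_le_iff by (rule card_subsets_with_sum_le[OF X s])
  then have "real (card ?bad) \<le> real (card X choose k) / real (Suc k)"
    by (simp add: field_simps)
  with split show "real (card X choose Suc k) - real (card X choose k) / real (Suc k) \<le> real N"
    by simp
qed

section \<open>Counts for the rational normal system\<close>

context rn_construction
begin

lemma finsum_Un_const:
  assumes "T \<subseteq> carrier R" "D \<subseteq> carrier R - T"
  shows "(\<Oplus>a\<in>T \<union> D. a) = (\<Oplus>a\<in>T. a) \<oplus> (\<Oplus>a\<in>D. a)"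
  using assms finite_carrier finite_subset[OF assms(1)] finite_subset[of D "carrier R"]
  by (intro R.finsum_Un_disjoint) auto

text \<open>Removing T turns the condition on A into one forbidden sum for A - T, namely
  -\<open>gam\<close> minus the sum of T. The empty T counts all points, a pair T those on two
  spheres.\<close>

lemma card_rn_sets_containing:
  fixes k :: nat
  assumes T: "T \<subseteq> carrier R" "card T + Suc k = d"
  defines "n \<equiv> order R - card T"
  shows "real (n choose Suc k) - real (n choose k) / real (Suc k) \<le> real (card {A \<in> rn_sets. T \<subseteq> A})"
    and "card {A \<in> rn_sets. T \<subseteq> A} \<le> n choose Suc k"
proof -
  let ?X = "carrier R - T"
  define s where "s = \<ominus> gam \<ominus> (\<Oplus>a\<in>T. a)"
  have finT: "finite T"
    using T(1) finite_carrier by (rule finite_subset)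
  have sT: "(\<Oplus>a\<in>T. a) \<in> carrier R"
    using T(1) by (intro R.finsum_closed) auto
  have s: "s \<in> carrier R"
    unfolding s_def using sT gam_closed by simp
  have n: "card ?X = n"
    unfolding n_def order_def using T(1) finT by (simp add: card_Diff_subset)
  have "bij_betw (\<lambda>D. T \<union> D) {D. D \<subseteq> ?X \<and> card D = Suc k \<and> (\<Oplus>a\<in>D. a) \<noteq> s} {A \<in> rn_sets. T \<subseteq> A}"
  proof (rule bij_betw_byWitness[where f' = "\<lambda>A. A - T"])
    have iff: "(\<Oplus>a\<in>D. a) \<noteq> s \<longleftrightarrow> \<ominus> (\<Oplus>a\<in>T \<union> D. a) \<noteq> gam" if D: "D \<subseteq> ?X" for D
    proof -
      have sB: "(\<Oplus>a\<in>D. a) \<in> carrier R"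
        using D by (intro R.finsum_closed) auto
      have "y = \<ominus> g \<ominus> x \<longleftrightarrow> \<ominus> (x \<oplus> y) = g"
        if "x \<in> carrier R" "y \<in> carrier R" "g \<in> carrier R" for x y g
      proof
        assume "y = \<ominus> g \<ominus> x"
        then show "\<ominus> (x \<oplus> y) = g"
          using that by (simp add: a_minus_def R.minus_add R.a_ac R.r_neg1 R.r_neg)
      next
        assume "\<ominus> (x \<oplus> y) = g"
        then have "\<ominus> g = x \<oplus> y"
          using that by auto
        then have "\<ominus> g \<ominus> x = \<ominus> x \<oplus> (x \<oplus> y)"
          unfolding a_minus_def using that by (simp only: R.a_comm R.add.m_closed R.a_inv_closed)
        then show "y = \<ominus> g \<ominus> x"
          using that by (simp add: R.r_neg1)
      qed
      then show ?thesis
        unfolding finsum_Un_const[OF T(1) D] s_def using sT sB gam_closed by simp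
    qed
    show "(\<lambda>D. T \<union> D) ` {D. D \<subseteq> ?X \<and> card D = Suc k \<and> (\<Oplus>a\<in>D. a) \<noteq> s} \<subseteq> {A \<in> rn_sets. T \<subseteq> A}"
    proof (rule image_subsetI)
      fix D assume D: "D \<in> {D. D \<subseteq> ?X \<and> card D = Suc k \<and> (\<Oplus>a\<in>D. a) \<noteq> s}"
      then have "finite D"
        using finite_carrier finite_subset[of D "carrier R"] by auto
      with D have "card (T \<union> D) = d"
        using card_Un_disjoint[OF finT, of D] T(2) by auto
      with D iff T(1) show "T \<union> D \<in> {A \<in> rn_sets. T \<subseteq> A}"
        unfolding rn_sets_def by auto
    qed
    show "(\<lambda>A. A - T) ` {A \<in> rn_sets. T \<subseteq> A} \<subseteq> {D. D \<subseteq> ?X \<and> card D = Suc k \<and> (\<Oplus>a\<in>D. a) \<noteq> s}"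
    proof (rule image_subsetI)
      fix A assume A: "A \<in> {A \<in> rn_sets. T \<subseteq> A}"
      then have A': "A \<subseteq> carrier R" "card A = d" "\<ominus> (\<Oplus>a\<in>A. a) \<noteq> gam" "T \<subseteq> A"
        unfolding rn_sets_def by auto
      then have "A - T \<subseteq> ?X" "T \<union> (A - T) = A"
        by auto
      moreover have "card (A - T) = Suc k"
        using A' card_Diff_subset[OF finT, of A] T(2) by simp
      ultimately show "A - T \<in> {D. D \<subseteq> ?X \<and> card D = Suc k \<and> (\<Oplus>a\<in>D. a) \<noteq> s}"
        using iff[of "A - T"] A'(3) by simp
    qed
  qed auto
  then have "card {A \<in> rn_sets. T \<subseteq> A} = card {D. D \<subseteq> ?X \<and> card D = Suc k \<and> (\<Oplus>a\<in>D. a) \<noteq> s}"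
    by (rule bij_betw_same_card[symmetric])
  then show "real (n choose Suc k) - real (n choose k) / real (Suc k) \<le> real (card {A \<in> rn_sets. T \<subseteq> A})"
    "card {A \<in> rn_sets. T \<subseteq> A} \<le> n choose Suc k"
    using R.card_subsets_avoiding_sum[OF _ _ s, of ?X k] finite_carrier n by auto
qed

lemma card_rn_points:
  assumes d: "d \<ge> 3"
  shows "real (order R choose d) - real (order R choose (d-1)) / real d \<le> real (card rn_points)"
    and "card rn_points \<le> order R choose d"
proof -
  have "card rn_points = card {A \<in> rn_sets. {} \<subseteq> A}"
    unfolding rn_points_def using card_image[OF inj_on_rn_point[OF d]] by simp
  then show "real (order R choose d) - real (order R choose (d-1)) / real d \<le> real (card rn_points)"
    "card rn_points \<le> order R choose d"
    using card_rn_sets_containing[of "{}" "d-1"] d by simp_all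
qed

text \<open>The points on both spheres are the p_A with t and v in A, by
  \<open>rn_point_mem_sphere_iff\<close>.\<close>

lemma card_rn_points_two_spheres:
  assumes d: "d \<ge> 3" and t: "t \<in> carrier R" "v \<in> carrier R" "t \<noteq> v"
  defines "P \<equiv> rn_points \<inter> sphere_pts R d Q (rn_sphere t) \<inter> sphere_pts R d Q (rn_sphere v)"
  shows "real ((order R - 2) choose (d-2)) - real ((order R - 2) choose (d-3)) / real (d-2) \<le> real (card P)"
    and "card P \<le> (order R - 2) choose (d-2)"
proof -
  have "P = rn_point ` {A \<in> rn_sets. {t, v} \<subseteq> A}"
    unfolding P_def rn_points_def using rn_point_mem_sphere_iff[OF d] t by auto
  moreover have "inj_on rn_point {A \<in> rn_sets. {t, v} \<subseteq> A}"
    using inj_on_rn_point[OF d] by (rule inj_on_subset) auto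
  ultimately have "card P = card {A \<in> rn_sets. {t, v} \<subseteq> A}"
    by (simp add: card_image)
  moreover have "card {t, v} + Suc (d - 3) = d" "Suc (d - 3) = d - 2" "card {t, v} = 2" "{t, v} \<subseteq> carrier R"
    using d t by auto
  ultimately show "real ((order R - 2) choose (d-2)) - real ((order R - 2) choose (d-3)) / real (d-2) \<le> real (card P)"
    "card P \<le> (order R - 2) choose (d-2)"
    using card_rn_sets_containing[of "{t, v}" "d-3"] by simp_all
qed

lemma lift_inj:
  assumes d: "d \<ge> 3"
  shows "inj_on (\<lambda>t. sphere_lift R d Q (rn_sphere t)) (carrier R)"
proof (rule inj_onI)
  interpret C: affine_moment_curve R d "coord_space R (d+1)" lift_lin lift_const
    by (rule affine_moment_curve_lift[OF d])
  fix t v assume t: "t \<in> carrier R" "v \<in> carrier R"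
    and "sphere_lift R d Q (rn_sphere t) = sphere_lift R d Q (rn_sphere v)"
  then have "C.L (moment_curve R d t) = C.L (moment_curve R d v)"
    unfolding C.L_def lift_eq[OF d t(1)] lift_eq[OF d t(2)] by simp
  then have "moment_curve R d t = moment_curve R d v"
    by (rule inj_onD[OF C.inj_L]) (intro C.moment_curve_closed t)+
  then have "t [^] (1::nat) = v [^] (1::nat)"
    using d unfolding moment_curve_def by (auto dest!: fun_cong[of _ _ 1])
  then show "t = v"
    using t by simp
qed

lemma inj_on_rn_sphere: "d \<ge> 3 \<Longrightarrow> inj_on rn_sphere (carrier R)"
  using inj_on_imageI2[of "sphere_lift R d Q" rn_sphere "carrier R"] lift_inj by (simp add: comp_def)

lemma card_rn_spheres: "d \<ge> 3 \<Longrightarrow> card rn_spheres = order R"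
  unfolding rn_spheres_def order_def by (rule card_image[OF inj_on_rn_sphere])

lemma card_spheres_through_rn_point:
  assumes d: "d \<ge> 3" and p: "p \<in> rn_points"
  shows "card {S \<in> rn_spheres. p \<in> sphere_pts R d Q S} = d"
proof -
  obtain A where A: "A \<in> rn_sets" "p = rn_point A"
    using p unfolding rn_points_def by blast
  have "{S \<in> rn_spheres. p \<in> sphere_pts R d Q S} = rn_sphere ` A"
    unfolding rn_spheres_def A(2) using rn_point_mem_sphere_iff[OF d A(1)] rn_setsD(1)[OF A(1)] by auto
  moreover have "inj_on rn_sphere A"
    using inj_on_rn_sphere[OF d] rn_setsD(1)[OF A(1)] by (rule inj_on_subset)
  ultimately show ?thesis
    using rn_setsD(2)[OF A(1)] by (simp add: card_image)
qed

lemma finite_rn_points: "finite rn_points"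
proof -
  have "rn_sets \<subseteq> Pow (carrier R)"
    unfolding rn_sets_def by blast
  then show ?thesis
    unfolding rn_points_def using finite_carrier finite_subset[of rn_sets "Pow (carrier R)"] by simp
qed

lemma incidences_rn:
  assumes d: "d \<ge> 3" and D: "D \<subseteq> rn_points"
  shows "incidences R d Q D rn_spheres = d * card D"
proof -
  have fin: "finite D" "finite rn_spheres"
    using D finite_rn_points finite_subset finite_carrier unfolding rn_spheres_def by auto
  have "{(p, S). p \<in> D \<and> S \<in> rn_spheres \<and> p \<in> sphere_pts R d Q S} =
      Sigma D (\<lambda>p. {S \<in> rn_spheres. p \<in> sphere_pts R d Q S})"
    by auto
  then have "incidences R d Q D rn_spheres = (\<Sum>p\<in>D. card {S \<in> rn_spheres. p \<in> sphere_pts R d Q S})"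
    unfolding incidences_def using fin by (simp add: card_SigmaI)
  also have "\<dots> = (\<Sum>p\<in>D. d)"
    using card_spheres_through_rn_point[OF d] D by (intro sum.cong) auto
  finally show ?thesis
    by simp
qed

text \<open>There are exactly q spheres, so the expected count is |D|, to be subtracted from d
  |D|.\<close>

lemma excess_rn:
  assumes d: "d \<ge> 3" and D: "D \<subseteq> rn_points"
  shows "excess R d Q D rn_spheres = (real d - 1) * real (card D)"
  using incidences_rn[OF d D] card_rn_spheres[OF d] order_gt_one
  unfolding excess_def by (simp add: algebra_simps)

text \<open>d < q provides the d + 1 parameters that affinely span a d-dimensional flat. Pencils are
  the case k = 1 of the bound on flats.\<close>

lemma lift_affine_properties:
  assumes d: "d \<ge> 3" and q: "d < order R"
  defines "W \<equiv> coord_space R (d+1)" and "\<Phi> \<equiv> sphere_lift R d Q"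
  defines "H \<equiv> affine_span R W (\<Phi> ` rn_spheres)"
  shows "\<exists>L. affine_map R V W L \<and> bij_betw L (carrier V) H \<and>
      (\<forall>t\<in>carrier R. L (moment_curve R d t) = \<Phi> (rn_sphere t))"
    and "affine_flat R W d H"
    and "k \<le> d-1 \<Longrightarrow> affine_flat R W k F \<Longrightarrow> card {t \<in> carrier R. \<Phi> (rn_sphere t) \<in> F} \<le> k + 1"
    and "coaxal_pencil R d Q \<P> \<Longrightarrow> card (\<P> \<inter> rn_spheres) < 3"
proof -
  interpret C: affine_moment_curve R d W lift_lin lift_const
    unfolding W_def by (rule affine_moment_curve_lift[OF d])
  have curve: "C.curve t = \<Phi> (rn_sphere t)" if "t \<in> carrier R" for t
    using lift_eq[OF d that] unfolding C.curve_def C.L_def by (simp add: W_def \<Phi>_def)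
  have "\<Phi> ` rn_spheres = C.curve ` carrier R"
    unfolding rn_spheres_def image_image using curve by (intro image_cong) simp_all
  then have H: "H = C.L ` carrier V"
    unfolding H_def using C.affine_span_curve[OF q] by simp
  have "affine_map R V W C.L"
    unfolding affine_map_def
    by (intro exI[of _ lift_lin] bexI[of _ lift_const] conjI ballI C.linear_map_axioms C.L_def C.b_closed)
  moreover have "bij_betw C.L (carrier V) H"
    unfolding bij_betw_def H using C.inj_L by simp
  ultimately show "\<exists>L. affine_map R V W L \<and> bij_betw L (carrier V) H \<and>
      (\<forall>t\<in>carrier R. L (moment_curve R d t) = \<Phi> (rn_sphere t))"
    using curve unfolding C.curve_def by blast
  show "affine_flat R W d H"
    unfolding H by (rule C.affine_flat_L_image)
  show flat: "card {t \<in> carrier R. \<Phi> (rn_sphere t) \<in> F} \<le> k + 1"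
    if "k \<le> d-1" "affine_flat R W k F" for k F
  proof -
    have "{t \<in> carrier R. \<Phi> (rn_sphere t) \<in> F} = {t \<in> carrier R. C.curve t \<in> F}"
      using curve by auto
    then show ?thesis
      using C.card_curve_in_flat_le[OF that(2)] that(1) d by simp
  qed
  show "card (\<P> \<inter> rn_spheres) < 3" if "coaxal_pencil R d Q \<P>"
  proof -
    let ?T = "{t \<in> carrier R. \<Phi> (rn_sphere t) \<in> \<Phi> ` \<P>}"
    have "affine_flat R W 1 (\<Phi> ` \<P>)"
      using that unfolding coaxal_pencil_def W_def \<Phi>_def by simp
    then have "card ?T \<le> 1 + 1"
      using d by (intro flat) simp_all
    moreover have "\<P> \<inter> rn_spheres \<subseteq> rn_sphere ` ?T"
      unfolding rn_spheres_def by auto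
    then have "card (\<P> \<inter> rn_spheres) \<le> card (rn_sphere ` ?T)"
      using finite_carrier by (intro card_mono) auto
    moreover have "card (rn_sphere ` ?T) \<le> card ?T"
      using finite_carrier by (intro card_image_le) auto
    ultimately show ?thesis
      by simp
  qed
qed

end

section \<open>Asymptotics\<close>

text \<open>Recursion of the falling factorial n (n-1) ... (n-k+1), valid for k > n too, where both
  sides vanish.\<close>

lemma fact_choose_Suc:
  "fact (Suc k) * real (n choose Suc k) = fact k * real (n choose k) * (real n - real k)"
proof (cases "k \<le> n")
  case True
  have "real (Suc k) * real (n choose Suc k) = (real n - real k) * real (n choose k)"
    using binomial_absorb_comp[of n k] True
    by (metis Suc_times_binomial_eq binomial_absorption mult.commute of_nat_diff of_nat_mult)
  then have "fact k * (real (Suc k) * real (n choose Suc k)) =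
      fact k * ((real n - real k) * real (n choose k))"
    by (rule arg_cong)
  then show ?thesis by (simp add: mult.commute mult.left_commute del: of_nat_Suc)
next
  case False
  then show ?thesis by (simp add: binomial_eq_0)
qed

lemma fact_choose_le: "fact k * real (n choose k) \<le> real n ^ k"
  using binomial_fact_pow[of n k] by (metis mult.commute of_nat_fact of_nat_le_iff of_nat_mult of_nat_power)

text \<open>The induction multiplies the falling factorial X by n - (k+1), which may be negative;
  hence X n is bounded below by induction and (k+1) X above by \<open>fact_choose_le\<close>. The
  squares leave room: (k+1)^2 + (k+1) <= (k+2)^2.\<close>

lemma fact_choose_ge:
  "real n ^ Suc k - (real (Suc k))\<^sup>2 * real n ^ k \<le> fact (Suc k) * real (n choose Suc k)"
proof (induction k)
  case 0
  show ?case by simp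
next
  case (Suc k)
  let ?X = "fact (Suc k) * real (n choose Suc k)"
  have "real n ^ Suc (Suc k) - (real (Suc (Suc k)))\<^sup>2 * real n ^ Suc k
      \<le> (real n ^ Suc k - (real (Suc k))\<^sup>2 * real n ^ k) * real n - real (Suc k) * real n ^ Suc k"
    by (simp add: algebra_simps power2_eq_square)
  also have "\<dots> \<le> ?X * real n - real (Suc k) * ?X"
    using mult_right_mono[OF Suc.IH, of "real n"]
      mult_left_mono[OF fact_choose_le[of "Suc k" n], of "real (Suc k)"] by linarith
  also have "\<dots> = fact (Suc (Suc k)) * real (n choose Suc (Suc k))"
    unfolding fact_choose_Suc[of "Suc k" n] by (simp add: algebra_simps)
  finally show ?case .
qed

text \<open>After scaling, the correction costs k! (n choose k) <= n^k, which is the summand 1 in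
  the constant.\<close>

lemma choose_minus_choose_bounds:
  fixes x :: real
  assumes lower: "real (n choose Suc k) - real (n choose k) / real (Suc k) \<le> x"
    and upper: "x \<le> real (n choose Suc k)"
  shows "real n ^ Suc k - ((real (Suc k))\<^sup>2 + 1) * real n ^ k \<le> fact (Suc k) * x"
    and "fact (Suc k) * x \<le> real n ^ Suc k"
proof -
  have "fact (Suc k) * (real (n choose Suc k) - real (n choose k) / real (Suc k)) =
      fact (Suc k) * real (n choose Suc k) - fact k * real (n choose k)"
    by (simp add: field_simps del: of_nat_Suc)
  then show "real n ^ Suc k - ((real (Suc k))\<^sup>2 + 1) * real n ^ k \<le> fact (Suc k) * x"
    using fact_choose_ge[of n k] fact_choose_le[of k n]
      mult_left_mono[OF lower, of "fact (Suc k)"] by (simp add: distrib_right)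
  show "fact (Suc k) * x \<le> real n ^ Suc k"
    using order_trans[OF mult_left_mono[OF upper fact_ge_zero] fact_choose_le] .
qed

lemma power_ge_half:
  fixes n c :: real
  assumes "2 * c \<le> n" "0 \<le> n"
  shows "n ^ Suc k / 2 \<le> n ^ Suc k - c * n ^ k"
  using mult_right_mono[OF assms(1), of "n ^ k"] assms(2) by simp

text \<open>Bernoulli: (1 - 2/n)^k >= 1 - 2k/n >= 1/2.\<close>

lemma half_power_le_shifted:
  assumes "4 * k \<le> n" "4 \<le> n"
  shows "real n ^ k / 2 \<le> real (n - 2) ^ k"
proof -
  have n: "real n > 0" "real (n - 2) = real n - 2" using assms by auto
  have "1 / 2 \<le> 1 + real k * (- 2 / real n)"
    using assms n(1) by (simp add: field_simps)
  also have "\<dots> \<le> (1 + (- 2 / real n)) ^ k"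
    by (rule Bernoulli_inequality) (use assms n in \<open>simp add: field_simps\<close>)
  finally have "real n ^ k * (1 / 2) \<le> real n ^ k * (1 + (- 2 / real n)) ^ k"
    by (rule mult_left_mono) simp
  also have "\<dots> = real (n - 2) ^ k"
    unfolding power_mult_distrib[symmetric] n(2) using n(1)
    by (intro arg_cong[where f = "\<lambda>x. x ^ k"]) (simp add: field_simps)
  finally show ?thesis by simp
qed

text \<open>Subadditivity of the root. It converts an O(1/q) error for N/q^d into an explicit error
  for K.\<close>

lemma abs_sqrt_diff_le:
  fixes a b :: real
  assumes "0 \<le> a" "0 \<le> b"
  shows "\<bar>sqrt a - sqrt b\<bar> \<le> sqrt \<bar>a - b\<bar>"
proof -
  have *: "sqrt x - sqrt y \<le> sqrt (x - y)" if "0 \<le> y" "y \<le> x" for x y :: real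
    using sqrt_add_le_add_sqrt[of y "x - y"] that by simp
  show ?thesis
  proof (cases "a \<le> b")
    case True
    then show ?thesis
      using *[of a b] assms real_sqrt_le_mono[OF True] by (simp add: abs_if)
  next
    case False
    then show ?thesis
      using *[of b a] assms real_sqrt_le_mono[of b a] by (simp add: abs_if)
  qed
qed

text \<open>Of the geometry only the bounds of \<open>card_rn_points\<close> are kept, with q the
  order of the field.\<close>

locale point_count =
  fixes d q :: nat and N :: real
  assumes d: "d \<ge> 3" and q: "0 < q"
    and lower: "real (q choose d) - real (q choose (d-1)) / real d \<le> N"
    and upper: "N \<le> real (q choose d)"
begin

lemma fact_N:
  shows "real q ^ d - ((real d)\<^sup>2 + 1) * real q ^ (d-1) \<le> fact d * N"
    and "fact d * N \<le> real q ^ d"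
  using choose_minus_choose_bounds[of q "d-1" N] lower upper d by (simp_all del: fact_Suc)

lemma N_near: "\<bar>N - real q ^ d / fact d\<bar> \<le> ((real d)\<^sup>2 + 1) * real q ^ (d-1)"
proof -
  have "fact d * \<bar>N - real q ^ d / fact d\<bar> = \<bar>fact d * N - real q ^ d\<bar>"
    by (subst abs_of_nonneg[OF fact_ge_zero, symmetric], subst abs_mult[symmetric])
       (simp add: right_diff_distrib)
  also have "\<dots> \<le> ((real d)\<^sup>2 + 1) * real q ^ (d-1)"
    using fact_N by simp
  finally have "fact d * \<bar>N - real q ^ d / fact d\<bar> \<le> ((real d)\<^sup>2 + 1) * real q ^ (d-1)" .
  \<comment> \<open>Discarding the factor d! is where the constant d^2 + 1 of the error term comes
    from.\<close>
  moreover have "1 * \<bar>N - real q ^ d / fact d\<bar> \<le> fact d * \<bar>N - real q ^ d / fact d\<bar>"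
    by (rule mult_right_mono) (simp_all add: fact_ge_1)
  ultimately show ?thesis
    by simp
qed

lemma power_d: "real q ^ d = real q * real q ^ (d-1)"
  using d by (simp flip: power_Suc)

text \<open>The extra root of q is that of the number of spheres.\<close>

lemma powr_half_d: "real q powr ((real d - 1) / 2) * sqrt (real q) = real q powr (real d / 2)"
proof -
  have "real q powr ((real d - 1) / 2) * real q powr (1 / 2) = real q powr ((real d - 1) / 2 + 1 / 2)"
    by (rule powr_add[symmetric])
  also have "(real d - 1) / 2 + 1 / 2 = real d / 2"
    by (simp add: field_simps)
  finally show ?thesis
    using q by (simp add: powr_half_sqrt)
qed

lemma powr_half_d_square: "(real q powr (real d / 2))\<^sup>2 = real q ^ d"
  using q by (simp add: powr_power powr_realpow)

definition K where
  "K = (real d - 1) * N / (real q powr ((real d - 1) / 2) * sqrt (N * real q))"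

lemma K_eq: "0 \<le> N \<Longrightarrow> K = (real d - 1) * sqrt N / real q powr (real d / 2)"
proof -
  assume N: "0 \<le> N"
  have "K = (real d - 1) * (N / sqrt N) / (real q powr ((real d - 1) / 2) * sqrt (real q))"
    unfolding K_def by (simp add: real_sqrt_mult mult.commute mult.left_commute)
  then show ?thesis
    unfolding powr_half_d real_div_sqrt[OF N] .
qed

text \<open>K equals (d - 1) sqrt(N/q^d), and N/q^d is within (d^2 + 1)/q of 1/d!. The bound depends
  on d and q alone, which makes the limit uniform over all forms and choices.\<close>

lemma K_limit_bound:
  assumes "0 \<le> N"
  shows "\<bar>K - (real d - 1) / sqrt (fact d)\<bar> \<le> (real d - 1) * sqrt (((real d)\<^sup>2 + 1) / real q)"
proof -
  have qd: "0 < real q ^ d"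
    using q by simp
  have "sqrt (real q ^ d) = real q powr (real d / 2)"
    using powr_half_d_square by (metis powr_ge_zero real_sqrt_unique)
  then have "K = (real d - 1) * sqrt (N / real q ^ d)"
    unfolding K_eq[OF assms] by (simp add: real_sqrt_divide)
  moreover have "(real d - 1) / sqrt (fact d) = (real d - 1) * sqrt (1 / fact d)"
    by (simp add: real_sqrt_divide)
  ultimately have "\<bar>K - (real d - 1) / sqrt (fact d)\<bar> = (real d - 1) * \<bar>sqrt (N / real q ^ d) - sqrt (1 / fact d)\<bar>"
    using d by (simp only: right_diff_distrib[symmetric] abs_mult)
  also have "\<dots> \<le> (real d - 1) * sqrt \<bar>N / real q ^ d - 1 / fact d\<bar>"
    using d assms by (intro mult_left_mono abs_sqrt_diff_le) simp_all
  also have "\<dots> \<le> (real d - 1) * sqrt (((real d)\<^sup>2 + 1) / real q)"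
  proof (intro mult_left_mono real_sqrt_le_mono)
    have "N / real q ^ d - 1 / fact d = (N - real q ^ d / fact d) / real q ^ d"
      using qd by (simp add: diff_divide_distrib)
    then have "\<bar>N / real q ^ d - 1 / fact d\<bar> = \<bar>N - real q ^ d / fact d\<bar> / real q ^ d"
      using qd by simp
    also have "\<dots> \<le> ((real d)\<^sup>2 + 1) * real q ^ (d-1) / real q ^ d"
      using N_near qd by (intro divide_right_mono) simp_all
    also have "\<dots> = ((real d)\<^sup>2 + 1) / real q"
      unfolding power_d using q by simp
    finally show "\<bar>N / real q ^ d - 1 / fact d\<bar> \<le> ((real d)\<^sup>2 + 1) / real q" .
  qed (use d in simp)
  finally show ?thesis .
qed

end

text \<open>The first summand keeps lower-order errors below half of the main term, also after q is
  replaced by q - 2. The second gives d! <= q, which absorbs factorials when d >= 4.\<close>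

locale large_point_count = point_count +
  assumes large: "2 * (d\<^sup>2 + 1) + fact d \<le> q"
begin

lemma fact_le_q: "fact d \<le> real q"
proof -
  have "fact d \<le> q"
    using large by linarith
  then show ?thesis
    by (metis of_nat_fact of_nat_le_iff)
qed

lemma fact_N_ge_half: "real q ^ d / 2 \<le> fact d * N"
proof -
  have "2 * ((real d)\<^sup>2 + 1) \<le> real q"
  proof -
    have "2 * (d\<^sup>2 + 1) \<le> q"
      using large by linarith
    then have "real (2 * (d\<^sup>2 + 1)) \<le> real q"
      by (rule of_nat_mono)
    then show ?thesis by simp
  qed
  then have "real q ^ Suc (d-1) / 2 \<le> real q ^ Suc (d-1) - ((real d)\<^sup>2 + 1) * real q ^ (d-1)"
    by (intro power_ge_half) simp_all
  with fact_N(1) d show ?thesis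
    by simp
qed

lemma N_pos: "0 < N"
proof -
  have "0 < real q ^ d / 2"
    using q by simp
  with fact_N_ge_half have "0 < fact d * N"
    by linarith
  then show ?thesis
    by (simp add: zero_less_mult_iff)
qed

lemma d_minus_one: "2 \<le> real d - 1"
  using d by simp

lemma K_scale: "K * real q powr ((real d - 1) / 2) = (real d - 1) * sqrt (N / real q)"
proof -
  have "real q powr ((real d - 1) / 2) > 0"
    using q by simp
  then show ?thesis
    unfolding K_eq[OF less_imp_le[OF N_pos]] powr_half_d[symmetric]
    by (simp add: real_sqrt_divide)
qed

lemma excess_eq: "(real d - 1) * N = K * real q powr ((real d - 1) / 2) * sqrt (N * real q)"
proof -
  define x where "x = real q powr ((real d - 1) / 2) * sqrt (N * real q)"
  have "x \<noteq> 0"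
    unfolding x_def using q N_pos by simp
  then show ?thesis
    unfolding K_def mult.assoc[of _ "real q powr _" "sqrt _"] x_def[symmetric] by simp
qed

lemma K_square: "K\<^sup>2 * real q ^ (d-1) * real q = (real d - 1)\<^sup>2 * N"
proof -
  have "K\<^sup>2 * (real q * real q ^ (d-1)) = (real d - 1)\<^sup>2 * N"
    unfolding power_d[symmetric] K_eq[OF less_imp_le[OF N_pos]] power_divide powr_half_d_square
    using N_pos q by (simp add: power_mult_distrib)
  then show ?thesis
    by (simp add: mult.commute mult.left_commute)
qed

lemma four_le: "4 * N \<le> (real d - 1)\<^sup>2 * N"
  using power_mono[OF d_minus_one, of 2] N_pos by simp

text \<open>By \<open>K_square\<close> the claim amounts to 4 N <= (d - 1)^2 N.\<close>

lemma window_lower: "4 * N / (K\<^sup>2 * real q ^ (d-1)) \<le> real q"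
proof -
  have "0 < (real d - 1)\<^sup>2 * N"
    using four_le N_pos by linarith
  then have "0 < K\<^sup>2 * real q ^ (d-1) * real q"
    unfolding K_square .
  then have "0 < K\<^sup>2 * real q ^ (d-1)"
    using q by (simp add: zero_less_mult_iff)
  then show ?thesis
    using four_le K_square by (simp add: pos_divide_le_eq mult.commute)
qed

text \<open>Squared, the claim is q^3 <= 4 (d - 1)^2 N; the bound N >= q^d / (2 d!) reduces it to d!
  q^3 <= 2 (d - 1)^2 q^d.\<close>

lemma window_upper: "real q \<le> 2 * K * real q powr ((real d - 1) / 2)"
proof -
  have "fact d * real q ^ 3 \<le> 2 * (real d - 1)\<^sup>2 * real q ^ d"
  \<comment> \<open>For d = 3 the powers agree and 6 <= 8 decides.\<close>
  proof (cases "d = 3")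
    case True
    then show ?thesis
      by (simp add: fact_numeral)
  next
    case False
    have "fact d * real q ^ 3 \<le> real q * real q ^ 3"
      using fact_le_q by (rule mult_right_mono) simp
    also have "\<dots> = real q ^ 4"
      by (simp add: numeral_eq_Suc)
    also have "\<dots> \<le> real q ^ d"
      using False d q by (intro power_increasing) simp_all
    also have "\<dots> \<le> 2 * (real d - 1)\<^sup>2 * real q ^ d"
    proof -
      have "1 \<le> 2 * (real d - 1)\<^sup>2"
        using power_mono[OF d_minus_one, of 2] by simp
      then show ?thesis
        using mult_right_mono[of 1 "2 * (real d - 1)\<^sup>2" "real q ^ d"] by simp
    qed
    finally show ?thesis .
  qed
  also have "\<dots> = 4 * (real d - 1)\<^sup>2 * (real q ^ d / 2)"
    by simp
  also have "\<dots> \<le> 4 * (real d - 1)\<^sup>2 * (fact d * N)"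
    using fact_N_ge_half by (rule mult_left_mono) simp
  finally have "fact d * real q ^ 3 \<le> fact d * (4 * (real d - 1)\<^sup>2 * N)"
    by (simp add: mult.commute mult.left_commute)
  then have "real q ^ 3 \<le> 4 * (real d - 1)\<^sup>2 * N"
    by simp
  then have "(real q)\<^sup>2 \<le> 4 * (real d - 1)\<^sup>2 * (N / real q)"
    using q by (simp add: field_simps power2_eq_square power3_eq_cube)
  also have "\<dots> = (2 * ((real d - 1) * sqrt (N / real q)))\<^sup>2"
    using N_pos by (simp add: power_mult_distrib)
  finally have "real q \<le> 2 * ((real d - 1) * sqrt (N / real q))"
    by (rule power2_le_imp_le) (use d N_pos in simp)
  then show ?thesis
    unfolding K_scale[symmetric] by simp
qed

text \<open>M stands for the number of points common to two spheres.\<close>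

context
  fixes M :: real
  assumes M_lower: "real ((q-2) choose (d-2)) - real ((q-2) choose (d-3)) / real (d-2) \<le> M"
    and M_upper: "M \<le> real ((q-2) choose (d-2))"
begin

lemma fact_M_le: "fact (d-2) * M \<le> real q ^ (d-2)"
proof -
  obtain c where c: "d = c + 3"
    using d le_Suc_ex[of 3 d] by (auto simp: add.commute)
  then have dc: "d - 2 = Suc c" "d - 3 = c"
    by simp_all
  have "fact (d-2) * M \<le> real (q-2) ^ (d-2)"
    using choose_minus_choose_bounds(2)[of "q-2" c M] M_lower M_upper unfolding dc by blast
  also have "\<dots> \<le> real q ^ (d-2)"
    by (intro power_mono) simp_all
  finally show ?thesis .
qed

text \<open>One factor 1/2 pays for replacing q by q - 2, the other for the lower-order
  term.\<close>

lemma fact_M_ge: "real q ^ (d-2) / 4 \<le> fact (d-2) * M"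
proof -
  obtain c where c: "d = c + 3"
    using d le_Suc_ex[of 3 d] by (auto simp: add.commute)
  have dc: "d - 2 = Suc c" "d - 3 = c"
    using c by simp_all
  \<comment> \<open>This is 2 (d^2 + 1) with d = c + 3.\<close>
  have "2 * (c * c + 6 * c + 10) \<le> q"
    using large unfolding c by (simp add: power2_eq_square algebra_simps)
  then have *: "4 * Suc c \<le> q" "4 \<le> q" "2 * ((Suc c)\<^sup>2 + 1) \<le> q - 2"
    by (simp_all add: power2_eq_square algebra_simps)
  have "real (2 * ((Suc c)\<^sup>2 + 1)) \<le> real (q - 2)"
    using *(3) by (rule of_nat_mono)
  then have h: "2 * ((real (Suc c))\<^sup>2 + 1) \<le> real (q - 2)"
    by simp
  have "real q ^ Suc c / 2 / 2 \<le> real (q - 2) ^ Suc c / 2"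
    using half_power_le_shifted[OF *(1,2)] by (rule divide_right_mono) simp
  also have "\<dots> \<le> real (q - 2) ^ Suc c - ((real (Suc c))\<^sup>2 + 1) * real (q - 2) ^ c"
    using h by (rule power_ge_half) simp
  also have "\<dots> \<le> fact (Suc c) * M"
    using choose_minus_choose_bounds(1)[of "q-2" c M] M_lower M_upper unfolding dc by blast
  finally show ?thesis
    unfolding dc by simp
qed

lemma M_nonneg: "0 \<le> M"
proof -
  have "fact (d-2) * 0 \<le> fact (d-2) * M"
    using fact_M_ge order_trans[of 0 "real q ^ (d-2) / 4"] by simp
  then show ?thesis
    by (rule mult_left_le_imp_le) simp
qed

lemma fact_d: "fact d = real d * (real d - 1) * fact (d-2)"
proof -
  define c where "c = d - 2"
  have "d = Suc (Suc c)"
    unfolding c_def using d by simp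
  then show ?thesis
    by (simp add: algebra_simps)
qed

text \<open>Squared, the claim is (d - 1)^2 N <= 64 q M^2, where 64 = (4 C1)^2. After multiplication
  by F^2 with F = (d-2)!, the left side is at most F q^d, because F (d-1)^2 <= d!, and the right
  side is at least 4 q^(2d-3), because F M >= q^(d-2)/4.\<close>

lemma rich_pair: "K * real q powr ((real d - 1) / 2) / (4 * 2) \<le> M"
proof -
  let ?F = "fact (d-2) :: real"
  have F: "1 \<le> ?F" "?F \<le> real q"
    using fact_ge_1 fact_le_q order_trans[OF fact_mono[of "d-2" d]] by auto
  have "?F * ((real d - 1)\<^sup>2 * N) \<le> real q ^ d"
  proof -
    have "(real d - 1) * (real d - 1) \<le> real d * (real d - 1)"
      using d by (intro mult_right_mono) simp_all
    then have "?F * ((real d - 1)\<^sup>2 * N) \<le> ?F * (real d * (real d - 1) * N)"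
      using N_pos by (intro mult_left_mono mult_right_mono) (simp_all add: power2_eq_square)
    also have "\<dots> = fact d * N"
      unfolding fact_d by simp
    finally show ?thesis
      using fact_N(2) by linarith
  qed
  then have "?F * ?F * ((real d - 1)\<^sup>2 * N) \<le> ?F * real q ^ d"
    using F(1) mult_left_mono[of "?F * ((real d - 1)\<^sup>2 * N)" "real q ^ d" ?F] by (simp add: mult.assoc)
  also have "\<dots> \<le> 4 * real q * (real q ^ (d-2))\<^sup>2"
  \<comment> \<open>For d = 3, F = 1 and both sides are multiples of q^3; for d >= 4, F <= q and d
    <= 2 (d - 2).\<close>
  proof (cases "d = 3")
    case True
    then show ?thesis
      by (simp add: power2_eq_square power3_eq_cube)
  next
    case False
    have "?F * real q ^ d \<le> real q * real q ^ d"
      using F(2) by (rule mult_right_mono) simp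
    also have "\<dots> \<le> real q * (real q ^ ((d-2) * 2))"
      using False d q by (intro mult_left_mono power_increasing) simp_all
    also have "\<dots> \<le> 4 * real q * (real q ^ (d-2))\<^sup>2"
      by (simp add: power_mult)
    finally show ?thesis .
  qed
  also have "\<dots> = 64 * real q * (real q ^ (d-2) / 4)\<^sup>2"
    by (simp add: power_divide)
  also have "\<dots> \<le> 64 * real q * (?F * M)\<^sup>2"
    using fact_M_ge by (intro mult_left_mono power_mono) simp_all
  finally have "?F * ?F * ((real d - 1)\<^sup>2 * N) \<le> ?F * ?F * (64 * real q * M\<^sup>2)"
    by (simp add: power2_eq_square mult.commute mult.left_commute)
  then have "(real d - 1)\<^sup>2 * N \<le> 64 * real q * M\<^sup>2"
    using F(1) by simp
  then have "(real d - 1)\<^sup>2 * (N / real q) \<le> (8 * M)\<^sup>2"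
    using q by (simp add: field_simps power2_eq_square)
  moreover have "((real d - 1) * sqrt (N / real q))\<^sup>2 = (real d - 1)\<^sup>2 * (N / real q)"
    using N_pos by (simp add: power_mult_distrib)
  ultimately have "((real d - 1) * sqrt (N / real q))\<^sup>2 \<le> (8 * M)\<^sup>2"
    by simp
  then have "(real d - 1) * sqrt (N / real q) \<le> 8 * M"
    by (rule power2_le_imp_le) (use M_nonneg in simp)
  then show ?thesis
    unfolding K_scale by simp
qed

text \<open>The ratio is M / N, where M <= q^(d-2) and N >= q^d / (2 d!).\<close>

lemma pair_ratio: "\<bar>(real d - 1) * M / ((real d - 1) * N)\<bar> \<le> 2 * fact d / (real q)\<^sup>2"
proof -
  have "1 * M \<le> fact (d-2) * M"
    using M_nonneg fact_ge_1 by (intro mult_right_mono) simp_all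
  then have "M \<le> real q ^ (d-2)"
    using fact_M_le by simp
  then have "(real q)\<^sup>2 * M \<le> (real q)\<^sup>2 * real q ^ (d-2)"
    by (rule mult_left_mono) simp
  also have "\<dots> = real q ^ d"
  proof -
    have "2 + (d - 2) = d"
      using d by simp
    then show ?thesis
      using power_add[of "real q" 2 "d - 2"] by simp
  qed
  also have "\<dots> \<le> 2 * fact d * N"
    using fact_N_ge_half by simp
  finally have "M / N \<le> 2 * fact d / (real q)\<^sup>2"
    using q N_pos by (simp add: field_simps)
  then show ?thesis
    using M_nonneg N_pos d by simp
qed

end

end

section \<open>The rational normal system\<close>

context rn_construction
begin

lemma point_count: "d \<ge> 3 \<Longrightarrow> point_count d (order R) (real (card rn_points))"
  using card_rn_points order_gt_one by unfold_locales simp_all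

lemma K_const_eq:
  assumes d: "d \<ge> 3"
  shows "K_const R d Q rn_points rn_spheres = point_count.K d (order R) (real (card rn_points))"
proof -
  interpret point_count d "order R" "real (card rn_points)"
    by (rule point_count[OF d])
  show ?thesis
    unfolding K_def K_const_def excess_rn[OF d subset_refl] card_rn_spheres[OF d] ..
qed

end

text \<open>C and C' are quantified before q, the field and the form, which expresses the uniformity
  of O_d; the existence conjunct keeps the universal one from being vacuous. The limit stands apart
  because its threshold depends on \<epsilon>, and it is uniform over all choices since K_q is not
  determined by q.\<close>

theorem theorem4p6:
  fixes d :: nat
  assumes "d \<ge> 3"
  shows
    "(\<exists>C C' :: real. eventually (\<lambda>q. \<forall>(R :: 'a ring) Q.
        order R = q \<and> odd_quadratic_space R d Q \<longrightarrow>
        (\<exists>e f V0 u \<kappa>. rn_construction R d Q e f V0 u \<kappa>) \<and>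
        (\<forall>e f V0 u \<kappa>. rn_construction R d Q e f V0 u \<kappa> \<longrightarrow>
          (let V = coord_space R d;
               W = coord_space R (d+1);
               S = rn_data.rn_sphere R d Q f u \<kappa>;
               p = rn_data.rn_point R d Q e f V0 u \<kappa>;
               AA = rn_data.rn_sets R d Q f u;
               P = rn_data.rn_points R d Q e f V0 u \<kappa>;
               \<S> = rn_data.rn_spheres R d Q f u \<kappa>;
               pts = sphere_pts R d Q;
               \<Phi> = sphere_lift R d Q;
               H = affine_span R W (\<Phi> ` \<S>);
               N = real (card P);
               \<Sigma> = excess R d Q P \<S>;
               K = K_const R d Q P \<S>;
               C1 = (2 :: real)
           in
             \<comment> \<open>(1)\<close>
             (\<forall>t\<in>carrier R. snd (S t) \<noteq> \<zero>\<^bsub>R\<^esub>) \<and>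
             (\<exists>L. affine_map R V W L \<and> bij_betw L (carrier V) H \<and>
                (\<forall>t\<in>carrier R. L (moment_curve R d t) = \<Phi> (S t))) \<and>
             affine_flat R W d H \<and>
             (\<forall>k\<le>d-1. \<forall>F. affine_flat R W k F \<and> F \<subseteq> H \<longrightarrow>
                card {t \<in> carrier R. \<Phi> (S t) \<in> F} \<le> k + 1) \<and>
             (\<forall>\<P>. coaxal_pencil R d Q \<P> \<longrightarrow> card (\<P> \<inter> \<S>) < 3) \<and>
             \<comment> \<open>(2)\<close>
             inj_on p AA \<and>
             real (q choose d) - real (q choose (d-1)) / real d \<le> N \<and>
             N \<le> real (q choose d) \<and>
             \<bar>N - real q ^ d / fact d\<bar> \<le> C * real q ^ (d-1) \<and>
             (\<forall>A\<in>AA. \<forall>t\<in>carrier R. p A \<in> pts (S t) \<longleftrightarrow> t \<in> A) \<and>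
             (\<forall>x\<in>P. card {s \<in> \<S>. x \<in> pts s} = d) \<and>
             (\<forall>t\<in>carrier R. \<forall>v\<in>carrier R. t \<noteq> v \<longrightarrow>
                real ((q-2) choose (d-2)) - real ((q-2) choose (d-3)) / real (d-2)
                  \<le> real (card (P \<inter> pts (S t) \<inter> pts (S v))) \<and>
                card (P \<inter> pts (S t) \<inter> pts (S v)) \<le> (q-2) choose (d-2)) \<and>
             \<comment> \<open>(3)\<close>
             real (incidences R d Q P \<S>) = real d * N \<and>
             \<Sigma> = (real d - 1) * N \<and>
             \<Sigma> = K * real q powr ((real d - 1) / 2) * sqrt (N * real (card \<S>)) \<and>
             K = (real d - 1) * sqrt N / real q powr (real d / 2) \<and>
             K\<^sup>2 * real q ^ (d-1) * real (card \<S>) = (real d - 1)\<^sup>2 * N \<and>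
             (real d - 1)\<^sup>2 * N \<ge> 4 * N \<and>
             4 * N / (K\<^sup>2 * real q ^ (d-1)) \<le> real (card \<S>) \<and>
             real (card \<S>) \<le> C1 * K * real q powr ((real d - 1) / 2) \<and>
             (\<forall>s\<in>\<S>. \<forall>s'\<in>\<S>. s \<noteq> s' \<longrightarrow>
                real (card (P \<inter> pts s \<inter> pts s')) \<ge> K * real q powr ((real d - 1) / 2) / (4 * C1)) \<and>
             \<comment> \<open>(4)\<close>
             (\<forall>B\<subseteq>P. excess R d Q B \<S> = (real d - 1) * real (card B)) \<and>
             (\<forall>t\<in>carrier R. \<forall>v\<in>carrier R. t \<noteq> v \<longrightarrow>
                \<bar>excess R d Q (P \<inter> pts (S t) \<inter> pts (S v)) \<S> / \<Sigma>\<bar> \<le> C' / (real q)\<^sup>2)))) at_top)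
     \<and>
     \<comment> \<open>the limit of \<open>K\<^sub>q\<close> in (3)\<close>
     (\<forall>\<epsilon>>0. eventually (\<lambda>q. \<forall>(R :: 'a ring) Q e f V0 u \<kappa>.
        order R = q \<and> rn_construction R d Q e f V0 u \<kappa> \<longrightarrow>
        \<bar>K_const R d Q (rn_data.rn_points R d Q e f V0 u \<kappa>) (rn_data.rn_spheres R d Q f u \<kappa>)
          - (real d - 1) / sqrt (fact d)\<bar> < \<epsilon>) at_top)"
proof (rule conjI, rule exI[of _ "(real d)\<^sup>2 + 1"], rule exI[of _ "2 * fact d"], goal_cases)
  \<comment> \<open>The two witnesses are the constants of \<open>N_near\<close> and
    \<open>pair_ratio\<close>.\<close>
  case 1
  note d = assms
  show ?case
  proof (rule eventually_mono[OF eventually_ge_at_top[of "2 * (d\<^sup>2 + 1) + fact d"]], intro allI impI, goal_cases)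
    case (1 q R Q)
    then have q: "q = order R" and space: "odd_quadratic_space R d Q"
      and large: "2 * (d\<^sup>2 + 1) + fact d \<le> order R"
      by simp_all
    show ?case
    proof (rule conjI, goal_cases)
      case 1
      show ?case
        by (rule rn_construction_exists[OF space d]) blast
    next
      case 2
      show ?case
      proof (intro allI impI, goal_cases)
        case (1 e f V0 u \<kappa>)
        interpret rn_construction R d Q e f V0 u \<kappa>
          by fact
        interpret pc: large_point_count d "order R" "real (card rn_points)"
          using point_count[OF d] large
          by (simp add: large_point_count_def large_point_count_axioms_def)
        \<comment> \<open>Needed for the dimension of the affine span.\<close>
        have d_less: "d < order R"
        proof -
          have "d \<le> d\<^sup>2"
            using d by (intro self_le_power) simp_all
          then have "d < 2 * (d\<^sup>2 + 1) + fact d"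
            by simp
          then show ?thesis
            using large by (rule less_le_trans)
        qed
        note affine = lift_affine_properties[OF d d_less]
        note pair = card_rn_points_two_spheres[OF d]
        have pair_real: "real (card (rn_points \<inter> sphere_pts R d Q (rn_sphere t) \<inter> sphere_pts R d Q (rn_sphere v)))
            \<le> real ((order R - 2) choose (d-2))"
          if "t \<in> carrier R" "v \<in> carrier R" "t \<noteq> v" for t v
          using pair(2)[OF that] by (rule of_nat_mono)
        show ?case
          unfolding Let_def q
        proof (intro conjI, goal_cases)
          case 1
          show ?case
            using radius_nonzero unfolding rn_sphere_def by simp
        next
          case 2
          show ?case
            by (rule affine(1))
        next
          case 3
          show ?case
            by (rule affine(2))
        next
          case 4
          show ?case
            using affine(3) by blast
        next
          case 5
          show ?case
            using affine(4) by blast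
        next
          case 6
          show ?case
            by (rule inj_on_rn_point[OF d])
        next
          case 7
          show ?case
            by (rule card_rn_points(1)[OF d])
        next
          case 8
          show ?case
            using card_rn_points(2)[OF d] by (rule of_nat_mono)
        next
          case 9
          show ?case
            by (rule pc.N_near)
        next
          case 10
          show ?case
            using rn_point_mem_sphere_iff[OF d] by blast
        next
          case 11
          show ?case
            using card_spheres_through_rn_point[OF d] by blast
        next
          case 12
          show ?case
            using pair by blast
        next
          case 13
          show ?case
            unfolding incidences_rn[OF d subset_refl] by simp
        next
          case 14
          show ?case
            by (rule excess_rn[OF d subset_refl])
        next
          case 15
          show ?case
            unfolding excess_rn[OF d subset_refl] K_const_eq[OF d] card_rn_spheres[OF d]
            by (rule pc.excess_eq)
        next
          case 16
          show ?case
            unfolding K_const_eq[OF d] by (rule pc.K_eq) simp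
        next
          case 17
          show ?case
            unfolding K_const_eq[OF d] card_rn_spheres[OF d] by (rule pc.K_square)
        next
          case 18
          show ?case
            by (rule pc.four_le)
        next
          case 19
          show ?case
            unfolding K_const_eq[OF d] card_rn_spheres[OF d] by (rule pc.window_lower)
        next
          case 20
          show ?case
            unfolding K_const_eq[OF d] card_rn_spheres[OF d] by (rule pc.window_upper)
        next
          case 21
          show ?case
          proof (intro ballI impI)
            fix s s' assume s: "s \<in> rn_spheres" "s' \<in> rn_spheres" "s \<noteq> s'"
            then obtain t v where tv: "s = rn_sphere t" "t \<in> carrier R" "s' = rn_sphere v" "v \<in> carrier R"
              unfolding rn_spheres_def by blast
            with s have "t \<noteq> v"
              by blast
            then show "K_const R d Q rn_points rn_spheres * real (order R) powr ((real d - 1) / 2) / (4 * 2)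
                \<le> real (card (rn_points \<inter> sphere_pts R d Q s \<inter> sphere_pts R d Q s'))"
              unfolding K_const_eq[OF d] tv(1,3)
              by (intro pc.rich_pair pair(1) pair_real tv)
          qed
        next
          case 22
          show ?case
            using excess_rn[OF d] by blast
        next
          case 23
          show ?case
          proof (intro ballI impI)
            fix t v assume tv: "t \<in> carrier R" "v \<in> carrier R" "t \<noteq> v"
            have sub: "rn_points \<inter> sphere_pts R d Q (rn_sphere t) \<inter> sphere_pts R d Q (rn_sphere v) \<subseteq> rn_points"
              by blast
            show "\<bar>excess R d Q (rn_points \<inter> sphere_pts R d Q (rn_sphere t) \<inter> sphere_pts R d Q (rn_sphere v)) rn_spheres /
                excess R d Q rn_points rn_spheres\<bar> \<le> 2 * fact d / (real (order R))\<^sup>2"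
              unfolding excess_rn[OF d sub] excess_rn[OF d subset_refl]
              by (rule pc.pair_ratio[OF pair(1)[OF tv] pair_real[OF tv]])
          qed
        qed
      qed
    qed
  qed
next
  case 2
  note d = assms
  show ?case
  proof (intro allI impI)
    fix \<epsilon> :: real assume \<epsilon>: "\<epsilon> > 0"
    \<comment> \<open>The bound of \<open>K_limit_bound\<close> tends to 0 and involves neither the
      field nor the form, so one threshold serves all of them.\<close>
    have "((\<lambda>q. (real d - 1) * sqrt (((real d)\<^sup>2 + 1) / real q)) \<longlongrightarrow> (real d - 1) * sqrt 0) at_top"
      by (intro tendsto_mult tendsto_const tendsto_real_sqrt tendsto_divide_0[OF tendsto_const] filterlim_at_top_imp_at_infinity filterlim_real_sequentially)
    then have small: "eventually (\<lambda>q. (real d - 1) * sqrt (((real d)\<^sup>2 + 1) / real q) < \<epsilon>) at_top"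
      by (rule order_tendstoD) (use \<epsilon> in simp)
    show "eventually (\<lambda>q. \<forall>(R :: 'a ring) Q e f V0 u \<kappa>.
        order R = q \<and> rn_construction R d Q e f V0 u \<kappa> \<longrightarrow>
        \<bar>K_const R d Q (rn_data.rn_points R d Q e f V0 u \<kappa>) (rn_data.rn_spheres R d Q f u \<kappa>)
          - (real d - 1) / sqrt (fact d)\<bar> < \<epsilon>) at_top"
    proof (rule eventually_mono[OF small], intro allI impI, goal_cases)
      case (1 q R Q e f V0 u \<kappa>)
      interpret rn_construction R d Q e f V0 u \<kappa>
        using 1 by simp
      interpret pc: point_count d "order R" "real (card rn_points)"
        by (rule point_count[OF d])
      show ?case
        unfolding K_const_eq[OF d]
        using pc.K_limit_bound 1 by simp
    qed
  qed
qed

end
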